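(* Let $p>2$, $q>p-1$ and $h\in L^1_{loc}(\mathbb{R}^N)$. Let $\mathcal{K}$ be the class of all $u\in W^{1,p}_{loc}(\mathbb{R}^N)\cap L^q_{loc}(\mathbb{R}^N)$ for which there exist $\theta<\frac1{p-2}$ and $c>0$ (both possibly depending on $u$) such that $|\nabla u(x)|\le c|x|^\theta$ for (a.e.) $x$ with $|x|$ large. Then the problem $$-\Delta_p u+|u|^{q-1}u=h\quad\text{on }\mathbb{R}^N$$ has at most one weak solution $v$ in the class $\mathcal{K}$. Moreover, such a solution $v$ satisfies $$\inf_{\mathbb{R}^N}h\le |v|^{q-1}v\le\sup_{\mathbb{R}^N}h\quad\text{a.e. on }\mathbb{R}^N .$$
   Context: $\Delta_p u=\mathrm{div}(|\nabla u|^{p-2}\nabla u)$ is the $p$-Laplacian. $C^1_0(\mathbb{R}^N)$ denotes compactly supported $C^1$ functions. A function $u\in W^{1,p}_{loc}(\mathbb{R}^N)\cap L^q_{loc}(\mathbb{R}^N)$ is a weak solution if $\int_{\mathbb{R}^N}|\nabla u|^{p-2}\nabla u\cdot\nabla\phi+\int_{\mathbb{R}^N}|u|^{q-1}u\,\phi=\int_{\mathbb{R}^N}h\phi$ for every $\phi\in C^1_0(\mathbb{R}^N)$. $\inf$ and $\sup$ of $h$ are essential infimum and supremum, possibly $-\infty$, $+\infty$. *)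

theory Defs
  imports "HOL-Analysis.Analysis" "HOL-Probability.Essential_Supremum"
begin

definition L_loc :: "real \<Rightarrow> ('a::euclidean_space \<Rightarrow> 'b::euclidean_space) set" where
  "L_loc r = {f \<in> borel_measurable lebesgue.
     \<forall>K. compact K \<longrightarrow> set_integrable lebesgue K (\<lambda>x. norm (f x) powr r)}"

definition grad :: "('a::euclidean_space \<Rightarrow> real) \<Rightarrow> 'a \<Rightarrow> 'a" where
  "grad \<phi> x = (THE D. GDERIV \<phi> x :> D)"

definition C1_0 :: "('a::euclidean_space \<Rightarrow> real) set" where
  "C1_0 = {\<phi>. (\<forall>x. \<phi> differentiable (at x)) \<and> continuous_on UNIV (grad \<phi>) \<and>
               compact (closure {x. \<phi> x \<noteq> 0})}"

text \<open>
  Weak gradients, with \<open>C\<^sup>1\<close> test functions as in Gilbarg and Trudinger, Section 7.3.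
\<close>

definition has_weak_gradient ::
    "('a::euclidean_space \<Rightarrow> real) \<Rightarrow> ('a \<Rightarrow> 'a) \<Rightarrow> bool" where
  "has_weak_gradient u g \<longleftrightarrow> u \<in> L_loc 1 \<and> g \<in> L_loc 1 \<and>
     (\<forall>\<phi>\<in>C1_0. \<forall>i\<in>Basis.
        (LINT x|lebesgue. u x * (grad \<phi> x \<bullet> i)) = - (LINT x|lebesgue. (g x \<bullet> i) * \<phi> x))"

text \<open>
  A weak gradient is unique only up to a null set; \<open>weak_grad u\<close> is an arbitrary representative.
  It is meaningful only if \<open>u\<close> has a weak gradient, which \<open>W1_loc\<close> requires explicitly.
\<close>

definition weak_grad :: "('a::euclidean_space \<Rightarrow> real) \<Rightarrow> 'a \<Rightarrow> 'a" where
  "weak_grad u = (SOME g. has_weak_gradient u g)"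

definition W1_loc :: "real \<Rightarrow> ('a::euclidean_space \<Rightarrow> real) set" where
  "W1_loc p = {u \<in> L_loc p. (\<exists>g. has_weak_gradient u g) \<and> weak_grad u \<in> L_loc p}"

text \<open>Weak solutions of \<open>- \<Delta>\<^sub>p u + |u|\<^bsup>q-1\<^esup> u = h\<close> on the whole space.\<close>

definition weak_solution ::
    "real \<Rightarrow> real \<Rightarrow> ('a::euclidean_space \<Rightarrow> real) \<Rightarrow> ('a \<Rightarrow> real) \<Rightarrow> bool" where
  "weak_solution p q h u \<longleftrightarrow> u \<in> W1_loc p \<inter> L_loc q \<and>
     (\<forall>\<phi>\<in>C1_0.
        (LINT x|lebesgue. (norm (weak_grad u x) powr (p - 2) *\<^sub>R weak_grad u x) \<bullet> grad \<phi> x)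
        + (LINT x|lebesgue. \<bar>u x\<bar> powr (q - 1) * u x * \<phi> x)
        = (LINT x|lebesgue. h x * \<phi> x))"

definition class_K :: "real \<Rightarrow> real \<Rightarrow> ('a::euclidean_space \<Rightarrow> real) set" where
  "class_K p q = {u \<in> W1_loc p \<inter> L_loc q.
     \<exists>\<theta> c R. \<theta> < 1 / (p - 2) \<and> c > 0 \<and>
       (AE x in lebesgue. norm x \<ge> R \<longrightarrow> norm (weak_grad u x) \<le> c * norm x powr \<theta>)}"

definition essinf :: "'a measure \<Rightarrow> ('a \<Rightarrow> ereal) \<Rightarrow> ereal" where
  "essinf M f = Sup {z. AE x in M. z \<le> f x}"

end

theory Submission
  imports Defs
begin

text \<open>
  Both claims are instances of a comparison principle for sub- and supersolutions \<open>u\<close>, \<open>v\<close>: for the bounds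
  one of the two is the constant \<open>\<kappa>\<close> with \<open>|\<kappa>|\<^bsup>q-1\<^esup> \<kappa>\<close> equal to the supremum or infimum of \<open>h\<close>.
  Put \<open>w = u - v\<close>, \<open>F = |\<nabla>u|\<^bsup>p-2\<^esup> \<nabla>u - |\<nabla>v|\<^bsup>p-2\<^esup> \<nabla>v\<close> and
  \<open>G = |u|\<^bsup>q-1\<^esup> u - |v|\<^bsup>q-1\<^esup> v\<close>, fix \<open>k > 0\<close>, and test with \<open>\<psi>(w) \<eta>\<close>, where \<open>\<psi>\<close> is a bounded
  increasing function supported on \<open>w > k\<close> with \<open>\<psi> \<le> C \<psi>' G\<close> there (this uses \<open>q > 1\<close>) and \<open>\<eta>\<close> is a
  cutoff for the ball of radius \<open>R\<close> inside that of radius \<open>2R\<close>. The inequality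
  \<open>|F|\<^sup>2 \<le> C (|\<nabla>u|\<^bsup>p-2\<^esup> + |\<nabla>v|\<^bsup>p-2\<^esup>) F \<bullet> \<nabla>w\<close> and Cauchy's inequality absorb the gradient terms, so
  \<open>I(R)\<close>, the integral of \<open>G \<psi>(w)\<close> over the ball of radius \<open>R\<close>, satisfies
  \<open>I(R) \<le> C R\<^bsup>\<theta>(p-2)-2\<^esup> I(2R)\<close>. As the exponent is negative and \<open>I\<close> grows at most polynomially, iterating
  gives \<open>I = 0\<close>, that is \<open>w \<le> k\<close>. The test function is justified by mollifying \<open>w\<close>.
\<close>

subsection \<open>Test functions\<close>

text \<open>Cauchy's inequality splits the mixed term \<psi>(w) |F| |grad \<eta>| into the
  nonnegative term \<psi>'(w) \<eta> (F \<bullet> W), with W the gradient of w, and the product of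
  three quotients: |F|^2 / (F \<bullet> W), at most a multiple of R^(\<theta>(p-2)) on the annulus;
  |grad \<eta>|^2 / \<eta>, at most a multiple of R^(-2); and \<psi>^2 / \<psi>', at most a multiple
  of G \<psi>. The last one gives back the integrand of I, now on the ball of radius 2R. The level k
  > 0 keeps G bounded away from zero where w > k, so that G controls \<psi> / \<psi>' also close to
  w = k. The polynomial growth of I comes from the same tested inequality, with \<psi> \<le> 1 in
  place of the third quotient; a growth bound on the gradients is therefore enough. Test functions
  are only C^1, so bumps, cutoffs and truncations are all built from \<open>pos_sq\<close>, the
  simplest C^1 function that vanishes on a half-line.\<close>

definition pos_sq :: "real \<Rightarrow> real" where
  "pos_sq t = (max 0 t)\<^sup>2"

lemma pos_sq_nonneg [simp]: "0 \<le> pos_sq t"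
  by (simp add: pos_sq_def)

lemma DERIV_pos_sq: "(pos_sq has_real_derivative 2 * max 0 t) (at t)"
proof (cases "t = 0")
  case True
  have "((\<lambda>h. pos_sq h / h) \<longlongrightarrow> 0) (at 0)"
  proof (rule tendsto_sandwich)
    show "\<forall>\<^sub>F h in at 0. - \<bar>h\<bar> \<le> pos_sq h / h" "\<forall>\<^sub>F h in at 0. pos_sq h / h \<le> \<bar>h\<bar>"
      by (auto simp: pos_sq_def max_def power2_eq_square)
    show "((\<lambda>h::real. \<bar>h\<bar>) \<longlongrightarrow> 0) (at 0)"
      by (rule tendsto_rabs_zero) simp
    show "((\<lambda>h::real. - \<bar>h\<bar>) \<longlongrightarrow> 0) (at 0)"
      using tendsto_minus[OF tendsto_rabs_zero[OF tendsto_ident_at[of 0 UNIV]]] by simp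
  qed
  then show ?thesis
    using True by (simp add: DERIV_def pos_sq_def)
next
  case False
  show ?thesis
  proof (cases "t > 0")
    case True
    have "((\<lambda>t. t\<^sup>2) has_real_derivative 2 * max 0 t) (at t)"
      using True by (auto intro!: derivative_eq_intros)
    moreover have "\<forall>\<^sub>F s in nhds t. s\<^sup>2 = pos_sq s"
      by (rule eventually_mono[OF eventually_nhds_in_open[of "{0<..}" t]]) (use True in \<open>auto simp: pos_sq_def\<close>)
    ultimately show ?thesis
      by (rule DERIV_cong_ev[OF refl _ refl, THEN iffD1, rotated])
  next
    case f2: False
    have "((\<lambda>t. 0) has_real_derivative 2 * max 0 t) (at t)"
      using f2 by simp
    moreover have "\<forall>\<^sub>F s in nhds t. 0 = pos_sq s"
      by (rule eventually_mono[OF eventually_nhds_in_open[of "{..<0}" t]]) (use f2 False in \<open>auto simp: pos_sq_def max_def\<close>)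
    ultimately show ?thesis
      by (rule DERIV_cong_ev[OF refl _ refl, THEN iffD1, rotated])
  qed
qed

lemma GDERIV_unique:
  assumes "GDERIV f x :> D" "GDERIV f x :> E"
  shows "D = E"
proof -
  have "(\<lambda>h. h \<bullet> D) = (\<lambda>h. h \<bullet> E)"
    using assms unfolding gderiv_def by (rule has_derivative_unique)
  then have "(D - E) \<bullet> D = (D - E) \<bullet> E"
    by meson
  then show ?thesis
    by (metis eq_iff_diff_eq_0 inner_diff_right inner_eq_zero_iff)
qed

lemma grad_eqI: "GDERIV f x :> D \<Longrightarrow> grad f x = D"
  unfolding grad_def by (blast intro: GDERIV_unique)

text \<open>The Riesz vector of the derivative, assembled from its values on \<open>Basis\<close>,
  exists and is unique, so the definite description in \<open>grad\<close> denotes it.\<close>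

lemma GDERIV_grad:
  fixes f :: "'a::euclidean_space \<Rightarrow> real"
  assumes "f differentiable (at x)"
  shows "GDERIV f x :> grad f x"
proof -
  obtain f' where f': "(f has_derivative f') (at x)"
    using assms by (auto simp: differentiable_def)
  have "f' = (\<lambda>h. h \<bullet> (\<Sum>b\<in>Basis. f' b *\<^sub>R b))"
  proof
    fix h
    interpret linear f' by (rule has_derivative_linear[OF f'])
    have "f' h = f' (\<Sum>b\<in>Basis. (h \<bullet> b) *\<^sub>R b)"
      by (simp add: euclidean_representation)
    also have "\<dots> = h \<bullet> (\<Sum>b\<in>Basis. f' b *\<^sub>R b)"
      by (simp add: sum scaleR inner_sum_right mult.commute)
    finally show "f' h = h \<bullet> (\<Sum>b\<in>Basis. f' b *\<^sub>R b)" .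
  qed
  then have "GDERIV f x :> (\<Sum>b\<in>Basis. f' b *\<^sub>R b)"
    using f' by (simp add: gderiv_def)
  then show ?thesis
    using grad_eqI by metis
qed

lemma GDERIV_imp_differentiable: "GDERIV f x :> D \<Longrightarrow> f differentiable (at x)"
  by (auto simp: gderiv_def differentiable_def)

lemma C1_0_I:
  fixes f :: "'a::euclidean_space \<Rightarrow> real"
  assumes "\<And>x. GDERIV f x :> D x" "continuous_on UNIV D" "\<And>x. norm x > R \<Longrightarrow> f x = 0"
  shows "f \<in> C1_0"
proof -
  have "grad f = D"
    using assms(1) grad_eqI by blast
  moreover have "bounded {x. f x \<noteq> 0}"
    using assms(3) unfolding bounded_iff by (metis linorder_not_le mem_Collect_eq)
  ultimately show ?thesis
    using assms by (auto simp: C1_0_def intro: GDERIV_imp_differentiable)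
qed

lemma C1_0_D:
  fixes f :: "'a::euclidean_space \<Rightarrow> real"
  assumes "f \<in> C1_0"
  shows "GDERIV f x :> grad f x" "continuous_on UNIV (grad f)" "continuous_on UNIV f"
proof -
  show "GDERIV f x :> grad f x" for x
    using assms by (auto simp: C1_0_def intro: GDERIV_grad)
  show "continuous_on UNIV (grad f)" "continuous_on UNIV f"
    using assms by (auto simp: C1_0_def continuous_on_eq_continuous_at differentiable_imp_continuous_within)
qed

lemma C1_0_measurable [measurable_dest]:
  fixes f :: "'a::euclidean_space \<Rightarrow> real"
  assumes "f \<in> C1_0"
  shows "f \<in> borel_measurable borel" "grad f \<in> borel_measurable borel"
  using C1_0_D[OF assms] by (auto intro: borel_measurable_continuous_onI)

lemma C1_0_support:
  fixes f :: "'a::euclidean_space \<Rightarrow> real"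
  assumes "f \<in> C1_0"
  obtains R where "R > 0" "\<And>x. norm x > R \<Longrightarrow> f x = 0" "\<And>x. norm x > R \<Longrightarrow> grad f x = 0"
proof -
  have "bounded {x. f x \<noteq> 0}"
    using assms by (auto simp: C1_0_def compact_closure)
  then obtain R where R: "R > 0" "\<And>x. f x \<noteq> 0 \<Longrightarrow> norm x \<le> R"
    unfolding bounded_pos by blast
  have "grad f x = 0" if "norm x > R" for x
  proof (rule grad_eqI)
    have "open (- cball 0 R :: 'a set)" by auto
    moreover have "f y = 0" if "y \<in> - cball 0 R" for y
      using R(2)[of y] that by force
    ultimately show "GDERIV f x :> 0"
      using that has_derivative_transform_within_open[OF GDERIV_const[of 0 x, unfolded gderiv_def], of "- cball 0 R" f]
      by (auto simp: gderiv_def)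
  qed
  with R show thesis
    using that by force
qed

lemma continuous_compact_support_bounded:
  fixes f :: "'a::euclidean_space \<Rightarrow> 'b::real_normed_vector"
  assumes "continuous_on UNIV f" "\<And>x. norm x > R \<Longrightarrow> f x = 0"
  obtains B where "B > 0" "\<And>x. norm (f x) \<le> B"
proof -
  have "compact (f ` cball 0 R)"
    using assms by (intro compact_continuous_image continuous_on_subset[OF assms(1)]) auto
  then obtain B where B: "B > 0" "\<And>x. x \<in> cball 0 R \<Longrightarrow> norm (f x) \<le> B"
    using compact_imp_bounded bounded_pos by (metis image_eqI)
  then have "norm (f x) \<le> B" for x
    using assms(2)[of x] by (cases "norm x \<le> R") (auto simp: less_imp_le)
  with B show thesis using that by blast
qed

lemma C1_0_bounds:
  fixes f :: "'a::euclidean_space \<Rightarrow> real"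
  assumes "f \<in> C1_0"
  obtains R B where "R > 0" "B > 0" "\<And>x. \<bar>f x\<bar> \<le> B * indicator (cball 0 R) x"
    "\<And>x. norm (grad f x) \<le> B * indicator (cball 0 R) x"
proof -
  obtain R where R: "R > 0" "\<And>x. norm x > R \<Longrightarrow> f x = 0" "\<And>x. norm x > R \<Longrightarrow> grad f x = 0"
    using C1_0_support[OF assms] by blast
  obtain B1 where B1: "B1 > 0" "\<And>x. norm (f x) \<le> B1"
    using continuous_compact_support_bounded[OF C1_0_D(3)[OF assms] R(2)] by blast
  obtain B2 where B2: "B2 > 0" "\<And>x. norm (grad f x) \<le> B2"
    using continuous_compact_support_bounded[OF C1_0_D(2)[OF assms] R(3)] by blast
  show thesis
  proof (rule that[of R "max B1 B2"])
    show "\<bar>f x\<bar> \<le> max B1 B2 * indicator (cball 0 R) x" for x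
      using B1(2)[of x] R(2)[of x] B1(1) by (auto simp: indicator_def)
    show "norm (grad f x) \<le> max B1 B2 * indicator (cball 0 R) x" for x
      using B2(2)[of x] R(3)[of x] B2(1) by (auto simp: indicator_def)
  qed (use R B1 in auto)
qed

lemma integrable_compact_support_bounded:
  fixes f :: "'a::euclidean_space \<Rightarrow> 'b::{banach, second_countable_topology}"
  assumes [measurable]: "f \<in> borel_measurable borel"
    and "\<And>x. norm (f x) \<le> B * indicator (cball 0 R) x"
  shows "integrable lborel f"
proof (rule Bochner_Integration.integrable_bound)
  show "integrable lborel (\<lambda>x. B * indicator (cball 0 R) x :: real)"
    by (intro integrable_mult_right integrable_real_indicator emeasure_bounded_finite) auto
  show "AE x in lborel. norm (f x) \<le> norm (B * indicator (cball 0 R) x :: real)"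
    using assms(2) by (auto intro: order_trans abs_ge_self)
qed simp

lemma integrable_lborel_translate:
  fixes f :: "'a::euclidean_space \<Rightarrow> 'b::{banach, second_countable_topology}"
  assumes "integrable lborel f"
  shows "integrable lborel (\<lambda>x. f (c + x))"
proof -
  have "integrable (distr lborel borel ((+) c)) f"
    using assms by (simp add: lborel_distr_plus)
  then show ?thesis
    using assms by (subst (asm) integrable_distr_eq) auto
qed

lemma integral_lborel_translate:
  fixes f :: "'a::euclidean_space \<Rightarrow> 'b::{banach, second_countable_topology}"
  assumes [measurable]: "f \<in> borel_measurable borel"
  shows "(\<integral>x. f (c + x) \<partial>lborel) = (\<integral>x. f x \<partial>lborel)"
proof -
  have "(\<integral>x. f x \<partial>lborel) = (\<integral>x. f x \<partial>distr lborel borel ((+) c))"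
    by (simp add: lborel_distr_plus)
  also have "\<dots> = (\<integral>x. f (c + x) \<partial>lborel)"
    by (subst integral_distr) auto
  finally show ?thesis ..
qed

subsection \<open>Mollification\<close>

text \<open>Vector-valued, so that one operator smooths both a function and its weak
  gradient.\<close>

definition conv :: "('a::euclidean_space \<Rightarrow> real) \<Rightarrow> ('a \<Rightarrow> 'b::euclidean_space) \<Rightarrow> 'a \<Rightarrow> 'b" where
  "conv k f x = (\<integral>y. k (x - y) *\<^sub>R f y \<partial>lborel)"

lemma conv_measurable [measurable]:
  fixes f :: "'a::euclidean_space \<Rightarrow> 'b::euclidean_space"
  assumes [measurable]: "k \<in> borel_measurable borel" "f \<in> borel_measurable borel"
  shows "conv k f \<in> borel_measurable borel"
proof -
  have "(\<lambda>x. \<integral>y. k (x - y) *\<^sub>R f y \<partial>lborel) \<in> borel_measurable lborel"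
    by (rule lborel.borel_measurable_lebesgue_integral) measurable
  then show ?thesis
    by (simp add: conv_def[abs_def])
qed

text \<open>The kernel is itself a test function, so that its reflected translates can be inserted
  into the definition of the weak gradient.\<close>

definition mollifier :: "real \<Rightarrow> ('a::euclidean_space \<Rightarrow> real) \<Rightarrow> bool" where
  "mollifier r k \<longleftrightarrow> k \<in> C1_0 \<and> (\<forall>x. 0 \<le> k x) \<and> (\<forall>x. r \<le> norm x \<longrightarrow> k x = 0) \<and>
     (\<integral>x. k x \<partial>lborel) = 1"

lemma C1_0_integrable:
  fixes f :: "'a::euclidean_space \<Rightarrow> real"
  assumes "f \<in> C1_0"
  shows "integrable lborel f" "integrable lborel (grad f)"
proof -
  obtain R B where "\<And>x. \<bar>f x\<bar> \<le> B * indicator (cball 0 R) x"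
    "\<And>x. norm (grad f x) \<le> B * indicator (cball 0 R) x"
    using C1_0_bounds[OF assms] by metis
  then show "integrable lborel f" "integrable lborel (grad f)"
    using C1_0_measurable[OF assms] by (auto intro!: integrable_compact_support_bounded)
qed

lemma GDERIV_norm_square:
  fixes x :: "'a::euclidean_space"
  shows "GDERIV (\<lambda>x. (norm x)\<^sup>2) x :> 2 *\<^sub>R x"
  unfolding gderiv_def power2_norm_eq_inner
  by (auto intro!: derivative_eq_intros simp: inner_commute)

lemma mollifier_exists:
  fixes r :: real
  assumes "r > 0"
  obtains k :: "'a::euclidean_space \<Rightarrow> real" where "mollifier r k"
proof -
  \<comment> \<open>The squared norm keeps the bump differentiable at the origin.\<close>
  define k0 :: "'a \<Rightarrow> real" where "k0 x = pos_sq (r\<^sup>2 - (norm x)\<^sup>2)" for x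
  define D :: "'a \<Rightarrow> 'a" where "D x = (2 * max 0 (r\<^sup>2 - (norm x)\<^sup>2)) *\<^sub>R (0 - 2 *\<^sub>R x)" for x
  have D: "GDERIV k0 x :> D x" for x
    unfolding k0_def[abs_def] D_def
    by (rule GDERIV_DERIV_compose[OF GDERIV_diff[OF GDERIV_const GDERIV_norm_square] DERIV_pos_sq])
  have cD: "continuous_on UNIV D"
    unfolding D_def[abs_def] by (intro continuous_intros)
  have z: "k0 x = 0" if "r \<le> norm x" for x
    using power_mono[OF that, of 2] assms by (simp add: k0_def pos_sq_def max_def)
  have C: "k0 \<in> C1_0"
    by (rule C1_0_I[OF D cD, of r]) (auto intro: z)
  have k0_nonneg: "0 \<le> k0 x" for x
    by (simp add: k0_def)
  have int: "integrable lborel k0"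
    using C1_0_integrable[OF C] by simp
  have "k0 x > 0" if "x \<in> ball 0 r" for x
  proof -
    have "(norm x)\<^sup>2 < r\<^sup>2"
      using that assms by (intro power_strict_mono) auto
    then show ?thesis
      by (simp add: k0_def pos_sq_def max_def)
  qed
  then have "\<not> (AE x in lborel. k0 x = 0)"
  proof (intro notI)
    assume ae: "AE x in lborel. k0 x = 0" and pos: "\<And>x. x \<in> ball 0 r \<Longrightarrow> 0 < k0 x"
    from ae have "AE x in lborel. x \<notin> ball (0::'a) r"
      by (rule eventually_mono) (use pos in force)
    then have "emeasure lborel (ball (0::'a) r) = 0"
      by (subst (asm) AE_iff_measurable[where N="ball 0 r"]) auto
    then show False
      using content_ball_pos[OF assms, of "0::'a"] by (simp add: measure_def)
  qed
  then have "(\<integral>x. k0 x \<partial>lborel) \<noteq> 0"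
    using integral_nonneg_eq_0_iff_AE[OF int] k0_nonneg by auto
  moreover have "(\<integral>x. k0 x \<partial>lborel) \<ge> 0"
    by (intro Bochner_Integration.integral_nonneg k0_nonneg)
  ultimately have pos: "(\<integral>x. k0 x \<partial>lborel) > 0"
    by simp
  define c where "c = 1 / (\<integral>x. k0 x \<partial>lborel)"
  have "GDERIV (\<lambda>x. c * k0 x) x :> c *\<^sub>R D x + k0 x *\<^sub>R 0" for x
    by (rule GDERIV_mult[OF GDERIV_const D])
  then have "(\<lambda>x. c * k0 x) \<in> C1_0"
    using cD z by (intro C1_0_I[of _ "\<lambda>x. c *\<^sub>R D x" r]) (auto intro!: continuous_intros)
  then have "mollifier r (\<lambda>x. c * k0 x)"
    using pos z by (auto simp: mollifier_def c_def k0_def)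
  then show thesis by (rule that)
qed

text \<open>The second fact is phrased for a component of \<open>f\<close>; for real-valued
  \<open>f\<close> the choice \<open>b = 1\<close> recovers \<open>f\<close> itself.\<close>

lemma conv_kernel_integrable:
  fixes f :: "'a::euclidean_space \<Rightarrow> 'b::euclidean_space"
  assumes k: "k \<in> C1_0" and f: "integrable lborel f"
  shows "integrable lborel (\<lambda>y. k (x - y) *\<^sub>R f y)"
    and "integrable lborel (\<lambda>y. (f y \<bullet> b) *\<^sub>R grad k (x - y))"
proof -
  have [measurable]: "k \<in> borel_measurable borel" "grad k \<in> borel_measurable borel" "f \<in> borel_measurable borel"
    using k f by auto
  obtain R B where B: "B > 0" "\<And>x. \<bar>k x\<bar> \<le> B * indicator (cball 0 R) x"
    "\<And>x. norm (grad k x) \<le> B * indicator (cball 0 R) x"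
    using C1_0_bounds[OF k] by metis
  have B': "\<bar>k x\<bar> \<le> B" "norm (grad k x) \<le> B" for x
    using B(2)[of x] B(3)[of x] B(1) by (cases "norm x \<le> R"; simp)+
  have fb: "integrable lborel (\<lambda>y. f y \<bullet> b)"
    using f by simp
  show "integrable lborel (\<lambda>y. k (x - y) *\<^sub>R f y)"
    by (rule Bochner_Integration.integrable_bound[OF integrable_mult_right[OF integrable_norm[OF f], of B]])
       (use B' B(1) in \<open>auto simp: abs_mult intro!: mult_right_mono\<close>)
  show "integrable lborel (\<lambda>y. (f y \<bullet> b) *\<^sub>R grad k (x - y))"
    by (rule Bochner_Integration.integrable_bound[OF integrable_mult_right[OF integrable_norm[OF fb], of B]])
       (use B' B(1) in \<open>auto simp: abs_mult mult.commute[of B] intro!: mult_left_mono\<close>)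
qed

text \<open>Integrating in \<open>x\<close> first, translation invariance leaves just
  \<open>norm (f y)\<close>. Fubini's criterion is therefore checked in the order (y, x) and the
  pair swapped at the end.\<close>

lemma conv_product_integrable:
  fixes f :: "'a::euclidean_space \<Rightarrow> 'b::euclidean_space"
  assumes k: "mollifier r k" and f: "integrable lborel f"
  shows "integrable (lborel \<Otimes>\<^sub>M lborel) (\<lambda>(x, y). k (x - y) *\<^sub>R f y)"
    and "(\<integral>x. k (x - y) \<partial>lborel) = 1"
proof -
  have kC: "k \<in> C1_0" and k0: "\<And>x. 0 \<le> k x" and k1: "(\<integral>x. k x \<partial>lborel) = 1"
    using k by (auto simp: mollifier_def)
  have [measurable]: "k \<in> borel_measurable borel" "f \<in> borel_measurable borel"
    using kC f by auto
  have tr: "integrable lborel (\<lambda>x. k (x - y))" "(\<integral>x. k (x - y) \<partial>lborel) = 1" for y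
    using integrable_lborel_translate[OF C1_0_integrable(1)[OF kC], of "-y"]
      integral_lborel_translate[of k "-y"] k1 by auto
  show "(\<integral>x. k (x - y) \<partial>lborel) = 1"
    by (rule tr)
  have "integrable (lborel \<Otimes>\<^sub>M lborel) (\<lambda>(y, x). k (x - y) *\<^sub>R f y)"
  proof (rule lborel_pair.Fubini_integrable)
    show "(\<lambda>(y, x). k (x - y) *\<^sub>R f y) \<in> borel_measurable (lborel \<Otimes>\<^sub>M lborel)"
      by measurable
    have "(\<lambda>y. \<integral>x. norm (case (y, x) of (y, x) \<Rightarrow> k (x - y) *\<^sub>R f y) \<partial>lborel) = (\<lambda>y. norm (f y))"
      using k0 tr by (auto simp: abs_of_nonneg)
    then show "integrable lborel (\<lambda>y. \<integral>x. norm (case (y, x) of (y, x) \<Rightarrow> k (x - y) *\<^sub>R f y) \<partial>lborel)"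
      using f by simp
    show "AE y in lborel. integrable lborel (\<lambda>x. case (y, x) of (y, x) \<Rightarrow> k (x - y) *\<^sub>R f y)"
      using tr by auto
  qed
  from lborel_pair.integrable_product_swap[OF this]
  show "integrable (lborel \<Otimes>\<^sub>M lborel) (\<lambda>(x, y). k (x - y) *\<^sub>R f y)"
    by (simp add: case_prod_beta')
qed

lemma conv_integrable:
  fixes f :: "'a::euclidean_space \<Rightarrow> 'b::euclidean_space"
  assumes k: "mollifier r k" and f: "integrable lborel f"
  shows "integrable lborel (conv k f)" "(\<integral>x. conv k f x \<partial>lborel) = (\<integral>x. f x \<partial>lborel)"
proof -
  note I = conv_product_integrable[OF k f]
  have kC: "k \<in> C1_0" using k by (auto simp: mollifier_def)
  show "integrable lborel (conv k f)"
    using lborel_pair.integrable_fst[OF I(1)] by (simp add: conv_def[abs_def])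
  have "(\<integral>x. conv k f x \<partial>lborel) = (\<integral>y. (\<integral>x. k (x - y) *\<^sub>R f y \<partial>lborel) \<partial>lborel)"
    using lborel_pair.Fubini_integral[OF I(1)] by (simp add: conv_def[abs_def])
  also have "\<dots> = (\<integral>x. f x \<partial>lborel)"
  proof (rule Bochner_Integration.integral_cong)
    fix y
    have "integrable lborel (\<lambda>x. k (x - y))"
      using integrable_lborel_translate[OF C1_0_integrable(1)[OF kC], of "-y"] by simp
    then show "(\<integral>x. k (x - y) *\<^sub>R f y \<partial>lborel) = f y"
      using I(2)[of y] by simp
  qed simp
  finally show "(\<integral>x. conv k f x \<partial>lborel) = (\<integral>x. f x \<partial>lborel)" .
qed

lemma norm_conv_le:
  fixes f :: "'a::euclidean_space \<Rightarrow> 'b::euclidean_space"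
  assumes "\<And>x. 0 \<le> k x"
  shows "norm (conv k f x) \<le> conv k (\<lambda>y. norm (f y)) x"
proof -
  have "norm (conv k f x) \<le> (\<integral>y. norm (k (x - y) *\<^sub>R f y) \<partial>lborel)"
    unfolding conv_def by (rule integral_norm_bound)
  then show ?thesis
    using assms by (simp add: conv_def abs_of_nonneg)
qed

lemma conv_L1_contraction:
  fixes f :: "'a::euclidean_space \<Rightarrow> 'b::euclidean_space"
  assumes k: "mollifier r k" and f: "integrable lborel f"
  shows "(\<integral>x. norm (conv k f x) \<partial>lborel) \<le> (\<integral>x. norm (f x) \<partial>lborel)"
proof -
  have "(\<integral>x. norm (conv k f x) \<partial>lborel) \<le> (\<integral>x. conv k (\<lambda>y. norm (f y)) x \<partial>lborel)"
    using k by (intro integral_mono integrable_norm conv_integrable[OF k] f norm_conv_le) (auto simp: mollifier_def)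
  also have "\<dots> = (\<integral>x. norm (f x) \<partial>lborel)"
    by (rule conv_integrable[OF k integrable_norm[OF f]])
  finally show ?thesis .
qed

lemma conv_add:
  fixes f g :: "'a::euclidean_space \<Rightarrow> 'b::euclidean_space"
  assumes "k \<in> C1_0" "integrable lborel f" "integrable lborel g"
  shows "conv k (\<lambda>x. f x + g x) x = conv k f x + conv k g x"
  using conv_kernel_integrable(1)[OF assms(1,2)] conv_kernel_integrable(1)[OF assms(1,3)]
  by (simp add: conv_def scaleR_add_right)

lemma conv_diff:
  fixes f g :: "'a::euclidean_space \<Rightarrow> 'b::euclidean_space"
  assumes "k \<in> C1_0" "integrable lborel f" "integrable lborel g"
  shows "conv k (\<lambda>x. f x - g x) x = conv k f x - conv k g x"
  using conv_kernel_integrable(1)[OF assms(1,2)] conv_kernel_integrable(1)[OF assms(1,3)]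
  by (simp add: conv_def scaleR_diff_right)

lemma conv_local:
  assumes "mollifier r k" "\<And>y. norm (y - x) < r \<Longrightarrow> f y = g y"
  shows "conv k f x = conv k g x"
proof -
  have "k (x - y) *\<^sub>R f y = k (x - y) *\<^sub>R g y" for y
    using assms(2)[of y] assms(1) by (cases "norm (y - x) < r") (auto simp: mollifier_def norm_minus_commute)
  then show ?thesis
    unfolding conv_def by presburger
qed

lemma conv_const:
  assumes "mollifier r k"
  shows "conv k (\<lambda>_. c) x = c"
proof -
  have kC: "k \<in> C1_0" using assms by (auto simp: mollifier_def)
  have [measurable]: "k \<in> borel_measurable borel" using kC by auto
  \<comment> \<open>Reflection at the origin followed by a translation: an affine map with factor
    -1, hence measure preserving.\<close>
  have "distr lborel borel ((+) x \<circ> uminus) = (lborel::'a measure)"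
    using lborel_affine[of "-1" x] by (simp add: density_1 comp_def)
  then have "(\<integral>y. k y \<partial>lborel) = (\<integral>y. k y \<partial>distr lborel borel (\<lambda>y. x - y))" "integrable (distr lborel borel (\<lambda>y. x - y)) k"
    using C1_0_integrable[OF kC] by (simp_all add: comp_def)
  then have "(\<integral>y. k (x - y) \<partial>lborel) = 1" "integrable lborel (\<lambda>y. k (x - y))"
    using assms by (simp_all add: mollifier_def integral_distr integrable_distr_eq)
  then show ?thesis
    by (simp add: conv_def)
qed

text \<open>Mollification preserves the integral, so the \<open>L\<^sup>1\<close> distance is twice the integral of the positive
  part of \<open>indicator U - conv k (indicator U)\<close>. On an open set this vanishes pointwise in the limit.\<close>

lemma conv_indicator_open_tendsto:
  fixes U :: "'a::euclidean_space set" and k :: "nat \<Rightarrow> 'a \<Rightarrow> real"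
  assumes k: "\<And>n. mollifier (r n) (k n)" and r: "r \<longlonglongrightarrow> 0"
    and U: "open U" "emeasure lborel U < \<infinity>"
  shows "(\<lambda>n. \<integral>x. \<bar>conv (k n) (indicat_real U) x - indicat_real U x\<bar> \<partial>lborel) \<longlonglongrightarrow> 0"
proof -
  let ?I = "indicator U :: 'a \<Rightarrow> real"
  have int: "integrable lborel ?I"
    using U by (intro integrable_real_indicator) auto
  note ci = conv_integrable[OF k int]
  have nn: "0 \<le> conv (k n) ?I x" for n x
    unfolding conv_def using k by (intro Bochner_Integration.integral_nonneg) (auto simp: mollifier_def)
  have eq: "(\<integral>x. \<bar>conv (k n) ?I x - ?I x\<bar> \<partial>lborel) = 2 * (\<integral>x. max 0 (?I x - conv (k n) ?I x) \<partial>lborel)" for n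
  proof -
    have "(\<integral>x. \<bar>conv (k n) ?I x - ?I x\<bar> \<partial>lborel)
        = (\<integral>x. 2 * max 0 (?I x - conv (k n) ?I x) + (conv (k n) ?I x - ?I x) \<partial>lborel)"
      by (intro Bochner_Integration.integral_cong) (auto simp: max_def abs_if)
    also have "\<dots> = 2 * (\<integral>x. max 0 (?I x - conv (k n) ?I x) \<partial>lborel)"
      using ci[of n] int by simp
    finally show ?thesis .
  qed
  have "(\<lambda>n. \<integral>x. max 0 (?I x - conv (k n) ?I x) \<partial>lborel) \<longlonglongrightarrow> (\<integral>x. 0 \<partial>(lborel :: 'a measure))"
  proof (rule integral_dominated_convergence)
    show "integrable lborel ?I" by (rule int)
    show "AE x in lborel. norm (max 0 (?I x - conv (k n) ?I x)) \<le> ?I x" for n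
      using nn by (intro AE_I2) (auto simp: indicator_def)
    show "(\<lambda>x. max 0 (?I x - conv (k n) ?I x)) \<in> borel_measurable lborel" for n
      using ci[of n] int by auto
    show "AE x in lborel. (\<lambda>n. max 0 (?I x - conv (k n) ?I x)) \<longlonglongrightarrow> 0"
    proof (intro AE_I2)
      fix x
      have "\<forall>\<^sub>F n in sequentially. max 0 (?I x - conv (k n) ?I x) = 0"
      proof (cases "x \<in> U")
        case True
        then obtain e where e: "e > 0" "ball x e \<subseteq> U"
          using U(1) by (auto simp: open_contains_ball)
        from r e(1) have "\<forall>\<^sub>F n in sequentially. r n < e"
          by (rule order_tendstoD(2))
        then show ?thesis
        proof eventually_elim
          case (elim n)
          have "conv (k n) ?I x = conv (k n) (\<lambda>_. 1) x"
            using elim e(2) by (intro conv_local[OF k]) (auto simp: indicator_def dist_norm norm_minus_commute subset_eq)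
          then show ?case
            using conv_const[OF k, of n "1::real" x] True by simp
        qed
      qed (use nn in auto)
      then show "(\<lambda>n. max 0 (?I x - conv (k n) ?I x)) \<longlonglongrightarrow> 0"
        by (rule tendsto_eventually)
    qed
  qed simp
  then show ?thesis
    unfolding eq by (auto intro: tendsto_mult_right_zero)
qed

text \<open>Density argument along \<open>integrable_induct\<close>: outer regularity replaces a
  Borel set by an open one, for which the preceding lemma gives the convergence.\<close>

lemma conv_L1_tendsto:
  fixes f :: "'a::euclidean_space \<Rightarrow> 'b::euclidean_space" and k :: "nat \<Rightarrow> 'a \<Rightarrow> real"
  assumes k: "\<And>n. mollifier (r n) (k n)" and r: "r \<longlonglongrightarrow> 0" and f: "integrable lborel f"
  shows "(\<lambda>n. \<integral>x. norm (conv (k n) f x - f x) \<partial>lborel) \<longlonglongrightarrow> 0"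
proof -
  have kC: "k n \<in> C1_0" for n using k by (auto simp: mollifier_def)
  \<comment> \<open>an \<open>L\<^sup>1\<close> limit of functions with the property has the property, since \<open>conv\<close> is a contraction\<close>
  have approx: "(\<lambda>n. \<integral>x. norm (conv (k n) f x - f x) \<partial>lborel) \<longlonglongrightarrow> 0"
    if f: "integrable lborel f" and ex: "\<And>e. e > 0 \<Longrightarrow> \<exists>g. integrable lborel g \<and>
      (\<integral>x. norm (f x - g x) \<partial>lborel) < e \<and> (\<lambda>n. \<integral>x. norm (conv (k n) g x - g x) \<partial>lborel) \<longlonglongrightarrow> 0"
    for f :: "'a \<Rightarrow> 'b"
  proof (rule LIMSEQ_I)
    fix e :: real assume "e > 0"
    then obtain g where g: "integrable lborel g" "(\<integral>x. norm (f x - g x) \<partial>lborel) < e/4"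
      "(\<lambda>n. \<integral>x. norm (conv (k n) g x - g x) \<partial>lborel) \<longlonglongrightarrow> 0"
      using ex[of "e/4"] by auto
    from g(3) \<open>e > 0\<close> obtain N where N: "\<And>n. n \<ge> N \<Longrightarrow> (\<integral>x. norm (conv (k n) g x - g x) \<partial>lborel) < e/4"
      using order_tendstoD(2)[of _ 0 sequentially "e/4"] unfolding eventually_sequentially by force
    have "norm ((\<integral>x. norm (conv (k n) f x - f x) \<partial>lborel) - 0) < e" if "n \<ge> N" for n
    proof -
      have i: "integrable lborel (\<lambda>x. f x - g x)" using f g by simp
      note c = conv_integrable(1)[OF k, of _ n]
      have "(\<integral>x. norm (conv (k n) f x - f x) \<partial>lborel)
         \<le> (\<integral>x. norm (conv (k n) (\<lambda>x. f x - g x) x) + norm (conv (k n) g x - g x) + norm (f x - g x) \<partial>lborel)"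
      proof (rule integral_mono)
        fix x
        have "conv (k n) f x - f x = conv (k n) (\<lambda>x. f x - g x) x + (conv (k n) g x - g x) - (f x - g x)"
          using conv_diff[OF kC f g(1), of n x] by simp
        then show "norm (conv (k n) f x - f x) \<le> norm (conv (k n) (\<lambda>x. f x - g x) x) + norm (conv (k n) g x - g x) + norm (f x - g x)"
          by (metis (no_types, lifting) add_mono_thms_linordered_semiring(3) norm_triangle_ineq norm_triangle_ineq4 order_trans)
      qed (use c[OF f] c[OF g(1)] c[OF i] f g i in auto)
      also have "\<dots> = (\<integral>x. norm (conv (k n) (\<lambda>x. f x - g x) x) \<partial>lborel) + (\<integral>x. norm (conv (k n) g x - g x) \<partial>lborel) + (\<integral>x. norm (f x - g x) \<partial>lborel)"
        using c[OF f] c[OF g(1)] c[OF i] f g i by simp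
      also have "\<dots> \<le> (\<integral>x. norm (f x - g x) \<partial>lborel) + e/4 + e/4"
        using conv_L1_contraction[OF k i, of n] N[OF that] g(2) by simp
      also have "\<dots> < e" using g(2) \<open>e > 0\<close> by simp
      finally show ?thesis by simp
    qed
    then show "\<exists>N. \<forall>n\<ge>N. norm ((\<integral>x. norm (conv (k n) f x - f x) \<partial>lborel) - 0) < e" by blast
  qed
  from f show ?thesis
  proof (induct rule: integrable_induct)
    case (base A c)
    then have iA: "integrable lborel (indicator A :: 'a \<Rightarrow> real)"
      by (intro integrable_real_indicator) auto
    show ?case
    proof (rule approx)
      show "integrable lborel (\<lambda>x. indicat_real A x *\<^sub>R c)" using iA by simp
      fix e :: real assume e: "e > 0"
      \<comment> \<open>The added 1 covers the case \<open>c = 0\<close>.\<close>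
      define e' where "e' = e / (norm c + 1)"
      have e': "e' > 0" "norm c * e' < e"
        using e add_nonneg_pos[of "norm c" 1] by (auto simp: e'_def divide_simps mult.commute algebra_simps)
      obtain U where U: "open U" "A \<subseteq> U" "emeasure lborel (U - A) < e'"
        using outer_regular_lborel[of A e'] base e' by auto
      have [measurable]: "A \<in> sets borel" "U \<in> sets borel" using base U by auto
      have finUA: "emeasure lborel (U - A) < \<infinity>" using U(3) by (metis ennreal_less_top infinity_ennreal_def order_less_trans)
      have "emeasure lborel U \<le> emeasure lborel A + emeasure lborel (U - A)"
        using emeasure_subadditive[of A lborel "U - A"] U(2) by (simp add: Un_absorb1)
      then have finU: "emeasure lborel U < \<infinity>"
        using finUA base(2) by (metis ennreal_add_less_top infinity_ennreal_def order_le_less_trans)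
      let ?I = "indicator U :: 'a \<Rightarrow> real"
      have int: "integrable lborel ?I"
        using finU by (intro integrable_real_indicator) auto
      show "\<exists>g. integrable lborel g \<and> (\<integral>x. norm (indicat_real A x *\<^sub>R c - g x) \<partial>lborel) < e \<and>
         (\<lambda>n. \<integral>x. norm (conv (k n) g x - g x) \<partial>lborel) \<longlonglongrightarrow> 0"
      proof (intro exI[of _ "\<lambda>x. ?I x *\<^sub>R c"] conjI)
        show "integrable lborel (\<lambda>x. ?I x *\<^sub>R c)" using int by simp
        have "(\<integral>x. norm (indicat_real A x *\<^sub>R c - ?I x *\<^sub>R c) \<partial>lborel) = (\<integral>x. norm c * indicator (U - A) x \<partial>lborel)"
          using U(2) by (intro Bochner_Integration.integral_cong) (auto simp: indicator_def)
        also have "\<dots> = norm c * measure lborel (U - A)" by simp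
        also have "measure lborel (U - A) \<le> e'"
          using U(3) e' unfolding measure_def by (simp add: enn2real_leI less_imp_le)
        then have "norm c * measure lborel (U - A) < e" using e'(2)
          by (meson mult_left_mono norm_ge_zero order_le_less_trans)
        finally show "(\<integral>x. norm (indicat_real A x *\<^sub>R c - ?I x *\<^sub>R c) \<partial>lborel) < e" .
        have "norm (conv (k n) (\<lambda>x. ?I x *\<^sub>R c) x - ?I x *\<^sub>R c) = norm c * \<bar>conv (k n) ?I x - ?I x\<bar>" for n x
        proof -
          have "conv (k n) (\<lambda>x. ?I x *\<^sub>R c) x = conv (k n) ?I x *\<^sub>R c"
            using conv_kernel_integrable(1)[OF kC int, of n x] by (simp add: conv_def)
          then show ?thesis by (simp add: scaleR_diff_left[symmetric])
        qed
        then show "(\<lambda>n. \<integral>x. norm (conv (k n) (\<lambda>x. ?I x *\<^sub>R c) x - ?I x *\<^sub>R c) \<partial>lborel) \<longlonglongrightarrow> 0"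
          using tendsto_mult_right_zero[OF conv_indicator_open_tendsto[OF k r U(1) finU], of "norm c"] by simp
      qed
    qed
  next
    case (add f g)
    show ?case
    proof (rule tendsto_sandwich[OF _ _ tendsto_const])
      show "\<forall>\<^sub>F n in sequentially. 0 \<le> (\<integral>x. norm (conv (k n) (\<lambda>x. f x + g x) x - (f x + g x)) \<partial>lborel)"
        by simp
      show "(\<lambda>n. (\<integral>x. norm (conv (k n) f x - f x) \<partial>lborel) + (\<integral>x. norm (conv (k n) g x - g x) \<partial>lborel)) \<longlonglongrightarrow> 0"
        using tendsto_add[OF add(2,4)] by simp
      show "\<forall>\<^sub>F n in sequentially. (\<integral>x. norm (conv (k n) (\<lambda>x. f x + g x) x - (f x + g x)) \<partial>lborel)
          \<le> (\<integral>x. norm (conv (k n) f x - f x) \<partial>lborel) + (\<integral>x. norm (conv (k n) g x - g x) \<partial>lborel)"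
      proof (intro always_eventually allI)
        fix n
        note c = conv_integrable(1)[OF k add(1), of n] conv_integrable(1)[OF k add(3), of n]
        have "(\<integral>x. norm (conv (k n) (\<lambda>x. f x + g x) x - (f x + g x)) \<partial>lborel)
            \<le> (\<integral>x. norm (conv (k n) f x - f x) + norm (conv (k n) g x - g x) \<partial>lborel)"
        proof (rule integral_mono)
          show "norm (conv (k n) (\<lambda>x. f x + g x) x - (f x + g x)) \<le> norm (conv (k n) f x - f x) + norm (conv (k n) g x - g x)" for x
            using norm_triangle_ineq[of "conv (k n) f x - f x" "conv (k n) g x - g x"]
            by (simp add: conv_add[OF kC add(1,3)] algebra_simps)
        qed (use c conv_integrable(1)[OF k Bochner_Integration.integrable_add[OF add(1,3)], of n] add in auto)
        then show "(\<integral>x. norm (conv (k n) (\<lambda>x. f x + g x) x - (f x + g x)) \<partial>lborel)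
          \<le> (\<integral>x. norm (conv (k n) f x - f x) \<partial>lborel) + (\<integral>x. norm (conv (k n) g x - g x) \<partial>lborel)"
          using c add by simp
      qed
    qed
  next
    case (lim f s)
    show ?case
    proof (rule approx[OF lim(5)])
      fix e :: real assume e: "e > 0"
      have "(\<lambda>i. \<integral>x. norm (f x - s i x) \<partial>lborel) \<longlonglongrightarrow> (\<integral>x. 0 \<partial>(lborel::'a measure))"
      proof (rule integral_dominated_convergence)
        \<comment> \<open>The approximants supplied by the induction satisfy
          \<open>norm (s i x) \<le> 2 * norm (f x)\<close>, whence the factor 3.\<close>
        show "integrable lborel (\<lambda>x. 3 * norm (f x))" using lim(5) by simp
        show "AE x in lborel. norm (norm (f x - s i x)) \<le> 3 * norm (f x)" for i
        proof (intro AE_I2)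
          show "norm (norm (f x - s i x)) \<le> 3 * norm (f x)" for x
            using lim(4)[of x i] norm_triangle_ineq4[of "f x" "s i x"] by simp
        qed
        show "AE x in lborel. (\<lambda>i. norm (f x - s i x)) \<longlonglongrightarrow> 0"
          using lim(3) by (intro AE_I2) (auto intro!: tendsto_eq_intros)
      qed (use lim(1,5) in auto)
      then obtain i where "(\<integral>x. norm (f x - s i x) \<partial>lborel) < e"
        using order_tendstoD(2)[of _ 0 sequentially e] e by (auto simp: eventually_sequentially)
      then show "\<exists>g. integrable lborel g \<and> (\<integral>x. norm (f x - g x) \<partial>lborel) < e \<and>
         (\<lambda>n. \<integral>x. norm (conv (k n) g x - g x) \<partial>lborel) \<longlonglongrightarrow> 0"
        using lim(1,2) by blast
    qed
  qed
qed

lemma C1_0_grad_uniform: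
  fixes k :: "'a::euclidean_space \<Rightarrow> real"
  assumes k: "k \<in> C1_0" and e: "e > 0"
  obtains d where "d > 0" "\<And>x y. norm (x - y) < d \<Longrightarrow> norm (grad k x - grad k y) \<le> e"
proof -
  obtain R where R: "R > 0" "\<And>x. norm x > R \<Longrightarrow> grad k x = 0"
    using C1_0_support[OF k] by metis
  \<comment> \<open>One unit of margin: two points closer than 1, one of them outside the larger
    ball, both lie where the gradient vanishes.\<close>
  have "uniformly_continuous_on (cball 0 (R + 1)) (grad k)"
    using C1_0_D(2)[OF k] by (intro compact_uniformly_continuous) (auto intro: continuous_on_subset)
  then obtain d where d: "d > 0" "\<And>x y. x \<in> cball 0 (R+1) \<Longrightarrow> y \<in> cball 0 (R+1) \<Longrightarrow> dist x y < d
      \<Longrightarrow> dist (grad k x) (grad k y) < e"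
    using e unfolding uniformly_continuous_on_def by metis
  show thesis
  proof (rule that[of "min d 1"])
    fix x y :: 'a assume xy: "norm (x - y) < min d 1"
    show "norm (grad k x - grad k y) \<le> e"
    proof (cases "norm x \<le> R + 1 \<and> norm y \<le> R + 1")
      case True
      then show ?thesis using d(2)[of x y] xy by (simp add: dist_norm)
    next
      case False
      have "norm x \<le> norm y + norm (x - y)" "norm y \<le> norm x + norm (x - y)"
        by norm+
      then have "norm x > R" "norm y > R"
        using False xy by auto
      then show ?thesis using R(2) e by simp
    qed
  qed (use d in auto)
qed

text \<open>Mean value inequality for \<open>k y - y \<bullet> grad k z\<close> on a ball around
  \<open>z\<close>, where its gradient is small by uniform continuity. The point is that
  \<open>d\<close> does not depend on \<open>z\<close>, so the remainder can be integrated.\<close>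

lemma C1_0_uniform_differentiable:
  fixes k :: "'a::euclidean_space \<Rightarrow> real"
  assumes k: "k \<in> C1_0" and e: "e > 0"
  obtains d where "d > 0" "\<And>z h. norm h < d \<Longrightarrow> \<bar>k (z + h) - k z - h \<bullet> grad k z\<bar> \<le> e * norm h"
proof -
  obtain d where d: "d > 0" "\<And>x y. norm (x - y) < d \<Longrightarrow> norm (grad k x - grad k y) \<le> e"
    using C1_0_grad_uniform[OF assms] by blast
  show thesis
  proof (rule that[OF d(1)])
    fix z h :: 'a assume h: "norm h < d"
    have "norm ((k (z + h) - (z + h) \<bullet> grad k z) - (k z - z \<bullet> grad k z)) \<le> e * norm (z + h - z)"
    proof (rule differentiable_bound[of "ball z d" "\<lambda>y. k y - y \<bullet> grad k z" "\<lambda>y h. h \<bullet> (grad k y - grad k z)"])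
      fix y assume "y \<in> ball z d"
      then have n: "norm (grad k y - grad k z) \<le> e"
        using d(2)[of y z] by (simp add: dist_norm norm_minus_commute)
      have "((\<lambda>y. k y - y \<bullet> grad k z) has_derivative (\<lambda>h. h \<bullet> grad k y - h \<bullet> grad k z)) (at y)"
        using C1_0_D(1)[OF k, of y] unfolding gderiv_def
        by (intro has_derivative_diff has_derivative_inner_left has_derivative_ident) auto
      then show "((\<lambda>y. k y - y \<bullet> grad k z) has_derivative (\<lambda>h. h \<bullet> (grad k y - grad k z))) (at y within ball z d)"
        by (simp add: inner_diff_right has_derivative_at_withinI)
      show "onorm (\<lambda>h. h \<bullet> (grad k y - grad k z)) \<le> e"
      proof (rule onorm_bound)
        show "norm (h \<bullet> (grad k y - grad k z)) \<le> e * norm h" for h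
          using Cauchy_Schwarz_ineq2[of h "grad k y - grad k z"] n
          by (metis mult.commute mult_right_mono norm_ge_zero order_trans real_norm_def)
      qed (use e in simp)
    qed (use h d(1) in \<open>auto simp: dist_norm\<close>)
    then show "\<bar>k (z + h) - k z - h \<bullet> grad k z\<bar> \<le> e * norm h"
      by (simp add: inner_add_left algebra_simps)
  qed
qed

text \<open>The derivative falls on the kernel, so \<open>f\<close> need only be integrable: the
  first-order remainder of \<open>k\<close>, uniformly small in the base point, is integrated
  against |f|.\<close>

lemma GDERIV_conv:
  fixes f :: "'a::euclidean_space \<Rightarrow> real"
  assumes k: "k \<in> C1_0" and f: "integrable lborel f"
  shows "GDERIV (conv k f) x :> (\<integral>y. f y *\<^sub>R grad k (x - y) \<partial>lborel)"
proof -
  define I where "I = (\<integral>y. \<bar>f y\<bar> \<partial>lborel)"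
  have I0: "I \<ge> 0" unfolding I_def by simp
  have i1: "integrable lborel (\<lambda>y. k (x - y) * f y)" for x
    using conv_kernel_integrable(1)[OF k f, of x] by simp
  have i2: "integrable lborel (\<lambda>y. f y *\<^sub>R grad k (x - y))" for x
    using conv_kernel_integrable(2)[OF k f, of 1 x] by simp
  have inn: "h \<bullet> (\<integral>y. f y *\<^sub>R grad k (x - y) \<partial>lborel) = (\<integral>y. f y * (h \<bullet> grad k (x - y)) \<partial>lborel)"
    "integrable lborel (\<lambda>y. f y * (h \<bullet> grad k (x - y)))" for h
    using integral_inner_right[of h lborel "\<lambda>y. f y *\<^sub>R grad k (x - y)"] i2[of x]
      integrable_inner_right[of h lborel "\<lambda>y. f y *\<^sub>R grad k (x - y)"] by auto
  have "((\<lambda>h. norm (conv k f (x + h) - conv k f x - h \<bullet> (\<integral>y. f y *\<^sub>R grad k (x - y) \<partial>lborel)) / norm h) \<longlongrightarrow> 0) (at 0)"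
  proof (rule LIM_I)
    fix r :: real assume "r > 0"
    define e where "e = r / (I + 1)"
    have e: "e > 0" "e * I < r"
      using \<open>r > 0\<close> I0 by (auto simp: e_def divide_simps algebra_simps)
    obtain d where d: "d > 0" "\<And>z h. norm h < d \<Longrightarrow> \<bar>k (z + h) - k z - h \<bullet> grad k z\<bar> \<le> e * norm h"
      using C1_0_uniform_differentiable[OF k e(1)] by blast
    have "norm (norm (conv k f (x + h) - conv k f x - h \<bullet> (\<integral>y. f y *\<^sub>R grad k (x - y) \<partial>lborel)) / norm h - 0) < r"
      if h: "h \<noteq> 0" "norm (h - 0) < d" for h
    proof -
      have eq: "conv k f (x + h) - conv k f x - h \<bullet> (\<integral>y. f y *\<^sub>R grad k (x - y) \<partial>lborel)
          = (\<integral>y. k (x + h - y) * f y - k (x - y) * f y - f y * (h \<bullet> grad k (x - y)) \<partial>lborel)"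
        using i1 inn by (simp add: conv_def)
      have "norm (conv k f (x + h) - conv k f x - h \<bullet> (\<integral>y. f y *\<^sub>R grad k (x - y) \<partial>lborel)) \<le> (\<integral>y. norm (k (x + h - y) * f y - k (x - y) * f y - f y * (h \<bullet> grad k (x - y))) \<partial>lborel)"
        unfolding eq by (rule integral_norm_bound)
      also have "\<dots> \<le> (\<integral>y. e * norm h * \<bar>f y\<bar> \<partial>lborel)"
      proof (rule integral_mono)
        fix y
        have "k (x + h - y) * f y - k (x - y) * f y - f y * (h \<bullet> grad k (x - y))
            = (k ((x - y) + h) - k (x - y) - h \<bullet> grad k (x - y)) * f y"
          by (simp add: algebra_simps)
        then show "norm (k (x + h - y) * f y - k (x - y) * f y - f y * (h \<bullet> grad k (x - y))) \<le> e * norm h * \<bar>f y\<bar>"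
          using d(2)[of h "x - y"] h by (simp add: abs_mult mult_right_mono)
      qed (use i1 inn f in auto)
      also have "\<dots> = e * I * norm h"
        by (simp add: I_def)
      finally have "norm (conv k f (x + h) - conv k f x - h \<bullet> (\<integral>y. f y *\<^sub>R grad k (x - y) \<partial>lborel)) \<le> e * I * norm h" .
      then show ?thesis
        using e(2) h by (simp add: divide_le_eq order_le_less_trans)
    qed
    then show "\<exists>s>0. \<forall>h. h \<noteq> 0 \<and> norm (h - 0) < s \<longrightarrow>
      norm (norm (conv k f (x + h) - conv k f x - h \<bullet> (\<integral>y. f y *\<^sub>R grad k (x - y) \<partial>lborel)) / norm h - 0) < r"
      using d(1) by blast
  qed
  then show ?thesis
    unfolding gderiv_def has_derivative_at by (simp add: bounded_linear_inner_left)
qed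

lemma continuous_conv_grad:
  fixes f :: "'a::euclidean_space \<Rightarrow> real"
  assumes k: "k \<in> C1_0" and f: "integrable lborel f"
  shows "continuous_on UNIV (\<lambda>x. \<integral>y. f y *\<^sub>R grad k (x - y) \<partial>lborel)"
proof (rule continuous_at_imp_continuous_on, rule ballI, rule continuous_at_sequentiallyI)
  fix x :: 'a and s assume s: "s \<longlonglongrightarrow> x"
  have [measurable]: "grad k \<in> borel_measurable borel" "f \<in> borel_measurable borel" using k f by auto
  obtain R B where B: "B > 0" "\<And>x. norm (grad k x) \<le> B * indicator (cball 0 R) x"
    using C1_0_bounds[OF k] by metis
  have B': "norm (grad k x) \<le> B" for x
    using B(2)[of x] B(1) by (cases "norm x \<le> R"; simp)
  have cont: "isCont (grad k) z" for z
    using C1_0_D(2)[OF k] by (simp add: continuous_on_eq_continuous_at)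
  show "(\<lambda>n. \<integral>y. f y *\<^sub>R grad k (s n - y) \<partial>lborel) \<longlonglongrightarrow> (\<integral>y. f y *\<^sub>R grad k (x - y) \<partial>lborel)"
  proof (rule integral_dominated_convergence)
    show "integrable lborel (\<lambda>y. B * \<bar>f y\<bar>)" using f by simp
    show "AE y in lborel. norm (f y *\<^sub>R grad k (s n - y)) \<le> B * \<bar>f y\<bar>" for n
      using B' by (auto simp: mult.commute[of B] intro!: mult_left_mono)
    show "AE y in lborel. (\<lambda>n. f y *\<^sub>R grad k (s n - y)) \<longlonglongrightarrow> f y *\<^sub>R grad k (x - y)"
      using s by (auto intro!: tendsto_intros isCont_tendsto_compose[OF cont])
  qed auto
qed

section \<open>Jensen's inequality for mollifications and a dominated convergence theorem with
  moving bounds\<close>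

lemma powr_above_tangent:
  fixes a m p :: real
  assumes "0 \<le> a" "0 \<le> m" "1 \<le> p"
  shows "m powr p + p * m powr (p - 1) * (a - m) \<le> a powr p"
proof (cases "p = 1")
  case True
  \<comment> \<open>The split is due to \<open>m powr 0\<close>, which is 1 for positive
    \<open>m\<close> but 0 for \<open>m = 0\<close>.\<close>
  then show ?thesis using assms by (cases "m = 0") auto
next
  case False
  then have p: "p > 1" using assms by simp
  have mp: "m * m powr (p - 1) = m powr p"
    using assms(2) powr_mult_base[of m "p - 1"] by simp
  \<comment> \<open>Young's inequality for the conjugate exponents p and p / (p - 1), which is why p
    = 1 is treated apart.\<close>
  have "a * m powr (p - 1) \<le> a powr p / p + (m powr (p - 1)) powr (p / (p - 1)) / (p / (p - 1))"
    using p assms by (intro Youngs_inequality) (auto simp: field_simps)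
  also have "(m powr (p - 1)) powr (p / (p - 1)) = m powr p"
    using p by (simp add: powr_powr)
  finally have "p * (a * m powr (p - 1)) \<le> p * (a powr p / p + m powr p / (p / (p - 1)))"
    using p by (intro mult_left_mono) auto
  also have "\<dots> = a powr p + (p - 1) * m powr p"
    using p by (simp add: field_simps)
  finally show ?thesis
    using mp by (simp add: algebra_simps)
qed

text \<open>Jensen's inequality: the tangent at the mean value \<open>m = conv k f x\<close> is
  integrated against the kernel, a probability density, and its linear part averages out.\<close>

lemma conv_powr_le:
  fixes f :: "'a::euclidean_space \<Rightarrow> real"
  assumes k: "mollifier r k" and p: "1 \<le> p" and f0: "\<And>x. 0 \<le> f x"
    and f: "integrable lborel f" and fp: "integrable lborel (\<lambda>x. f x powr p)"
  shows "conv k f x powr p \<le> conv k (\<lambda>x. f x powr p) x"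
proof -
  have kC: "k \<in> C1_0" and k0: "\<And>x. 0 \<le> k x" using k by (auto simp: mollifier_def)
  define m where "m = conv k f x"
  have m: "m \<ge> 0"
    unfolding m_def conv_def using k0 f0 by (intro Bochner_Integration.integral_nonneg) auto
  have one: "(\<integral>y. k (x - y) \<partial>lborel) = 1"
    using conv_const[OF k, of "1::real" x] by (simp add: conv_def)
  \<comment> \<open>A nonintegrable function would have integral 0 by default, not 1.\<close>
  then have ik: "integrable lborel (\<lambda>y. k (x - y))"
    using not_integrable_integral_eq by fastforce
  have if1: "integrable lborel (\<lambda>y. k (x - y) * f y)" "integrable lborel (\<lambda>y. k (x - y) * f y powr p)"
    using conv_kernel_integrable(1)[OF kC f, of x] conv_kernel_integrable(1)[OF kC fp, of x] by auto
  have "m powr p = (m powr p - p * m powr (p - 1) * m) * (\<integral>y. k (x - y) \<partial>lborel)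
     + p * m powr (p - 1) * (\<integral>y. k (x - y) * f y \<partial>lborel)"
    using one by (simp add: m_def conv_def)
  also have "\<dots> = (\<integral>y. (m powr p - p * m powr (p - 1) * m) * k (x - y) + p * m powr (p - 1) * (k (x - y) * f y) \<partial>lborel)"
    using ik if1 by simp
  also have "\<dots> \<le> (\<integral>y. k (x - y) * f y powr p \<partial>lborel)"
  proof (rule integral_mono)
    fix y
    show "(m powr p - p * m powr (p - 1) * m) * k (x - y) + p * m powr (p - 1) * (k (x - y) * f y) \<le> k (x - y) * f y powr p"
      using mult_left_mono[OF powr_above_tangent[OF f0 m p, of y] k0[of "x - y"]]
      by (simp add: algebra_simps)
  qed (use ik if1 in auto)
  finally show ?thesis by (simp add: m_def conv_def)
qed

text \<open>Truncate \<open>f n\<close> to values between \<open>- G\<close> and \<open>G\<close>.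
  The truncations converge by ordinary dominated convergence, and what was cut off is at most
  \<open>\<bar>g n x - G x\<bar>\<close>, which tends to zero in mean.\<close>

lemma dominated_convergence_L1_bounds:
  fixes f g :: "nat \<Rightarrow> 'a \<Rightarrow> real"
  assumes [measurable]: "\<And>n. f n \<in> borel_measurable M" "F \<in> borel_measurable M"
    and g: "\<And>n. integrable M (g n)" and G: "integrable M G"
    and lim: "AE x in M. (\<lambda>n. f n x) \<longlonglongrightarrow> F x"
    and fg: "\<And>n. AE x in M. \<bar>f n x\<bar> \<le> g n x" and FG: "AE x in M. \<bar>F x\<bar> \<le> G x"
    and gG: "(\<lambda>n. \<integral>x. \<bar>g n x - G x\<bar> \<partial>M) \<longlonglongrightarrow> 0"
  shows "(\<lambda>n. \<integral>x. f n x \<partial>M) \<longlonglongrightarrow> (\<integral>x. F x \<partial>M)"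
proof -
  have [measurable]: "G \<in> borel_measurable M" "\<And>n. g n \<in> borel_measurable M" using G g by auto
  define t where "t n x = max (- G x) (min (G x) (f n x))" for n x
  have [measurable]: "t n \<in> borel_measurable M" for n
    unfolding t_def by measurable
  have G0: "AE x in M. 0 \<le> G x"
    using FG by eventually_elim auto
  have lt: "(\<lambda>n. \<integral>x. t n x \<partial>M) \<longlonglongrightarrow> (\<integral>x. F x \<partial>M)"
  proof (rule integral_dominated_convergence[where w=G])
    show "AE x in M. (\<lambda>n. t n x) \<longlonglongrightarrow> F x"
      using lim FG
    proof eventually_elim
      case (elim x)
      have "(\<lambda>n. t n x) \<longlonglongrightarrow> max (- G x) (min (G x) (F x))"
        unfolding t_def by (intro tendsto_intros elim)
      moreover have "max (- G x) (min (G x) (F x)) = F x"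
        using elim(2) by auto
      ultimately show ?case by simp
    qed
    show "AE x in M. norm (t n x) \<le> G x" for n
      using G0 by eventually_elim (auto simp: t_def)
  qed (use G in auto)
  have it: "integrable M (t n)" for n
    by (rule Bochner_Integration.integrable_bound[OF G]) (use G0 in \<open>auto simp: t_def elim!: eventually_mono\<close>)
  have if1: "integrable M (f n)" for n
    by (rule Bochner_Integration.integrable_bound[OF g[of n]]) (use fg[of n] in \<open>auto elim!: eventually_mono\<close>)
  have "(\<lambda>n. (\<integral>x. f n x \<partial>M) - (\<integral>x. t n x \<partial>M)) \<longlonglongrightarrow> 0"
  proof (rule Lim_null_comparison[OF _ gG], intro always_eventually allI)
    fix n
    have "norm ((\<integral>x. f n x \<partial>M) - (\<integral>x. t n x \<partial>M)) \<le> (\<integral>x. norm (f n x - t n x) \<partial>M)"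
      using integral_norm_bound[of M "\<lambda>x. f n x - t n x"] it[of n] if1[of n] by simp
    also have "\<dots> \<le> (\<integral>x. \<bar>g n x - G x\<bar> \<partial>M)"
    proof (rule integral_mono_AE)
      show "AE x in M. norm (f n x - t n x) \<le> \<bar>g n x - G x\<bar>"
        using fg[of n] G0 by eventually_elim (auto simp: t_def max_def min_def abs_if split: if_splits)
    qed (use it if1 g G in auto)
    finally show "norm ((\<integral>x. f n x \<partial>M) - (\<integral>x. t n x \<partial>M)) \<le> (\<integral>x. \<bar>g n x - G x\<bar> \<partial>M)" .
  qed
  from tendsto_add[OF this lt] show ?thesis by simp
qed

subsection \<open>Testing with a function of a Sobolev function\<close>

text \<open>Closed balls stand for all compact sets, each of which lies in one.\<close>

definition loc_integrable :: "('a::euclidean_space \<Rightarrow> 'b::euclidean_space) \<Rightarrow> bool" where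
  "loc_integrable f \<longleftrightarrow> f \<in> borel_measurable borel \<and>
     (\<forall>R. integrable lborel (\<lambda>x. indicator (cball 0 R) x *\<^sub>R f x))"

lemma loc_integrable_measurable [measurable_dest]: "loc_integrable f \<Longrightarrow> f \<in> borel_measurable borel"
  by (simp add: loc_integrable_def)

lemma loc_integrable_bound:
  fixes f :: "'a::euclidean_space \<Rightarrow> 'b::euclidean_space" and g :: "'a \<Rightarrow> real"
  assumes g: "loc_integrable g" and [measurable]: "f \<in> borel_measurable borel"
    and le: "\<And>x. norm (f x) \<le> g x"
  shows "loc_integrable f"
  unfolding loc_integrable_def
proof (intro conjI allI)
  fix R
  show "integrable lborel (\<lambda>x. indicat_real (cball 0 R) x *\<^sub>R f x)"
    by (rule Bochner_Integration.integrable_bound[of _ "\<lambda>x. indicator (cball 0 R) x *\<^sub>R g x"])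
       (use g le in \<open>auto simp: loc_integrable_def indicator_def intro: order_trans[OF _ abs_ge_self]\<close>)
qed simp

lemma loc_integrable_add:
  assumes "loc_integrable f" "loc_integrable g"
  shows "loc_integrable (\<lambda>x. f x + g x)"
  using assms by (auto simp: loc_integrable_def scaleR_add_right)

lemma loc_integrable_diff:
  assumes "loc_integrable f" "loc_integrable g"
  shows "loc_integrable (\<lambda>x. f x - g x)"
  using assms by (auto simp: loc_integrable_def scaleR_diff_right)

lemma loc_integrable_scale:
  assumes "loc_integrable f"
  shows "loc_integrable (\<lambda>x. c *\<^sub>R f x)"
proof -
  have "indicat_real A x *\<^sub>R c *\<^sub>R f x = c *\<^sub>R indicat_real A x *\<^sub>R f x" for A x
    by (rule scaleR_left_commute)
  then show ?thesis
    using assms unfolding loc_integrable_def by (auto simp del: scaleR_scaleR intro!: integrable_scaleR_right)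
qed

lemma loc_integrable_const: "loc_integrable (\<lambda>x. c)"
  unfolding loc_integrable_def
  by (auto intro!: integrable_real_indicator integrable_scaleR_left emeasure_bounded_finite)

lemma loc_integrable_norm: "loc_integrable f \<Longrightarrow> loc_integrable (\<lambda>x. norm (f x))"
proof -
  have "indicat_real A x * norm (f x) = norm (indicat_real A x *\<^sub>R f x)" for A x by simp
  then show "loc_integrable f \<Longrightarrow> loc_integrable (\<lambda>x. norm (f x))"
    unfolding loc_integrable_def real_scaleR_def by (auto simp del: norm_scaleR intro: integrable_norm)
qed

lemma loc_integrable_dominates:
  fixes f :: "'a::euclidean_space \<Rightarrow> 'b::euclidean_space" and g :: "'a \<Rightarrow> real"
  assumes g: "loc_integrable g" and [measurable]: "f \<in> borel_measurable borel"
    and le: "\<And>x. norm (f x) \<le> B * indicator (cball 0 R) x * g x"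
  shows "integrable lborel f"
proof (rule Bochner_Integration.integrable_bound)
  show "integrable lborel (\<lambda>x. B * (indicator (cball 0 R) x *\<^sub>R g x))"
    using g by (auto simp: loc_integrable_def)
  show "AE x in lborel. norm (f x) \<le> norm (B * (indicator (cball 0 R) x *\<^sub>R g x))"
    using le by (intro AE_I2) (auto simp: mult.assoc intro: order_trans[OF _ abs_ge_self])
qed simp

lemma mollifier_grad_zero:
  assumes "mollifier r k" "r < norm x"
  shows "grad k x = 0"
proof (rule grad_eqI)
  have "open (- cball 0 r :: 'a set)" by auto
  then show "GDERIV k x :> 0"
    using assms has_derivative_transform_within_open[OF GDERIV_const[of 0 x, unfolded gderiv_def], of "- cball 0 r" k]
    by (auto simp: gderiv_def mollifier_def)
qed

text \<open>Makes the kernel, as a function of the integration variable, a legitimate test function.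
  The sign produced by the reflection cancels the one from integration by parts.\<close>

lemma C1_0_reflect_translate:
  fixes k :: "'a::euclidean_space \<Rightarrow> real"
  assumes k: "k \<in> C1_0"
  shows "(\<lambda>y. k (x - y)) \<in> C1_0" "grad (\<lambda>y. k (x - y)) y = - grad k (x - y)"
proof -
  have g: "GDERIV (\<lambda>y. k (x - y)) y :> - grad k (x - y)" for y
  proof -
    have "((\<lambda>y. x - y) has_derivative (\<lambda>h. - h)) (at y)"
      by (auto intro!: derivative_eq_intros)
    from has_derivative_compose[OF this C1_0_D(1)[OF k, of "x - y", unfolded gderiv_def]]
    show ?thesis by (simp add: gderiv_def)
  qed
  then show "grad (\<lambda>y. k (x - y)) y = - grad k (x - y)"
    by (rule grad_eqI)
  obtain R where R: "\<And>x. norm x > R \<Longrightarrow> k x = 0"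
    using C1_0_support[OF k] by metis
  show "(\<lambda>y. k (x - y)) \<in> C1_0"
  proof (rule C1_0_I[OF g, of "R + norm x"])
    show "continuous_on UNIV (\<lambda>y. - grad k (x - y))"
      by (intro continuous_intros continuous_on_compose2[OF C1_0_D(2)[OF k]]) auto
    show "k (x - y) = 0" if "R + norm x < norm y" for y
    proof (rule R)
      show "R < norm (x - y)" using that norm_triangle_ineq2[of y x] by (simp add: norm_minus_commute)
    qed
  qed
qed

text \<open>The notion of \<open>has_weak_gradient\<close> for Borel functions and
  \<open>lborel\<close>, where translation and Fubini apply without passing through the
  completion.\<close>

definition weak_gradient_lborel :: "('a::euclidean_space \<Rightarrow> real) \<Rightarrow> ('a \<Rightarrow> 'a) \<Rightarrow> bool" where
  "weak_gradient_lborel w W \<longleftrightarrow> loc_integrable w \<and> loc_integrable W \<and>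
     (\<forall>\<phi>\<in>C1_0. \<forall>i\<in>Basis.
        (\<integral>x. w x * (grad \<phi> x \<bullet> i) \<partial>lborel) = - (\<integral>x. (W x \<bullet> i) * \<phi> x \<partial>lborel))"

text \<open>Truncating to a ball makes \<open>w\<close> and \<open>W\<close> integrable, but
  \<open>w'\<close> has no weak gradient across the sphere. By the condition on \<open>x\<close> the
  kernel only sees points inside the ball, where the truncation is invisible.\<close>

lemma conv_weak_gradient:
  fixes w :: "'a::euclidean_space \<Rightarrow> real"
  assumes W: "weak_gradient_lborel w W" and k: "mollifier r k" and x: "norm x + r \<le> R"
  defines "w' \<equiv> \<lambda>x. indicat_real (cball 0 R) x *\<^sub>R w x"
    and "W' \<equiv> \<lambda>x. indicat_real (cball 0 R) x *\<^sub>R W x"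
  shows "(\<integral>y. w' y *\<^sub>R grad k (x - y) \<partial>lborel) = conv k W' x"
proof (rule euclidean_eqI)
  fix i :: 'a assume i: "i \<in> Basis"
  have kC: "k \<in> C1_0" using k by (simp add: mollifier_def)
  have iw: "integrable lborel w'" "integrable lborel W'"
    using W by (auto simp: w'_def W'_def weak_gradient_lborel_def loc_integrable_def)
  have far: "norm (x - y) > r" if "y \<notin> cball 0 R" for y
    using that x norm_triangle_ineq2[of y x] by (simp add: norm_minus_commute)
  have "(\<integral>y. w' y *\<^sub>R grad k (x - y) \<partial>lborel) \<bullet> i = (\<integral>y. w' y *\<^sub>R grad k (x - y) \<bullet> i \<partial>lborel)"
    using conv_kernel_integrable(2)[OF kC iw(1), of 1 x] by (intro integral_inner_left[symmetric]) simp
  also have "\<dots> = (\<integral>y. - (w y * (grad (\<lambda>y. k (x - y)) y \<bullet> i)) \<partial>lborel)"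
  proof (rule Bochner_Integration.integral_cong)
    fix y
    show "w' y *\<^sub>R grad k (x - y) \<bullet> i = - (w y * (grad (\<lambda>y. k (x - y)) y \<bullet> i))"
      using mollifier_grad_zero[OF k far, of y]
      by (cases "y \<in> cball 0 R") (simp_all add: w'_def C1_0_reflect_translate(2)[OF kC])
  qed simp
  also have "\<dots> = (\<integral>y. (W y \<bullet> i) * k (x - y) \<partial>lborel)"
    using W C1_0_reflect_translate(1)[OF kC, of x] i by (simp add: weak_gradient_lborel_def)
  also have "\<dots> = (\<integral>y. (k (x - y) *\<^sub>R W' y) \<bullet> i \<partial>lborel)"
  proof (rule Bochner_Integration.integral_cong)
    fix y
    have "k (x - y) = 0" if "y \<notin> cball 0 R"
      using far[OF that] k by (simp add: mollifier_def)
    then show "(W y \<bullet> i) * k (x - y) = (k (x - y) *\<^sub>R W' y) \<bullet> i"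
      by (cases "y \<in> cball 0 R") (simp_all add: W'_def)
  qed simp
  also have "\<dots> = conv k W' x \<bullet> i"
    unfolding conv_def using conv_kernel_integrable(1)[OF kC iw(2), of x] by (intro integral_inner_left) simp
  finally show "(\<integral>y. w' y *\<^sub>R grad k (x - y) \<partial>lborel) \<bullet> i = conv k W' x \<bullet> i" .
qed

text \<open>A crude Young inequality: replace both factors by the larger of \<open>a\<close> and
  \<open>b\<close>.\<close>

lemma powr_mult_le_add:
  fixes a b p :: real
  assumes "a \<ge> 0" "b \<ge> 0" "p > 1"
  shows "a powr (p - 1) * b \<le> a powr p + b powr p"
proof (cases "a \<le> b")
  case True
  have "a powr (p - 1) * b \<le> b powr (p - 1) * b"
    using True assms by (intro mult_right_mono powr_mono2) auto
  also have "\<dots> = b powr p"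
    using powr_mult_base[of b "p - 1"] assms by (simp add: mult.commute)
  finally show ?thesis by (smt (verit) powr_ge_zero)
next
  case False
  have "a powr (p - 1) * b \<le> a powr (p - 1) * a"
    using False assms by (intro mult_left_mono) auto
  also have "\<dots> = a powr p"
    using powr_mult_base[of a "p - 1"] assms by (simp add: mult.commute)
  finally show ?thesis by (smt (verit) powr_ge_zero)
qed

text \<open>\<open>\<psi> (w x) * \<eta> x\<close> is in general not C^1, but it becomes so when
  \<open>w\<close> is mollified. In the limit the gradient of the mollified function has no fixed
  majorant: its p-th power is bounded, by Jensen, by the mollification of the p-th power, which
  converges only in mean. Hence the version of dominated convergence with moving bounds.\<close>

lemma test_with_composition:
  fixes w :: "'a::euclidean_space \<Rightarrow> real" and F W :: "'a \<Rightarrow> 'a"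
  assumes p: "p > 1"
    and wW: "weak_gradient_lborel w W"
    and Wp: "loc_integrable (\<lambda>x. norm (W x) powr p)"
    and [measurable]: "F \<in> borel_measurable borel"
    and K: "loc_integrable (\<lambda>x. K x powr p)" and K0: "\<And>x. 0 \<le> K x"
    and FK: "\<And>x. norm (F x) \<le> K x powr (p - 1)"
    and G: "loc_integrable G"
    and ineq: "\<And>\<phi>. \<phi> \<in> C1_0 \<Longrightarrow> (\<And>x. 0 \<le> \<phi> x) \<Longrightarrow> (\<integral>x. F x \<bullet> grad \<phi> x + G x * \<phi> x \<partial>lborel) \<le> 0"
    and \<psi>: "\<And>t. (\<psi> has_real_derivative \<psi>' t) (at t)" "continuous_on UNIV \<psi>'"
    and \<psi>01: "\<And>t. 0 \<le> \<psi> t" "\<And>t. \<psi> t \<le> 1" and \<psi>'L: "\<And>t. \<bar>\<psi>' t\<bar> \<le> L"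
    and \<eta>: "\<eta> \<in> C1_0" "\<And>x. 0 \<le> \<eta> x"
  shows "integrable lborel (\<lambda>x. (F x \<bullet> W x) * \<psi>' (w x) * \<eta> x + \<psi> (w x) * (F x \<bullet> grad \<eta> x) + G x * \<psi> (w x) * \<eta> x)"
    and "(\<integral>x. (F x \<bullet> W x) * \<psi>' (w x) * \<eta> x + \<psi> (w x) * (F x \<bullet> grad \<eta> x) + G x * \<psi> (w x) * \<eta> x \<partial>lborel) \<le> 0"
proof -
  have [measurable]: "w \<in> borel_measurable borel" "W \<in> borel_measurable borel" "G \<in> borel_measurable borel"
      "\<eta> \<in> borel_measurable borel" "grad \<eta> \<in> borel_measurable borel"
    using wW G \<eta> by (auto simp: weak_gradient_lborel_def)
  have \<psi>c: "continuous_on UNIV \<psi>"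
    using \<psi>(1) by (intro continuous_at_imp_continuous_on) (auto intro: DERIV_isCont)
  have [measurable]: "\<psi> \<in> borel_measurable borel" "\<psi>' \<in> borel_measurable borel"
    using \<psi>c \<psi>(2) by (auto intro: borel_measurable_continuous_onI)
  have L0: "L \<ge> 0" using \<psi>'L[of 0] by simp
  obtain R B where R: "R > 0" "B > 0" "\<And>x. \<bar>\<eta> x\<bar> \<le> B * indicator (cball 0 R) x"
    "\<And>x. norm (grad \<eta> x) \<le> B * indicator (cball 0 R) x"
    using C1_0_bounds[OF \<eta>(1)] by metis
  have \<eta>out: "\<eta> x = 0" "grad \<eta> x = 0" if "x \<notin> cball 0 R" for x
    using R(3,4)[of x] that by auto
  \<comment> \<open>The cutoff lives in the ball of radius \<open>R\<close> and the mollification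
    radii are at most 1, so truncating at \<open>R + 1\<close> changes nothing that matters.\<close>
  define w' where "w' = (\<lambda>x. indicat_real (cball 0 (R + 1)) x *\<^sub>R w x)"
  define W' where "W' = (\<lambda>x. indicat_real (cball 0 (R + 1)) x *\<^sub>R W x)"
  have iw: "integrable lborel w'" "integrable lborel W'"
    using wW by (auto simp: w'_def W'_def weak_gradient_lborel_def loc_integrable_def)
  have [measurable]: "w' \<in> borel_measurable borel" "W' \<in> borel_measurable borel"
    using iw by auto
  have "norm (W' x) powr p = indicat_real (cball 0 (R + 1)) x *\<^sub>R norm (W x) powr p" for x
    by (auto simp: W'_def indicator_def)
  then have iWp: "integrable lborel (\<lambda>x. norm (W' x) powr p)"
    using Wp by (simp add: loc_integrable_def)
  define r where "r n = 1 / real (Suc n)" for n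
  have r0: "r \<longlonglongrightarrow> 0" and r1: "r n \<le> 1" for n
    unfolding r_def using LIMSEQ_inverse_real_of_nat by (simp_all add: inverse_eq_divide)
  have "\<exists>k :: 'a \<Rightarrow> real. mollifier (r n) k" for n
    using mollifier_exists[of "r n"] by (auto simp: r_def)
  then obtain k0 :: "nat \<Rightarrow> 'a \<Rightarrow> real" where k0: "\<And>n. mollifier (r n) (k0 n)"
    by metis
  \<comment> \<open>Convergence in mean gives convergence almost everywhere along a subsequence: one
    is taken for \<open>w'\<close>, then a further one for \<open>W'\<close>.\<close>
  obtain s1 where s1: "strict_mono s1" "AE x in lborel. (\<lambda>n. conv (k0 (s1 n)) w' x - w' x) \<longlonglongrightarrow> 0"
    using tendsto_L1_AE_subseq[OF _ conv_L1_tendsto[OF k0 r0 iw(1)]] conv_integrable(1)[OF k0 iw(1)] iw(1) by force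
  have k1: "mollifier ((r \<circ> s1) n) (k0 (s1 n))" for n using k0 by simp
  have r1': "(r \<circ> s1) \<longlonglongrightarrow> 0" using LIMSEQ_subseq_LIMSEQ[OF r0 s1(1)] .
  obtain s2 where s2: "strict_mono s2" "AE x in lborel. (\<lambda>n. conv (k0 (s1 (s2 n))) W' x - W' x) \<longlonglongrightarrow> 0"
    using tendsto_L1_AE_subseq[OF _ conv_L1_tendsto[OF k1 r1' iw(2)]] conv_integrable(1)[OF k1 iw(2)] iw(2) by force
  define k where "k n = k0 (s1 (s2 n))" for n
  define \<rho> where "\<rho> = r \<circ> s1 \<circ> s2"
  have k: "mollifier (\<rho> n) (k n)" for n using k0 by (simp add: k_def \<rho>_def)
  have kC: "k n \<in> C1_0" for n using k by (simp add: mollifier_def)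
  have \<rho>0: "\<rho> \<longlonglongrightarrow> 0" unfolding \<rho>_def using LIMSEQ_subseq_LIMSEQ[OF r1' s2(1)] .
  have \<rho>1: "\<rho> n \<le> 1" for n using r1 by (simp add: \<rho>_def)
  define wn where "wn n = conv (k n) w'" for n
  define Wn where "Wn n = conv (k n) W'" for n
  \<comment> \<open>The classical gradient of \<open>wn n\<close> on the whole space, needed for C^1
    regularity. It is the mollified weak gradient only on the ball of radius \<open>R\<close>, but
    outside it is multiplied by \<open>\<eta> x = 0\<close>.\<close>
  define Dn where "Dn n x = (\<integral>y. w' y *\<^sub>R grad (k n) (x - y) \<partial>lborel)" for n x
  have Dn: "GDERIV (wn n) x :> Dn n x" "continuous_on UNIV (Dn n)" for n x
    unfolding wn_def Dn_def by (rule GDERIV_conv[OF kC iw(1)], rule continuous_conv_grad[OF kC iw(1)])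
  have DW: "Dn n x = Wn n x" if "x \<in> cball 0 R" for n x
    unfolding Dn_def Wn_def w'_def W'_def
    using that \<rho>1[of n] by (intro conv_weak_gradient[OF wW k]) auto
  have limw: "AE x in lborel. (\<lambda>n. wn n x) \<longlonglongrightarrow> w' x"
  proof -
    have "(\<lambda>n. conv (k n) w' x) \<longlonglongrightarrow> w' x" if "(\<lambda>n. conv (k0 (s1 n)) w' x - w' x) \<longlonglongrightarrow> 0" for x
      using LIMSEQ_subseq_LIMSEQ[OF that s2(1)] by (simp add: k_def comp_def LIM_zero_iff)
    with s1(2) show ?thesis unfolding wn_def by (auto elim: eventually_mono)
  qed
  have limW: "AE x in lborel. (\<lambda>n. Wn n x) \<longlonglongrightarrow> W' x"
    using s2(2) by (simp add: Wn_def k_def LIM_zero_iff)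
  have [measurable]: "wn n \<in> borel_measurable borel" "Wn n \<in> borel_measurable borel" for n
    unfolding wn_def Wn_def using kC by (auto intro!: conv_measurable)
  define \<phi> where "\<phi> n x = \<psi> (wn n x) * \<eta> x" for n x
  have g\<phi>: "GDERIV (\<phi> n) x :> \<psi> (wn n x) *\<^sub>R grad \<eta> x + \<eta> x *\<^sub>R (\<psi>' (wn n x) *\<^sub>R Dn n x)" for n x
    unfolding \<phi>_def[abs_def]
    by (intro GDERIV_mult GDERIV_DERIV_compose[OF Dn(1) \<psi>(1)] C1_0_D(1)[OF \<eta>(1)])
  have cwn: "continuous_on UNIV (wn n)" for n
    using Dn(1)[of n] unfolding gderiv_def
    by (intro continuous_at_imp_continuous_on) (auto intro: has_derivative_continuous)
  have \<phi>C: "\<phi> n \<in> C1_0" for n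
  proof (rule C1_0_I[OF g\<phi>, of _ R])
    show "continuous_on UNIV (\<lambda>x. \<psi> (wn n x) *\<^sub>R grad \<eta> x + \<eta> x *\<^sub>R (\<psi>' (wn n x) *\<^sub>R Dn n x))"
      by (intro continuous_intros C1_0_D[OF \<eta>(1)] Dn(2) continuous_on_compose2[OF \<psi>c cwn] continuous_on_compose2[OF \<psi>(2) cwn]) auto
    show "\<phi> n x = 0" if "R < norm x" for x
      using \<eta>out[of x] that by (simp add: \<phi>_def)
  qed
  \<comment> \<open>Values \<open>v\<close> and \<open>V\<close> in place of functions: one bound
    then serves the approximants and the limit.\<close>
  define T where "T v V x = (F x \<bullet> V) * \<psi>' v * \<eta> x + \<psi> v * (F x \<bullet> grad \<eta> x) + G x * \<psi> v * \<eta> x" for v V x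
  have le0: "(\<integral>x. T (wn n x) (Wn n x) x \<partial>lborel) \<le> 0" for n
  proof -
    have "T (wn n x) (Wn n x) x = F x \<bullet> grad (\<phi> n) x + G x * \<phi> n x" for x
      unfolding T_def grad_eqI[OF g\<phi>] \<phi>_def using DW[of x n] \<eta>out[of x]
      by (cases "x \<in> cball 0 R") (auto simp: inner_add_right algebra_simps)
    then show ?thesis
      using ineq[OF \<phi>C, of n] \<psi>01(1) \<eta>(2) by (simp add: \<phi>_def)
  qed
  \<comment> \<open>The part of the majorant that is independent of \<open>V\<close>. Its summands
    come from the three terms of \<open>T\<close>; the middle one uses
    \<open>norm (F x) * 1 \<le> K x powr p + 1\<close>.\<close>
  define Q where "Q x = indicat_real (cball 0 R) x *\<^sub>R (B * L * K x powr p + B * (K x powr p + 1) + B * \<bar>G x\<bar>)" for x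
  have Fb: "norm (F x) * b \<le> K x powr p + b powr p" if "b \<ge> 0" for x b
  proof -
    have "norm (F x) * b \<le> K x powr (p - 1) * b" using FK that by (intro mult_right_mono) auto
    also have "\<dots> \<le> K x powr p + b powr p" by (rule powr_mult_le_add[OF K0 that p])
    finally show ?thesis .
  qed
  have Tb: "\<bar>T v V x\<bar> \<le> Q x + B * L * norm V powr p" for v V x
  proof (cases "x \<in> cball 0 R")
    case True
    have e: "\<eta> x \<le> B" "norm (grad \<eta> x) \<le> B" using R(3,4)[of x] True by auto
    have "\<bar>(F x \<bullet> V) * \<psi>' v * \<eta> x\<bar> \<le> (norm (F x) * norm V) * L * B"
      unfolding abs_mult using e \<eta>(2) \<psi>'L L0 by (intro mult_mono Cauchy_Schwarz_ineq2) auto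
    also have "\<dots> \<le> (K x powr p + norm V powr p) * L * B"
      using Fb[of "norm V" x] L0 R(2) by (intro mult_right_mono) auto
    finally have 1: "\<bar>(F x \<bullet> V) * \<psi>' v * \<eta> x\<bar> \<le> (K x powr p + norm V powr p) * L * B" .
    have "\<bar>\<psi> v * (F x \<bullet> grad \<eta> x)\<bar> \<le> 1 * (norm (F x) * B)"
      unfolding abs_mult using \<psi>01 e
      by (intro mult_mono order_trans[OF Cauchy_Schwarz_ineq2] mult_left_mono) auto
    also have "\<dots> \<le> (K x powr p + 1) * B"
      using Fb[of 1 x] R(2) by simp
    finally have 2: "\<bar>\<psi> v * (F x \<bullet> grad \<eta> x)\<bar> \<le> (K x powr p + 1) * B" .
    have 3: "\<bar>G x * \<psi> v * \<eta> x\<bar> \<le> \<bar>G x\<bar> * 1 * B"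
      unfolding abs_mult using \<psi>01 e \<eta>(2) by (intro mult_mono) auto
    from 1 2 3 True show ?thesis
      unfolding T_def Q_def by (simp add: algebra_simps)
  next
    case False
    then show ?thesis using \<eta>out[OF False] L0 R(2) by (simp add: T_def Q_def)
  qed
  have iQ: "integrable lborel Q"
  proof -
    have "loc_integrable (\<lambda>x. (B * L) *\<^sub>R K x powr p + B *\<^sub>R (K x powr p + 1) + B *\<^sub>R norm (G x))"
      by (intro loc_integrable_add loc_integrable_scale loc_integrable_const loc_integrable_norm K G)
    then show ?thesis by (simp add: Q_def[abs_def] loc_integrable_def)
  qed
  have lim: "(\<lambda>n. \<integral>x. T (wn n x) (Wn n x) x \<partial>lborel) \<longlonglongrightarrow> (\<integral>x. T (w' x) (W' x) x \<partial>lborel)"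
  proof (rule dominated_convergence_L1_bounds)
    let ?g = "\<lambda>n x. Q x + B * L * conv (k n) (\<lambda>y. norm (W' y) powr p) x"
    let ?G = "\<lambda>x. Q x + B * L * norm (W' x) powr p"
    note ic = conv_integrable(1)[OF k iWp]
    show "integrable lborel (?g n)" for n using iQ ic by simp
    show "integrable lborel ?G" using iQ iWp by simp
    show "AE x in lborel. \<bar>T (w' x) (W' x) x\<bar> \<le> ?G x" using Tb by simp
    show "AE x in lborel. \<bar>T (wn n x) (Wn n x) x\<bar> \<le> ?g n x" for n
    proof (rule AE_I2)
      fix x
      have "norm (Wn n x) powr p \<le> conv (k n) (\<lambda>y. norm (W' y)) x powr p"
        unfolding Wn_def using k p by (intro powr_mono2 norm_conv_le) (auto simp: mollifier_def)
      also have "\<dots> \<le> conv (k n) (\<lambda>y. norm (W' y) powr p) x"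
        using p by (intro conv_powr_le[OF k]) (auto intro: iw iWp)
      finally have "B * L * norm (Wn n x) powr p \<le> B * L * conv (k n) (\<lambda>y. norm (W' y) powr p) x"
        using L0 R(2) by (intro mult_left_mono) auto
      with Tb[of "wn n x" "Wn n x" x] show "\<bar>T (wn n x) (Wn n x) x\<bar> \<le> ?g n x" by simp
    qed
    have "(\<lambda>n. B * L * (\<integral>x. norm (conv (k n) (\<lambda>y. norm (W' y) powr p) x - norm (W' x) powr p) \<partial>lborel)) \<longlonglongrightarrow> 0"
      by (intro tendsto_mult_right_zero conv_L1_tendsto[OF k \<rho>0 iWp])
    moreover have "\<bar>?g n x - ?G x\<bar> = B * L * norm (conv (k n) (\<lambda>y. norm (W' y) powr p) x - norm (W' x) powr p)" for n x
      using L0 R(2) by (simp add: right_diff_distrib[symmetric] abs_mult)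
    ultimately show "(\<lambda>n. \<integral>x. \<bar>?g n x - ?G x\<bar> \<partial>lborel) \<longlonglongrightarrow> 0" by simp
    show "AE x in lborel. (\<lambda>n. T (wn n x) (Wn n x) x) \<longlonglongrightarrow> T (w' x) (W' x) x"
      using limw limW
    proof eventually_elim
      case (elim x)
      have "isCont \<psi> (w' x)" "isCont \<psi>' (w' x)"
        using \<psi>c \<psi>(2) by (auto simp: continuous_on_eq_continuous_at)
      then show ?case
        unfolding T_def
        by (intro tendsto_intros elim isCont_tendsto_compose[of _ \<psi>] isCont_tendsto_compose[of _ \<psi>'])
    qed
  qed (auto simp: T_def)
  have "(\<integral>x. T (w' x) (W' x) x \<partial>lborel) \<le> 0"
    by (rule LIMSEQ_le_const2[OF lim]) (use le0 in auto)
  moreover have "integrable lborel (\<lambda>x. T (w' x) (W' x) x)"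
    by (rule Bochner_Integration.integrable_bound[of _ "\<lambda>x. Q x + B * L * norm (W' x) powr p"])
       (use iQ iWp Tb in \<open>auto simp: T_def intro!: AE_I2 order_trans[OF _ abs_ge_self]\<close>)
  moreover have "T (w' x) (W' x) x = T (w x) (W x) x" for x
    using \<eta>out[of x] R(1) by (cases "x \<in> cball 0 R") (auto simp: T_def w'_def W'_def)
  ultimately show "integrable lborel (\<lambda>x. (F x \<bullet> W x) * \<psi>' (w x) * \<eta> x + \<psi> (w x) * (F x \<bullet> grad \<eta> x) + G x * \<psi> (w x) * \<eta> x)"
    and "(\<integral>x. (F x \<bullet> W x) * \<psi>' (w x) * \<eta> x + \<psi> (w x) * (F x \<bullet> grad \<eta> x) + G x * \<psi> (w x) * \<eta> x \<partial>lborel) \<le> 0"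
    by (simp_all add: T_def)
qed

subsection \<open>Inequalities, cutoffs and truncations\<close>

text \<open>For m \<ge> 1 a convex power lies above its tangent at 1; for m < 1 simply s \<le> s^m
  on the unit interval.\<close>

lemma one_minus_powr_le:
  fixes s m :: real
  assumes "0 \<le> s" "s \<le> 1" "m > 0"
  shows "1 - s powr m \<le> max 1 m * (1 - s)"
proof (cases "m \<ge> 1")
  case True
  then show ?thesis
    using powr_above_tangent[of s 1 m] assms by (simp add: max_def algebra_simps)
next
  case False
  then have "s powr 1 \<le> s powr m"
    using assms by (intro powr_mono') auto
  then show ?thesis using False assms by (simp add: max_def)
qed

text \<open>Both sides are homogeneous of degree m + 1, so dividing by \<open>x\<close> reduces the
  claim to the preceding lemma at the ratio y / x, with x + y \<le> 2x.\<close>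

lemma powr_diff_sum_le:
  fixes x y m :: real
  assumes "0 \<le> y" "y \<le> x" "m > 0"
  shows "(x powr m - y powr m) * (x + y) \<le> 2 * max 1 m * (x powr m + y powr m) * (x - y)"
proof (cases "x = 0")
  case True
  then show ?thesis using assms by simp
next
  case False
  then have x: "x > 0" using assms by simp
  define s where "s = y / x"
  have s: "0 \<le> s" "s \<le> 1" "y = x * s" using assms x by (auto simp: s_def)
  have "x powr m - y powr m = x powr m * (1 - s powr m)"
    using s x by (simp add: powr_mult algebra_simps)
  also have "\<dots> \<le> x powr m * (max 1 m * (1 - s))"
    by (intro mult_left_mono one_minus_powr_le s assms) auto
  finally have "(x powr m - y powr m) * (x + y) \<le> x powr m * (max 1 m * (1 - s)) * (2 * x)"
    using s x assms by (intro mult_mono) auto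
  also have "\<dots> = 2 * max 1 m * x powr m * (x - y)"
    using s by (simp add: algebra_simps)
  also have "\<dots> \<le> 2 * max 1 m * (x powr m + y powr m) * (x - y)"
    using assms by (intro mult_right_mono mult_left_mono) auto
  finally show ?thesis .
qed

text \<open>With a, b the weights |\<xi>|^(p-2), |\<zeta>|^(p-2), write F as (a + b)/2 times \<xi> -
  \<zeta> plus (a - b)/2 times \<xi> + \<zeta>. Then F \<bullet> (\<xi> - \<zeta>) = D1 + D2, and D2
  \<ge> 0 because a - b and |\<xi>| - |\<zeta>| have the same sign. In |F|^2 the first part
  contributes (a + b) D1, and the second is reduced to a multiple of (a + b) D2 by
  \<open>powr_diff_sum_le\<close>.\<close>

lemma p_laplace_monotone:
  fixes \<xi> \<zeta> :: "'a::euclidean_space" and p :: real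
  assumes p: "p > 2"
  defines "F \<equiv> norm \<xi> powr (p - 2) *\<^sub>R \<xi> - norm \<zeta> powr (p - 2) *\<^sub>R \<zeta>"
  shows "0 \<le> F \<bullet> (\<xi> - \<zeta>)"
    and "(norm F)\<^sup>2 \<le> 2 * max 1 (p - 2) * (norm \<xi> powr (p - 2) + norm \<zeta> powr (p - 2)) * (F \<bullet> (\<xi> - \<zeta>))"
proof -
  define a b x y \<mu> where "a = norm \<xi> powr (p - 2)" and "b = norm \<zeta> powr (p - 2)"
    and "x = norm \<xi>" and "y = norm \<zeta>" and "\<mu> = max 1 (p - 2)"
  define D1 D2 where "D1 = (a + b) / 2 * (norm (\<xi> - \<zeta>))\<^sup>2" and "D2 = (a - b) / 2 * (x\<^sup>2 - y\<^sup>2)"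
  have ab: "a \<ge> 0" "b \<ge> 0" "x \<ge> 0" "y \<ge> 0" "\<mu> \<ge> 1" by (auto simp: a_def b_def x_def y_def \<mu>_def)
  have abs: "\<bar>a - b\<bar> * (x + y) \<le> 2 * \<mu> * (a + b) * \<bar>x - y\<bar>" and sgn: "(a - b) * (x - y) = \<bar>a - b\<bar> * \<bar>x - y\<bar>"
  proof -
    have "\<bar>a - b\<bar> * (x + y) \<le> 2 * \<mu> * (a + b) * \<bar>x - y\<bar> \<and> (a - b) * (x - y) = \<bar>a - b\<bar> * \<bar>x - y\<bar>"
    proof (cases "y \<le> x")
      case True
      then have "b \<le> a" unfolding a_def b_def x_def y_def using p by (intro powr_mono2) auto
      then show ?thesis
        using powr_diff_sum_le[of y x "p - 2"] True ab p by (simp add: a_def b_def x_def y_def \<mu>_def)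
    next
      case False
      then have "a \<le> b" unfolding a_def b_def x_def y_def using p by (intro powr_mono2) auto
      then show ?thesis
        using powr_diff_sum_le[of x y "p - 2"] False ab p
        by (simp add: a_def b_def x_def y_def \<mu>_def add.commute algebra_simps)
    qed
    then show "\<bar>a - b\<bar> * (x + y) \<le> 2 * \<mu> * (a + b) * \<bar>x - y\<bar>" "(a - b) * (x - y) = \<bar>a - b\<bar> * \<bar>x - y\<bar>" by auto
  qed
  have x2: "x\<^sup>2 = \<xi> \<bullet> \<xi>" "y\<^sup>2 = \<zeta> \<bullet> \<zeta>" by (simp_all add: x_def y_def power2_norm_eq_inner)
  have D: "F \<bullet> (\<xi> - \<zeta>) = D1 + D2"
    unfolding F_def D1_def D2_def x2 power2_norm_eq_inner a_def[symmetric] b_def[symmetric]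
    by (simp add: inner_diff inner_commute[of \<zeta> \<xi>] field_simps)
  have D2e: "D2 = \<bar>a - b\<bar> * \<bar>x - y\<bar> * (x + y) / 2"
  proof -
    have "D2 = ((a - b) * (x - y)) * (x + y) / 2"
      by (simp add: D2_def power2_eq_square algebra_simps)
    then show ?thesis by (simp only: sgn)
  qed
  have D0: "D1 \<ge> 0" "D2 \<ge> 0" using ab by (auto simp: D1_def D2e)
  then show "0 \<le> F \<bullet> (\<xi> - \<zeta>)" by (simp add: D)
  have F: "F = ((a + b) / 2) *\<^sub>R (\<xi> - \<zeta>) + ((a - b) / 2) *\<^sub>R (\<xi> + \<zeta>)"
    unfolding F_def a_def[symmetric] b_def[symmetric]
    by (simp add: algebra_simps add_divide_distrib diff_divide_distrib flip: scaleR_2)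
  have "norm F \<le> (a + b) / 2 * norm (\<xi> - \<zeta>) + \<bar>a - b\<bar> / 2 * (x + y)"
  proof -
    have "norm F \<le> norm (((a + b) / 2) *\<^sub>R (\<xi> - \<zeta>)) + norm (((a - b) / 2) *\<^sub>R (\<xi> + \<zeta>))"
      unfolding F by (rule norm_triangle_ineq)
    also have "\<dots> \<le> (a + b) / 2 * norm (\<xi> - \<zeta>) + \<bar>a - b\<bar> / 2 * (x + y)"
      using ab by (auto simp: x_def y_def intro!: mult_left_mono norm_triangle_ineq)
    finally show ?thesis .
  qed
  then have "(norm F)\<^sup>2 \<le> ((a + b) / 2 * norm (\<xi> - \<zeta>) + \<bar>a - b\<bar> / 2 * (x + y))\<^sup>2"
    by (intro power_mono) auto
  also have "\<dots> \<le> 2 * ((a + b) / 2 * norm (\<xi> - \<zeta>))\<^sup>2 + 2 * (\<bar>a - b\<bar> / 2 * (x + y))\<^sup>2"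
    using sum_squares_bound[of "(a + b) / 2 * norm (\<xi> - \<zeta>)" "\<bar>a - b\<bar> / 2 * (x + y)"] by (simp only: power2_sum)
  also have "2 * ((a + b) / 2 * norm (\<xi> - \<zeta>))\<^sup>2 = (a + b) * D1"
    by (simp add: D1_def power2_eq_square field_simps)
  also have "2 * (\<bar>a - b\<bar> / 2 * (x + y))\<^sup>2 = \<bar>a - b\<bar> * (x + y) / 2 * (\<bar>a - b\<bar> * (x + y))"
    by (simp add: power2_eq_square field_simps)
  also have "\<dots> \<le> \<bar>a - b\<bar> * (x + y) / 2 * (2 * \<mu> * (a + b) * \<bar>x - y\<bar>)"
    using ab by (intro mult_left_mono abs) auto
  also have "\<dots> = 2 * \<mu> * (a + b) * D2"
    by (simp add: D2e field_simps)
  finally have "(norm F)\<^sup>2 \<le> (a + b) * D1 + 2 * \<mu> * (a + b) * D2" by simp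
  also have "(a + b) * D1 \<le> 2 * \<mu> * (a + b) * D1"
    using ab D0 mult_right_mono[of 1 "2 * \<mu>" "(a + b) * D1"] by (simp add: mult.assoc)
  finally show "(norm F)\<^sup>2 \<le> 2 * max 1 (p - 2) * (norm \<xi> powr (p - 2) + norm \<zeta> powr (p - 2)) * (F \<bullet> (\<xi> - \<zeta>))"
    by (simp only: D a_def[symmetric] b_def[symmetric] \<mu>_def[symmetric] distrib_left[of _ D1 D2])
qed

text \<open>The inner square makes it equal to 1 on the ball of radius R and zero beyond radius sqrt
  2 R. The outer square makes |grad|^2 bounded by a multiple of the cutoff itself, as the absorption
  requires.\<close>

definition cutoff :: "real \<Rightarrow> 'a::euclidean_space \<Rightarrow> real" where
  "cutoff R x = pos_sq (1 - pos_sq ((norm x)\<^sup>2 / R\<^sup>2 - 1))"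

lemma cutoff_properties:
  fixes x :: "'a::euclidean_space"
  assumes R: "R > 0"
  shows "(cutoff R :: 'a \<Rightarrow> real) \<in> C1_0"
    and "0 \<le> cutoff R x" "cutoff R x \<le> 1"
    and "norm x \<le> R \<Longrightarrow> cutoff R x = 1"
    and "norm x < R \<Longrightarrow> grad (cutoff R) x = 0"
    and "norm x > 2 * R \<Longrightarrow> cutoff R x = 0"
    and "norm x > 2 * R \<Longrightarrow> grad (cutoff R) x = 0"
    and "(norm (grad (cutoff R) x))\<^sup>2 \<le> 128 / R\<^sup>2 * cutoff R x"
proof -
  define s where "s x = (norm x)\<^sup>2 / R\<^sup>2 - 1" for x :: 'a
  define D where "D x = (2 * max 0 (1 - pos_sq (s x))) *\<^sub>R (0 - (2 * max 0 (s x)) *\<^sub>R ((2 / R\<^sup>2) *\<^sub>R x))" for x :: 'a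
  have s: "GDERIV s x :> (2 / R\<^sup>2) *\<^sub>R x" for x
    using GDERIV_diff[OF GDERIV_mult[OF GDERIV_norm_square[of x] GDERIV_const[of "1 / R\<^sup>2" x]] GDERIV_const[of 1 x]]
    by (simp add: s_def[abs_def])
  have D: "GDERIV (cutoff R) x :> D x" for x
    unfolding cutoff_def[abs_def] D_def s_def[symmetric]
    by (intro GDERIV_DERIV_compose[OF _ DERIV_pos_sq] GDERIV_diff GDERIV_const s)
  have gr: "grad (cutoff R) x = D x" for x :: 'a using D by (rule grad_eqI)
  have out: "1 \<le> pos_sq (s x)" if "norm x > 2 * R" for x
  proof -
    have "(2 * R)\<^sup>2 \<le> (norm x)\<^sup>2" using that R by (intro power_mono) auto
    then have "s x \<ge> 3" using R by (simp add: s_def field_simps)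
    then show ?thesis using power_mono[of 1 "s x" 2] by (simp add: pos_sq_def)
  qed
  have cs: "continuous_on UNIV s" unfolding s_def by (intro continuous_intros) (use R in auto)
  have cp: "continuous_on UNIV pos_sq" unfolding pos_sq_def by (intro continuous_intros)
  show C: "(cutoff R :: 'a \<Rightarrow> real) \<in> C1_0"
  proof (rule C1_0_I[OF D, of "2 * R"])
    show "continuous_on UNIV D" unfolding D_def
      by (intro continuous_intros cs continuous_on_compose2[OF cp cs]) auto
  qed (use out in \<open>auto simp: cutoff_def s_def[symmetric] pos_sq_def[of "1 - _"]\<close>)
  show "0 \<le> cutoff R x" by (simp add: cutoff_def)
  have "max 0 (1 - pos_sq (s x)) \<le> 1" by simp
  then show "cutoff R x \<le> 1"
    using power_mono[of "max 0 (1 - pos_sq (s x))" 1 2] by (simp add: cutoff_def s_def pos_sq_def[of "1 - _"])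
  have in0: "max 0 (s x) = 0" if "norm x \<le> R" for x
    using power_mono[OF that, of 2] R by (simp add: s_def max_def)
  then show "cutoff R x = 1" if "norm x \<le> R"
    using in0[OF that] by (simp add: cutoff_def s_def[symmetric] pos_sq_def)
  show "grad (cutoff R) x = 0" if "norm x < R"
    using in0[of x] that by (simp add: gr D_def)
  show "cutoff R x = 0" "grad (cutoff R) x = 0" if "norm x > 2 * R"
    using out[OF that] by (simp_all add: cutoff_def s_def[symmetric] gr D_def pos_sq_def[of "1 - _"])
  show "(norm (grad (cutoff R) x))\<^sup>2 \<le> 128 / R\<^sup>2 * cutoff R x"
  proof (cases "s x < 1")
    case True
    \<comment> \<open>128 = 4 * 16 * 2: the outer square contributes 4 times the cutoff, the inner
      chain rule 16 |x|^2 / R^4 (as \<open>s x\<close> < 1 here), and |x|^2 \<le> 2 R^2.\<close>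
    have "(norm (grad (cutoff R) x))\<^sup>2 = 4 * cutoff R x * (16 * (max 0 (s x))\<^sup>2 * ((norm x)\<^sup>2 / R\<^sup>2) / R\<^sup>2)"
    proof -
      have "cutoff R x = (max 0 (1 - pos_sq (s x)))\<^sup>2"
        by (simp add: cutoff_def s_def pos_sq_def[of "1 - _"])
      then show ?thesis
        unfolding gr D_def using R by (simp add: power_mult_distrib) (simp add: power2_eq_square power4_eq_xxxx mult_ac)
    qed
    also have "\<dots> \<le> 4 * cutoff R x * (16 * 1 * 2 / R\<^sup>2)"
    proof -
      have "(max 0 (s x))\<^sup>2 \<le> 1" using True power_mono[of "max 0 (s x)" 1 2] by simp
      moreover have "(norm x)\<^sup>2 / R\<^sup>2 \<le> 2" using True by (simp add: s_def)
      ultimately have "(max 0 (s x))\<^sup>2 * ((norm x)\<^sup>2 / R\<^sup>2) \<le> 1 * 2" by (intro mult_mono) auto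
      then show ?thesis using \<open>0 \<le> cutoff R x\<close> by (intro mult_left_mono divide_right_mono) auto
    qed
    finally show ?thesis by simp
  next
    case False
    then have "1 - pos_sq (s x) \<le> 0" using power_mono[of 1 "s x" 2] by (simp add: pos_sq_def)
    then show ?thesis by (simp add: gr D_def cutoff_def)
  qed
qed

text \<open>For \<open>\<delta> = (q - 1) / 2\<close> the quotient \<open>trunc / trunc'\<close> grows like \<open>t\<^sup>q\<close>, the growth of the
  absorption term.\<close>

definition trunc :: "real \<Rightarrow> real \<Rightarrow> real \<Rightarrow> real" where
  "trunc \<delta> k t = 1 - (1 + pos_sq (t - k)) powr (- \<delta>)"

definition trunc' :: "real \<Rightarrow> real \<Rightarrow> real \<Rightarrow> real" where
  "trunc' \<delta> k t = \<delta> * (1 + pos_sq (t - k)) powr (- \<delta> - 1) * (2 * max 0 (t - k))"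

lemma DERIV_trunc: "(trunc \<delta> k has_real_derivative trunc' \<delta> k t) (at t)"
proof -
  have 1: "((\<lambda>t. 1 + pos_sq (t - k)) has_real_derivative 2 * max 0 (t - k)) (at t)"
    using DERIV_shift[of pos_sq "2 * max 0 (t - k)" t "-k"] DERIV_pos_sq[of "t - k"]
    by (auto intro!: derivative_eq_intros)
  have 2: "1 + pos_sq (t - k) > 0" by (simp add: add_pos_nonneg)
  show ?thesis
    unfolding trunc_def[abs_def] trunc'_def
    using DERIV_diff[OF DERIV_const[of 1] DERIV_chain2[OF has_real_derivative_powr[OF 2] 1], of "-\<delta>"]
    by simp
qed

lemma continuous_trunc': "continuous_on UNIV (trunc' \<delta> k)"
proof -
  have "1 + pos_sq s \<noteq> 0" for s by (metis add_pos_nonneg less_irrefl pos_sq_nonneg zero_less_one)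
  moreover have "continuous_on UNIV (\<lambda>t. pos_sq (t - k))"
    unfolding pos_sq_def by (intro continuous_intros)
  ultimately show ?thesis
    unfolding trunc'_def[abs_def] by (intro continuous_intros) auto
qed

lemma trunc_bounds:
  assumes "\<delta> > 0"
  shows "0 \<le> trunc \<delta> k t" "trunc \<delta> k t \<le> 1" "t \<le> k \<Longrightarrow> trunc \<delta> k t = 0" "t > k \<Longrightarrow> trunc \<delta> k t > 0"
    "0 \<le> trunc' \<delta> k t" "trunc' \<delta> k t \<le> \<delta>"
proof -
  define r where "r = max 0 (t - k)"
  have P: "pos_sq (t - k) = r\<^sup>2" by (simp add: r_def pos_sq_def)
  have ne: "1 + r\<^sup>2 \<noteq> 0" by (metis add_pos_nonneg less_irrefl zero_le_power2 zero_less_one)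
  have "(1 + r\<^sup>2) powr (- \<delta>) \<le> (1 + r\<^sup>2) powr 0" using assms by (intro powr_mono) auto
  then show "0 \<le> trunc \<delta> k t" using ne by (simp add: trunc_def P)
  show "trunc \<delta> k t \<le> 1" by (simp add: trunc_def)
  show "trunc \<delta> k t = 0" if "t \<le> k" using that by (simp add: trunc_def pos_sq_def max_def)
  show "trunc \<delta> k t > 0" if "t > k"
  proof -
    have "r > 0" using that by (simp add: r_def)
    then have "(1 + r\<^sup>2) powr (- \<delta>) < (1 + r\<^sup>2) powr 0" using assms by (intro powr_less_mono) auto
    then show ?thesis using ne by (simp add: trunc_def P)
  qed
  have r0: "r \<ge> 0" by (simp add: r_def)
  show "0 \<le> trunc' \<delta> k t" using assms by (simp add: trunc'_def)
  \<comment> \<open>The factor 2r is absorbed by 2r \<le> 1 + r^2.\<close>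
  have "(1 + r\<^sup>2) powr (- \<delta> - 1) * (2 * r) \<le> (1 + r\<^sup>2) powr (- 1) * (1 + r\<^sup>2)"
    using assms r0 sum_squares_bound[of 1 r] by (intro mult_mono powr_mono) auto
  also have "\<dots> = 1" using ne by (simp add: powr_minus_divide add_pos_nonneg)
  finally show "trunc' \<delta> k t \<le> \<delta>"
    using assms mult_left_mono[of "(1 + r\<^sup>2) powr (- \<delta> - 1) * (2 * r)" 1 \<delta>]
    unfolding trunc'_def P r_def[symmetric] by (simp add: mult.assoc)
qed

text \<open>With r = t - k both sides are compared with 2 \<delta> r / (1 + r). Close to r = 0 the
  function is of order r^2 and its derivative of order r, and t^q stays above k^q > 0; for large r
  the function is at most 1 and the choice of \<delta> keeps the right-hand side from
  decaying.\<close>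

lemma trunc_le_deriv:
  assumes q: "q > 1" and k: "k > 0"
  obtains C where "C > 0" "\<And>t. t > k \<Longrightarrow> trunc ((q - 1) / 2) k t \<le> C * trunc' ((q - 1) / 2) k t * t powr q"
proof -
  define \<delta> where "\<delta> = (q - 1) / 2"
  have \<delta>: "\<delta> > 0" "- \<delta> - 1 = - (q + 1) / 2" using q by (auto simp: \<delta>_def field_simps)
  \<comment> \<open>Chosen so that t = k + r is at least \<mu> (1 + r).\<close>
  define \<mu> where "\<mu> = min 1 k"
  have \<mu>: "0 < \<mu>" "\<mu> \<le> 1" "\<mu> \<le> k" using k by (auto simp: \<mu>_def)
  define C where "C = (1 + 1 / \<delta>) / \<mu> powr q"
  have "C > 0" using \<mu> \<delta> by (simp add: C_def add_pos_pos)
  moreover have "trunc \<delta> k t \<le> C * trunc' \<delta> k t * t powr q" if t: "t > k" for t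
  proof -
    define r where "r = t - k"
    have r: "r > 0" "t = k + r" using t by (auto simp: r_def)
    have P: "pos_sq (t - k) = r\<^sup>2" "max 0 (t - k) = r" using r by (simp_all add: pos_sq_def)
    have "\<mu> * r \<le> 1 * r" using \<mu> r by (intro mult_right_mono) auto
    then have "\<mu> * (1 + r) \<le> t" using \<mu>(3) r(2) by (simp only: distrib_left mult_1_left mult_1_right)
    then have "(\<mu> * (1 + r)) powr q \<le> t powr q" using \<mu> r q by (intro powr_mono2) auto
    then have tq: "\<mu> powr q * (1 + r) powr q \<le> t powr q" using \<mu> r by (simp add: powr_mult)
    \<comment> \<open>Here \<delta> = (q - 1) / 2 enters: the powers of 1 + r then combine to
      exactly 1 / (1 + r).\<close>
    have "- (q + 1) = 2 * (- \<delta> - 1)" using \<delta>(2) by simp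
    then have "(1 + r) powr (- (q + 1)) = ((1 + r)\<^sup>2) powr (- \<delta> - 1)"
      using r by (simp only: powr_powr flip: powr_numeral)
    also have "\<dots> \<le> (1 + r\<^sup>2) powr (- \<delta> - 1)"
      using r \<delta> by (intro powr_mono2') (auto simp: power2_sum add_pos_nonneg)
    finally have rq: "(1 + r) powr (- (q + 1)) \<le> (1 + r\<^sup>2) powr (- \<delta> - 1)" .
    have "2 * \<delta> * r / (1 + r) * \<mu> powr q = (\<delta> * (1 + r) powr (- (q + 1)) * (2 * r)) * (\<mu> powr q * (1 + r) powr q)"
    proof -
      have "(1 + r) powr (- (q + 1)) * (1 + r) powr q = (1 + r) powr (-1)"
        using r by (simp flip: powr_add)
      also have "\<dots> = 1 / (1 + r)" using r by (simp add: powr_minus_divide)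
      finally show ?thesis by (simp add: field_simps)
    qed
    also have "\<dots> \<le> trunc' \<delta> k t * t powr q"
      unfolding trunc'_def P using rq tq r \<delta>(1) by (intro mult_mono mult_left_mono mult_right_mono) auto
    finally have low: "2 * \<delta> * r / (1 + r) * \<mu> powr q \<le> trunc' \<delta> k t * t powr q" .
    have up: "trunc \<delta> k t \<le> (1 + 1 / \<delta>) * (2 * \<delta> * r / (1 + r))"
    proof (cases "r \<le> 1")
      \<comment> \<open>Small r: the exponential lies above its tangent at 0, and ln (1 + r^2) \<le>
        r^2, so \<open>trunc\<close> is at most \<delta> r^2.\<close>
      case True
      have "(1 + r\<^sup>2) powr (- \<delta>) = exp (- \<delta> * ln (1 + r\<^sup>2))"
        by (metis add_pos_nonneg less_irrefl powr_def zero_le_power2 zero_less_one)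
      moreover have "1 + (- \<delta> * ln (1 + r\<^sup>2)) \<le> exp (- \<delta> * ln (1 + r\<^sup>2))" by (rule exp_ge_add_one_self)
      moreover have "\<delta> * ln (1 + r\<^sup>2) \<le> \<delta> * r\<^sup>2"
        using \<delta> by (intro mult_left_mono ln_add_one_self_le_self) auto
      ultimately have "trunc \<delta> k t \<le> \<delta> * r\<^sup>2" unfolding trunc_def P by simp
      also have "\<dots> \<le> 2 * \<delta> * r / (1 + r)"
      proof -
        have "r * (1 + r) \<le> 1 * 2" using True r by (intro mult_mono) auto
        then have "\<delta> * r * (r * (1 + r)) \<le> \<delta> * r * 2" using \<delta> r by (intro mult_left_mono) auto
        then show ?thesis using r by (simp add: field_simps power2_eq_square)
      qed
      also have "\<dots> \<le> (1 + 1 / \<delta>) * (2 * \<delta> * r / (1 + r))"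
        using \<delta>(1) r mult_right_mono[of 1 "1 + 1 / \<delta>" "2 * \<delta> * r / (1 + r)"] by simp
      finally show ?thesis .
    next
      case False
      have "trunc \<delta> k t \<le> 1" by (rule trunc_bounds(2)[OF \<delta>(1)])
      also have "\<dots> \<le> 1 / \<delta> * (2 * \<delta> * r / (1 + r))" using False \<delta>(1) by (simp add: field_simps)
      also have "\<dots> \<le> (1 + 1 / \<delta>) * (2 * \<delta> * r / (1 + r))"
        using \<delta>(1) r by (intro mult_right_mono) auto
      finally show ?thesis .
    qed
    also have "\<dots> = C * (2 * \<delta> * r / (1 + r) * \<mu> powr q)"
      using \<mu> by (simp add: C_def)
    also have "\<dots> \<le> C * (trunc' \<delta> k t * t powr q)"
      using low \<open>C > 0\<close> by (intro mult_left_mono) auto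
    finally show ?thesis by (simp add: mult.assoc)
  qed
  ultimately show thesis using that unfolding \<delta>_def by blast
qed

lemma powr_superadd:
  fixes x y q :: real
  assumes "x \<ge> 0" "y \<ge> 0" "q \<ge> 1"
  shows "x powr q + y powr q \<le> (x + y) powr q"
proof -
  have e: "z * z powr (q - 1) = z powr q" if "z \<ge> 0" for z :: real
    using powr_mult_base[OF that, of "q - 1"] by simp
  have "x * x powr (q - 1) + y * y powr (q - 1) \<le> x * (x + y) powr (q - 1) + y * (x + y) powr (q - 1)"
    using assms by (intro add_mono mult_left_mono powr_mono2) auto
  also have "\<dots> = (x + y) * (x + y) powr (q - 1)" by (simp add: distrib_right)
  finally show ?thesis using assms by (simp add: e)
qed

text \<open>For equal signs this is superadditivity of the power. For opposite signs one of
  \<open>u\<close>, \<open>- v\<close> is at least half of \<open>u - v\<close>, which is where the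
  factor 1/2 comes from.\<close>

lemma odd_power_diff_ge:
  fixes u v q :: real
  assumes uv: "v < u" and q: "q \<ge> 1"
  shows "((u - v) / 2) powr q \<le> \<bar>u\<bar> powr (q - 1) * u - \<bar>v\<bar> powr (q - 1) * v"
proof -
  have e: "\<bar>z\<bar> powr (q - 1) * z = (if z \<ge> 0 then z powr q else - ((- z) powr q))" for z :: real
    using powr_mult_base[of "\<bar>z\<bar>" "q - 1"] by (auto simp: mult.commute)
  have half: "((u - v) / 2) powr q \<le> (u - v) powr q" using uv q by (intro powr_mono2) auto
  consider "v \<ge> 0" | "u \<ge> 0" "v < 0" | "u < 0" using uv by linarith
  then show ?thesis
  proof cases
    case 1
    then show ?thesis using powr_superadd[of v "u - v" q] half q uv unfolding e by simp
  next
    case 3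
    then show ?thesis using powr_superadd[of "- u" "u - v" q] half q uv unfolding e by simp
  next
    case 2
    have "((u - v) / 2) powr q \<le> (max u (- v)) powr q" using 2 q by (intro powr_mono2) auto
    also have "\<dots> \<le> u powr q + (- v) powr q" by (auto simp: max_def)
    finally show ?thesis using 2 unfolding e by simp
  qed
qed

text \<open>Once C R^(-a) \<le> 2^(-b-1), each doubling of the radius gains 2^(-b-1) while the
  growth bound loses only 2^b. After j doublings a factor (1/2)^j remains.\<close>

lemma doubling_decay_imp_zero:
  fixes I :: "real \<Rightarrow> real"
  assumes R0: "R0 \<ge> 1" and a: "a > 0" and C: "C > 0" and I0: "\<And>R. 0 \<le> I R"
    and decay: "\<And>R. R \<ge> R0 \<Longrightarrow> I R \<le> C * R powr (- a) * I (2 * R)"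
    and growth: "\<And>R. R \<ge> R0 \<Longrightarrow> I R \<le> C' * R powr b"
  obtains R1 where "R1 \<ge> R0" "\<And>R. R \<ge> R1 \<Longrightarrow> I R = 0"
proof -
  \<comment> \<open>The threshold for R^(-a), solved for R in \<open>R1\<close>.\<close>
  define e where "e = 2 powr (- b - 1) / C"
  have e: "e > 0" using C by (simp add: e_def)
  define R1 where "R1 = max R0 (e powr (- 1 / a))"
  have small: "C * R powr (- a) \<le> 2 powr (- b - 1)" if "R \<ge> R1" for R
  proof -
    have "R powr (- a) \<le> (e powr (- 1 / a)) powr (- a)"
      using that a e by (intro powr_mono2') (auto simp: R1_def)
    also have "\<dots> = e" using a e by (simp add: powr_powr)
    finally show ?thesis using C by (simp add: e_def field_simps)
  qed
  have "I R = 0" if R: "R \<ge> R1" for R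
  proof -
    have R': "R \<ge> R0" "R \<ge> 1" using R R0 by (auto simp: R1_def)
    have it: "I R \<le> 2 powr ((- b - 1) * real j) * I (2 ^ j * R)" for j
    proof (induction j)
      case (Suc j)
      have big: "2 ^ j * R \<ge> R1" using R R' mult_mono[of 1 "2 ^ j" R1 R] R0 by (auto simp: R1_def)
      have "I (2 ^ j * R) \<le> C * (2 ^ j * R) powr (- a) * I (2 * (2 ^ j * R))"
        using big by (intro decay) (simp add: R1_def)
      also have "\<dots> \<le> 2 powr (- b - 1) * I (2 * (2 ^ j * R))"
        using small[OF big] I0 by (intro mult_right_mono) auto
      finally have "2 powr ((- b - 1) * real j) * I (2 ^ j * R)
          \<le> 2 powr ((- b - 1) * real j) * (2 powr (- b - 1) * I (2 * (2 ^ j * R)))"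
        by (intro mult_left_mono) auto
      also have "\<dots> = 2 powr ((- b - 1) * real (Suc j)) * I (2 ^ Suc j * R)"
        by (simp add: distrib_left powr_add mult.assoc)
      finally show ?case using Suc.IH by simp
    qed simp
    have "I R \<le> C' * R powr b * (1 / 2) ^ j" for j
    proof -
      have "2 ^ j * R \<ge> R0" using R' mult_mono[of 1 "2 ^ j" R0 R] R0 by auto
      then have "2 powr ((- b - 1) * real j) * I (2 ^ j * R) \<le> 2 powr ((- b - 1) * real j) * (C' * (2 ^ j * R) powr b)"
        by (intro mult_left_mono growth) auto
      also have "(2 ^ j * R) powr b = 2 powr (real j * b) * R powr b"
        using R' by (simp add: powr_mult powr_powr flip: powr_realpow)
      also have "2 powr ((- b - 1) * real j) * (C' * (2 powr (real j * b) * R powr b))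
          = C' * R powr b * (2 powr ((- b - 1) * real j) * 2 powr (real j * b))"
        by simp
      also have "2 powr ((- b - 1) * real j) * 2 powr (real j * b) = 2 powr (- real j)"
        by (simp add: algebra_simps flip: powr_add)
      also have "\<dots> = (1 / 2) ^ j"
        by (simp add: powr_minus powr_realpow power_one_over inverse_eq_divide)
      finally show ?thesis using it[of j] by simp
    qed
    moreover have "(\<lambda>j. C' * R powr b * (1 / 2) ^ j) \<longlonglongrightarrow> 0"
      by (intro tendsto_mult_right_zero LIMSEQ_power_zero) auto
    ultimately have "I R \<le> 0"
      by (intro LIMSEQ_le_const) auto
    then show ?thesis using I0[of R] by simp
  qed
  then show thesis using that[of R1] by (simp add: R1_def)
qed

subsection \<open>The comparison principle\<close>

lemma odd_power_abs: "q > 0 \<Longrightarrow> \<bar>\<bar>s\<bar> powr (q - 1) * s\<bar> = \<bar>s\<bar> powr q" for s q :: real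
  using powr_mult_base[of "\<bar>s\<bar>" "q - 1"] by (simp add: abs_mult mult.commute)

lemma norm_p_flux: "norm (norm \<xi> powr (p - 2) *\<^sub>R \<xi>) = norm \<xi> powr (p - 1)" for \<xi> :: "'a::euclidean_space"
  using powr_mult_base[of "norm \<xi>" "p - 2"] by (simp add: mult.commute)

text \<open>Cauchy's inequality without division: in the application \<open>X\<close> is the
  gradient term to be absorbed, which may vanish.\<close>

lemma le_add_of_square_le_mult:
  fixes y X Y :: real
  assumes "y\<^sup>2 \<le> X * Y" "0 \<le> X" "0 \<le> Y"
  shows "y \<le> X + Y"
proof (rule power2_le_imp_le)
  have "X * Y \<le> (X + Y)\<^sup>2" using assms by (simp add: power2_sum)
  with assms show "y\<^sup>2 \<le> (X + Y)\<^sup>2" by linarith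
qed (use assms in simp)

lemma C1_0_mult_integrable:
  fixes f :: "'a::euclidean_space \<Rightarrow> real" and g :: "'a \<Rightarrow> 'a"
  assumes \<phi>: "\<phi> \<in> C1_0"
  shows "loc_integrable f \<Longrightarrow> integrable lborel (\<lambda>x. f x * \<phi> x)"
    and "loc_integrable f \<Longrightarrow> integrable lborel (\<lambda>x. f x *\<^sub>R grad \<phi> x)"
    and "loc_integrable g \<Longrightarrow> integrable lborel (\<lambda>x. \<phi> x *\<^sub>R g x)"
    and "loc_integrable g \<Longrightarrow> integrable lborel (\<lambda>x. g x \<bullet> grad \<phi> x)"
proof -
  have [measurable]: "\<phi> \<in> borel_measurable borel" "grad \<phi> \<in> borel_measurable borel" using \<phi> by auto
  obtain R B where B: "B > 0" "\<And>x. \<bar>\<phi> x\<bar> \<le> B * indicator (cball 0 R) x"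
    "\<And>x. norm (grad \<phi> x) \<le> B * indicator (cball 0 R) x"
    using C1_0_bounds[OF \<phi>] by metis
  show "integrable lborel (\<lambda>x. f x * \<phi> x)" "integrable lborel (\<lambda>x. f x *\<^sub>R grad \<phi> x)" if f: "loc_integrable f"
  proof -
    note [measurable] = loc_integrable_measurable[OF f]
    have "norm (f x * \<phi> x) \<le> B * indicator (cball 0 R) x * norm (f x)"
      "norm (f x *\<^sub>R grad \<phi> x) \<le> B * indicator (cball 0 R) x * norm (f x)" for x
      using mult_right_mono[OF B(2)[of x] abs_ge_zero[of "f x"]] mult_right_mono[OF B(3)[of x] abs_ge_zero[of "f x"]]
      by (simp_all add: abs_mult mult.commute[of "\<bar>f x\<bar>"])
    then show "integrable lborel (\<lambda>x. f x * \<phi> x)" "integrable lborel (\<lambda>x. f x *\<^sub>R grad \<phi> x)"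
      by (auto intro!: loc_integrable_dominates[OF loc_integrable_norm[OF f], of _ B R])
  qed
  show "integrable lborel (\<lambda>x. \<phi> x *\<^sub>R g x)" "integrable lborel (\<lambda>x. g x \<bullet> grad \<phi> x)" if g: "loc_integrable g"
  proof -
    note [measurable] = loc_integrable_measurable[OF g]
    show "integrable lborel (\<lambda>x. \<phi> x *\<^sub>R g x)"
      by (rule loc_integrable_dominates[OF loc_integrable_norm[OF g], of _ B R])
         (use B mult_right_mono[OF B(2) norm_ge_zero] in auto)
    have "\<bar>g x \<bullet> grad \<phi> x\<bar> \<le> B * indicator (cball 0 R) x * norm (g x)" for x
      using Cauchy_Schwarz_ineq2[of "g x" "grad \<phi> x"] mult_right_mono[OF B(3) norm_ge_zero, of x "g x"]
      by (simp add: mult.commute)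
    then show "integrable lborel (\<lambda>x. g x \<bullet> grad \<phi> x)"
      by (intro loc_integrable_dominates[OF loc_integrable_norm[OF g], of _ B R]) auto
  qed
qed

lemma weak_gradient_lborel_diff:
  assumes u: "weak_gradient_lborel u U" and v: "weak_gradient_lborel v V"
  shows "weak_gradient_lborel (\<lambda>x. u x - v x) (\<lambda>x. U x - V x)"
  unfolding weak_gradient_lborel_def
proof (intro conjI ballI)
  have l: "loc_integrable u" "loc_integrable U" "loc_integrable v" "loc_integrable V"
    using u v by (auto simp: weak_gradient_lborel_def)
  then show "loc_integrable (\<lambda>x. u x - v x)" "loc_integrable (\<lambda>x. U x - V x)"
    by (auto intro: loc_integrable_diff)
  fix \<phi> :: "'a \<Rightarrow> real" and i :: 'a assume \<phi>: "\<phi> \<in> C1_0" and i: "i \<in> Basis"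
  note I = C1_0_mult_integrable[OF \<phi>]
  have 1: "integrable lborel (\<lambda>x. f x * (grad \<phi> x \<bullet> i))" if "loc_integrable f" for f :: "'a \<Rightarrow> real"
    using integrable_inner_left[of i lborel "\<lambda>x. f x *\<^sub>R grad \<phi> x"] I(2)[OF that] by auto
  have 2: "integrable lborel (\<lambda>x. (g x \<bullet> i) * \<phi> x)" if "loc_integrable g" for g :: "'a \<Rightarrow> 'a"
    using integrable_inner_left[of i lborel "\<lambda>x. \<phi> x *\<^sub>R g x"] I(3)[OF that] by (auto simp: mult.commute)
  show "(\<integral>x. (u x - v x) * (grad \<phi> x \<bullet> i) \<partial>lborel) = - (\<integral>x. ((U x - V x) \<bullet> i) * \<phi> x \<partial>lborel)"
    using u v \<phi> i 1[OF l(1)] 1[OF l(3)] 2[OF l(2)] 2[OF l(4)]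
    by (simp add: weak_gradient_lborel_def left_diff_distrib inner_diff_left)
qed

text \<open>The exponent \<theta> is normalised to be nonnegative, so that the growth bound
  increases with \<open>norm x\<close> and its value at radius 2R serves on the whole
  annulus.\<close>

lemma comparison_lborel:
  fixes u v :: "'a::euclidean_space \<Rightarrow> real" and U V :: "'a \<Rightarrow> 'a" and p q \<theta> c R0 :: real
  defines "F \<equiv> \<lambda>x. norm (U x) powr (p - 2) *\<^sub>R U x - norm (V x) powr (p - 2) *\<^sub>R V x"
    and "G \<equiv> \<lambda>x. \<bar>u x\<bar> powr (q - 1) * u x - \<bar>v x\<bar> powr (q - 1) * v x"
  assumes p: "p > 2" and q: "q > 1"
    and uU: "weak_gradient_lborel u U" and vV: "weak_gradient_lborel v V"
    and Up: "loc_integrable (\<lambda>x. norm (U x) powr p)" and Vp: "loc_integrable (\<lambda>x. norm (V x) powr p)"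
    and uq: "loc_integrable (\<lambda>x. \<bar>u x\<bar> powr q)" and vq: "loc_integrable (\<lambda>x. \<bar>v x\<bar> powr q)"
    and \<theta>: "\<theta> \<ge> 0" "\<theta> * (p - 2) < 2" and c: "c > 0" and R0: "R0 \<ge> 1"
    and growth: "AE x in lborel. R0 \<le> norm x \<longrightarrow>
        norm (U x) \<le> c * norm x powr \<theta> \<and> norm (V x) \<le> c * norm x powr \<theta>"
    and ineq: "\<And>\<phi>. \<phi> \<in> C1_0 \<Longrightarrow> (\<And>x. 0 \<le> \<phi> x) \<Longrightarrow> (\<integral>x. F x \<bullet> grad \<phi> x + G x * \<phi> x \<partial>lborel) \<le> 0"
  shows "AE x in lborel. u x \<le> v x"
proof -
  have [measurable]: "u \<in> borel_measurable borel" "U \<in> borel_measurable borel"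
      "v \<in> borel_measurable borel" "V \<in> borel_measurable borel"
    using uU vV by (auto simp: weak_gradient_lborel_def)
  have [measurable]: "F \<in> borel_measurable borel" "G \<in> borel_measurable borel"
    unfolding F_def G_def by measurable
  define w W where "w x = u x - v x" and "W x = U x - V x" for x
  have [measurable]: "w \<in> borel_measurable borel" "W \<in> borel_measurable borel"
    unfolding w_def W_def by measurable
  have wW: "weak_gradient_lborel w W"
    using weak_gradient_lborel_diff[OF uU vV] by (simp add: w_def[abs_def] W_def[abs_def])
  \<comment> \<open>A common majorant: it bounds \<open>norm (W x)\<close>, and its power p - 1
    bounds the flux difference \<open>F\<close>.\<close>
  define K where "K x = 2 * (norm (U x) + norm (V x))" for x
  have K0: "0 \<le> K x" for x by (simp add: K_def)
  have Kp: "loc_integrable (\<lambda>x. K x powr p)"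
  proof (rule loc_integrable_bound)
    show "loc_integrable (\<lambda>x. (4 powr p) *\<^sub>R (norm (U x) powr p + norm (V x) powr p))"
      by (intro loc_integrable_scale loc_integrable_add Up Vp)
    show "norm (K x powr p) \<le> 4 powr p *\<^sub>R (norm (U x) powr p + norm (V x) powr p)" for x
    proof -
      have "K x powr p \<le> (4 * max (norm (U x)) (norm (V x))) powr p"
        using p by (intro powr_mono2) (auto simp: K_def)
      also have "\<dots> = 4 powr p * max (norm (U x)) (norm (V x)) powr p" by (simp add: powr_mult max_def)
      also have "\<dots> \<le> 4 powr p * (norm (U x) powr p + norm (V x) powr p)"
        by (intro mult_left_mono) (auto simp: max_def)
      finally show ?thesis by simp
    qed
  qed (simp add: K_def)
  have Wp: "loc_integrable (\<lambda>x. norm (W x) powr p)"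
  proof (rule loc_integrable_bound[OF Kp])
    show "norm (norm (W x) powr p) \<le> K x powr p" for x
    proof -
      have "norm (W x) \<le> norm (U x) + norm (V x)"
        unfolding W_def by (rule norm_triangle_ineq4)
      also have "\<dots> \<le> K x" by (simp add: K_def)
      finally show ?thesis using p by (auto intro!: powr_mono2)
    qed
  qed simp
  have FUV: "norm (F x) \<le> norm (U x) powr (p - 1) + norm (V x) powr (p - 1)" for x
    unfolding F_def using norm_triangle_ineq4 norm_p_flux by metis
  have FK: "norm (F x) \<le> K x powr (p - 1)" for x
  proof -
    have "norm (U x) powr (p - 1) + norm (V x) powr (p - 1) \<le> (norm (U x) + norm (V x)) powr (p - 1)"
      using p by (intro powr_superadd) auto
    also have "\<dots> \<le> K x powr (p - 1)" using p by (intro powr_mono2) (auto simp: K_def)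
    finally show ?thesis using FUV[of x] by simp
  qed
  have Gl: "loc_integrable G"
  proof (rule loc_integrable_bound[OF loc_integrable_add[OF uq vq]])
    have "\<bar>G x\<bar> \<le> \<bar>\<bar>u x\<bar> powr (q - 1) * u x\<bar> + \<bar>\<bar>v x\<bar> powr (q - 1) * v x\<bar>" for x
      unfolding G_def by (rule abs_triangle_ineq4)
    then show "norm (G x) \<le> \<bar>u x\<bar> powr q + \<bar>v x\<bar> powr q" for x
      using q by (simp add: odd_power_abs)
  qed simp
  have main: "AE x in lborel. w x \<le> k" if k: "k > 0" for k :: real
  proof -
    define \<delta> where "\<delta> = (q - 1) / 2"
    have \<delta>: "\<delta> > 0" using q by (simp add: \<delta>_def)
    define \<psi> \<psi>' where "\<psi> = trunc \<delta> k" and "\<psi>' = trunc' \<delta> k"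
    note \<psi>b = trunc_bounds[where k=k, OF \<delta>, folded \<psi>_def \<psi>'_def]
    obtain C\<psi> where C\<psi>: "C\<psi> > 0" "\<And>t. t > k \<Longrightarrow> \<psi> t \<le> C\<psi> * \<psi>' t * t powr q"
      using trunc_le_deriv[OF q k] unfolding \<psi>_def \<psi>'_def \<delta>_def by blast
    have [measurable]: "\<psi> \<in> borel_measurable borel"
      by (intro borel_measurable_continuous_onI continuous_at_imp_continuous_on)
         (auto simp: \<psi>_def intro: DERIV_isCont[OF DERIV_trunc])
    define \<Phi> where "\<Phi> x = G x * \<psi> (w x)" for x
    have Gw: "(w x) powr q \<le> 2 powr q * G x" if "w x > k" for x
    proof -
      have "(w x / 2) powr q \<le> G x"
        using odd_power_diff_ge[of "v x" "u x" q] that k q by (simp add: w_def G_def)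
      then show ?thesis
        using that k by (simp add: powr_divide divide_le_eq mult.commute)
    qed
    have \<Phi>0: "0 \<le> \<Phi> x" for x
    proof (cases "w x > k")
      case True
      have "0 \<le> 2 powr q * G x" using Gw[OF True] order_trans[OF powr_ge_zero] by blast
      then have "0 \<le> G x" by (simp add: zero_le_mult_iff)
      then show ?thesis using \<psi>b(1) by (simp add: \<Phi>_def)
    qed (use \<psi>b(3)[of "w x"] in \<open>simp add: \<Phi>_def\<close>)
    \<comment> \<open>The third quotient of the absorption, written without division.\<close>
    have \<psi>\<Phi>: "(\<psi> (w x))\<^sup>2 \<le> C\<psi> * 2 powr q * \<psi>' (w x) * \<Phi> x" for x
    proof (cases "w x > k")
      case True
      have "\<psi> (w x) * \<psi> (w x) \<le> (C\<psi> * \<psi>' (w x) * w x powr q) * \<psi> (w x)"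
        using C\<psi>(2)[OF True] \<psi>b(1) by (rule mult_right_mono)
      also have "\<dots> \<le> (C\<psi> * \<psi>' (w x) * (2 powr q * G x)) * \<psi> (w x)"
        using Gw[OF True] \<psi>b(1,5) C\<psi>(1) by (intro mult_right_mono mult_left_mono) auto
      finally show ?thesis by (simp add: \<Phi>_def power2_eq_square mult_ac)
    qed (use \<psi>b(3)[of "w x"] in \<open>simp add: \<Phi>_def\<close>)
    have \<Phi>l: "loc_integrable \<Phi>"
    proof (rule loc_integrable_bound[OF loc_integrable_norm[OF Gl]])
      show "norm (\<Phi> x) \<le> norm (G x)" for x
        using \<psi>b(1,2) by (simp add: \<Phi>_def abs_mult mult_left_le)
    qed (simp add: \<Phi>_def[abs_def])
    define I where "I R = (\<integral>x. indicat_real (cball 0 R) x *\<^sub>R \<Phi> x \<partial>lborel)" for R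
    have iI: "integrable lborel (\<lambda>x. indicat_real (cball 0 R) x *\<^sub>R \<Phi> x)" for R
      using \<Phi>l by (simp add: loc_integrable_def)
    define T where "T R x = (F x \<bullet> W x) * \<psi>' (w x) * cutoff R x + \<psi> (w x) * (F x \<bullet> grad (cutoff R) x) + G x * \<psi> (w x) * cutoff R x" for R x
    have T: "integrable lborel (T R)" "(\<integral>x. T R x \<partial>lborel) \<le> 0" if "R > 0" for R
    proof -
      have \<psi>L: "\<bar>\<psi>' t\<bar> \<le> \<delta>" for t using \<psi>b(5,6)[of t] by simp
      have d: "(\<psi> has_real_derivative \<psi>' t) (at t)" for t
        unfolding \<psi>_def \<psi>'_def by (rule DERIV_trunc)
      have c: "continuous_on UNIV \<psi>'"
        unfolding \<psi>'_def by (rule continuous_trunc')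
      have "p > 1" "F \<in> borel_measurable borel" using p by auto
      note tc = test_with_composition[where p=p and w=w and W=W and F=F and K=K and G=G and \<psi>=\<psi> and \<psi>'=\<psi>'
        and L=\<delta> and \<eta>="cutoff R", OF this(1) wW Wp this(2) Kp K0 FK Gl ineq d c \<psi>b(1,2) \<psi>L cutoff_properties(1,2)[OF that]]
      show "integrable lborel (T R)" "(\<integral>x. T R x \<partial>lborel) \<le> 0"
        unfolding T_def[abs_def] by (rule tc, assumption+)+
    qed
    define \<mu> where "\<mu> = 2 * max 1 (p - 2)"
    have \<mu>: "\<mu> > 0" by (simp add: \<mu>_def)
    have D0: "0 \<le> F x \<bullet> W x" and FD: "(norm (F x))\<^sup>2 \<le> \<mu> * (norm (U x) powr (p - 2) + norm (V x) powr (p - 2)) * (F x \<bullet> W x)" for x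
      using p_laplace_monotone[OF p, of "U x" "V x"] by (simp_all add: F_def W_def \<mu>_def)
    define \<Psi> where "\<Psi> R x = \<psi> (w x) * norm (F x) * norm (grad (cutoff R) x)" for R x
    \<comment> \<open>The bracket is what Cauchy's inequality must control: the mixed term minus the
      good gradient term.\<close>
    have T1: "\<Phi> x * cutoff R x \<le> T R x + (\<Psi> R x - (F x \<bullet> W x) * \<psi>' (w x) * cutoff R x)" for R x
    proof -
      have "- (\<psi> (w x) * (F x \<bullet> grad (cutoff R) x)) \<le> \<Psi> R x"
      proof -
        have "\<bar>F x \<bullet> grad (cutoff R) x\<bar> \<le> norm (F x) * norm (grad (cutoff R) x)" by (rule Cauchy_Schwarz_ineq2)
        then have "- (F x \<bullet> grad (cutoff R) x) \<le> norm (F x) * norm (grad (cutoff R) x)" by simp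
        from mult_left_mono[OF this \<psi>b(1)] show ?thesis by (simp add: \<Psi>_def mult.assoc)
      qed
      then show ?thesis by (simp add: T_def \<Phi>_def)
    qed
    \<comment> \<open>Any bound on that bracket bounds \<open>I R\<close>, since the tested integral
      of \<open>T R\<close> is at most 0. Used twice: with \<open>f = \<Phi>\<close> for the decay
      and with \<open>f = 1\<close> for the a priori growth.\<close>
    have I_le: "I R \<le> (\<integral>x. b * (indicat_real (cball 0 (2 * R)) x *\<^sub>R f x) \<partial>lborel)"
      if "R > 0" "loc_integrable f" "AE x in lborel. \<Psi> R x - (F x \<bullet> W x) * \<psi>' (w x) * cutoff R x \<le> b * (indicat_real (cball 0 (2 * R)) x *\<^sub>R f x)"
      for R b f
    proof -
      have i2: "integrable lborel (\<lambda>x. b * (indicat_real (cball 0 (2 * R)) x *\<^sub>R f x))"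
        using that(2) by (auto simp: loc_integrable_def)
      have "I R \<le> (\<integral>x. T R x + b * (indicat_real (cball 0 (2 * R)) x *\<^sub>R f x) \<partial>lborel)"
        unfolding I_def
      proof (rule integral_mono_AE[OF iI Bochner_Integration.integrable_add[OF T(1)[OF that(1)] i2]])
        show "AE x in lborel. indicat_real (cball 0 R) x *\<^sub>R \<Phi> x \<le> T R x + b * (indicat_real (cball 0 (2 * R)) x *\<^sub>R f x)"
          using that(3)
        proof eventually_elim
          case (elim x)
          have "indicat_real (cball 0 R) x *\<^sub>R \<Phi> x \<le> \<Phi> x * cutoff R x"
            using cutoff_properties(2,4)[OF that(1), of x] \<Phi>0[of x] by (auto simp: indicator_def)
          with T1[of x R] elim show ?case by linarith
        qed
      qed
      also have "\<dots> = (\<integral>x. T R x \<partial>lborel) + (\<integral>x. b * (indicat_real (cball 0 (2 * R)) x *\<^sub>R f x) \<partial>lborel)"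
        by (rule Bochner_Integration.integral_add[OF T(1)[OF that(1)] i2])
      finally show ?thesis using T(2)[OF that(1)] by linarith
    qed
    define \<beta> where "\<beta> R = c * (2 * R) powr \<theta>" for R
    have annulus: "AE x in lborel. grad (cutoff R) x \<noteq> 0 \<longrightarrow> norm (U x) \<le> \<beta> R \<and> norm (V x) \<le> \<beta> R \<and> x \<in> cball 0 (2 * R)"
      if R: "R \<ge> R0" for R
      using growth
    proof eventually_elim
      case (elim x)
      show ?case
      proof (intro impI)
        assume "grad (cutoff R) x \<noteq> 0"
        then have x: "R \<le> norm x" "norm x \<le> 2 * R"
          using cutoff_properties(5,7)[of R x] R R0 by force+
        have "c * norm x powr \<theta> \<le> \<beta> R"
          unfolding \<beta>_def using c x \<theta> by (intro mult_left_mono powr_mono2) auto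
        then show "norm (U x) \<le> \<beta> R \<and> norm (V x) \<le> \<beta> R \<and> x \<in> cball 0 (2 * R)"
          using elim x R by force
      qed
    qed
    \<comment> \<open>The product of the constants of the three quotients: flux on the annulus,
      cutoff, truncation.\<close>
    define C1 where "C1 = \<mu> * (2 * (c * 2 powr \<theta>) powr (p - 2)) * 128 * (C\<psi> * 2 powr q)"
    have C1: "C1 > 0" using \<mu> c C\<psi> by (simp add: C1_def)
    have decay: "I R \<le> C1 * R powr (- (2 - \<theta> * (p - 2))) * I (2 * R)" if R: "R \<ge> R0" for R
    proof -
      have Rp: "R > 0" using R R0 by simp
      have e1: "\<beta> R powr (p - 2) = (c * 2 powr \<theta>) powr (p - 2) * R powr (\<theta> * (p - 2))"
        using Rp c by (simp add: \<beta>_def powr_mult powr_powr)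
      have e2: "R powr (\<theta> * (p - 2)) / R\<^sup>2 = R powr (- (2 - \<theta> * (p - 2)))"
      proof -
        have "R powr (\<theta> * (p - 2)) / R powr 2 = R powr (\<theta> * (p - 2) - 2)" by (rule powr_diff[symmetric])
        then show ?thesis using Rp by (simp add: powr_numeral)
      qed
      have Ceq: "\<mu> * (2 * \<beta> R powr (p - 2)) * (128 / R\<^sup>2) * (C\<psi> * 2 powr q) = C1 * R powr (- (2 - \<theta> * (p - 2)))"
        unfolding C1_def e1 e2[symmetric] by simp
      have "I R \<le> (\<integral>x. C1 * R powr (- (2 - \<theta> * (p - 2))) * (indicat_real (cball 0 (2 * R)) x *\<^sub>R \<Phi> x) \<partial>lborel)"
      proof (rule I_le[OF Rp \<Phi>l])
        show "AE x in lborel. \<Psi> R x - (F x \<bullet> W x) * \<psi>' (w x) * cutoff R x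
           \<le> C1 * R powr (- (2 - \<theta> * (p - 2))) * (indicat_real (cball 0 (2 * R)) x *\<^sub>R \<Phi> x)"
          using annulus[OF R]
        proof eventually_elim
          case (elim x)
          have nn: "0 \<le> (F x \<bullet> W x) * \<psi>' (w x) * cutoff R x"
            by (intro mult_nonneg_nonneg D0 \<psi>b(5) cutoff_properties(2)[OF Rp])
          show ?case
          proof (cases "grad (cutoff R) x = 0")
            case True
            have "0 \<le> C1 * R powr (- (2 - \<theta> * (p - 2))) * (indicat_real (cball 0 (2 * R)) x *\<^sub>R \<Phi> x)"
              using \<Phi>0[of x] C1 by (auto simp: indicator_def)
            moreover have "\<Psi> R x = 0" using True by (simp add: \<Psi>_def)
            ultimately show ?thesis using nn by linarith
          next
            case False
            then have b: "norm (U x) \<le> \<beta> R" "norm (V x) \<le> \<beta> R" "x \<in> cball 0 (2 * R)" using elim by auto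
            have "norm (U x) powr (p - 2) + norm (V x) powr (p - 2) \<le> 2 * \<beta> R powr (p - 2)"
              using powr_mono2[of "p - 2", OF _ _ b(1)] powr_mono2[of "p - 2", OF _ _ b(2)] p by simp
            then have "\<mu> * (norm (U x) powr (p - 2) + norm (V x) powr (p - 2)) * (F x \<bullet> W x) \<le> \<mu> * (2 * \<beta> R powr (p - 2)) * (F x \<bullet> W x)"
              using \<mu> D0[of x] by (intro mult_right_mono mult_left_mono) auto
            with FD[of x] have F2: "(norm (F x))\<^sup>2 \<le> \<mu> * (2 * \<beta> R powr (p - 2)) * (F x \<bullet> W x)" by linarith
            \<comment> \<open>The three quotients meet: the product regroups into the good gradient
              term times a small multiple of \<open>\<Phi> x\<close>, and the square root is then
              split additively.\<close>
            have "(\<Psi> R x)\<^sup>2 = (\<psi> (w x))\<^sup>2 * (norm (F x))\<^sup>2 * (norm (grad (cutoff R) x))\<^sup>2"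
              by (simp add: \<Psi>_def power_mult_distrib)
            also have "\<dots> \<le> (C\<psi> * 2 powr q * \<psi>' (w x) * \<Phi> x) * (\<mu> * (2 * \<beta> R powr (p - 2)) * (F x \<bullet> W x)) * (128 / R\<^sup>2 * cutoff R x)"
              using \<psi>\<Phi>[of x] F2 cutoff_properties(8)[OF Rp, of x] \<psi>b(5)[of "w x"] \<Phi>0[of x] C\<psi>(1) \<mu> D0[of x]
              by (intro mult_mono) auto
            also have "\<dots> = ((F x \<bullet> W x) * \<psi>' (w x) * cutoff R x) * (C1 * R powr (- (2 - \<theta> * (p - 2))) * \<Phi> x)"
              unfolding Ceq[symmetric] by (simp only: mult_ac)
            finally have "\<Psi> R x \<le> (F x \<bullet> W x) * \<psi>' (w x) * cutoff R x + C1 * R powr (- (2 - \<theta> * (p - 2))) * \<Phi> x"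
              using nn C1 \<Phi>0[of x] by (intro le_add_of_square_le_mult) auto
            then show ?thesis using b(3) by simp
          qed
        qed
      qed
      then show ?thesis by (simp add: I_def)
    qed
    define N where "N = real DIM('a)"
    define C2 where "C2 = 2 * (c * 2 powr \<theta>) powr (p - 1) * 12 * (unit_ball_vol N * 2 powr N)"
    \<comment> \<open>The good term is dropped and \<psi> bounded by 1: the flux on the annulus
      gives R^(\<theta>(p-1)), the volume of the ball R^N.\<close>
    have growthI: "I R \<le> C2 * R powr (\<theta> * (p - 1) + N)" if R: "R \<ge> R0" for R
    proof -
      have Rp: "R > 0" "R \<ge> 1" using R R0 by auto
      have "\<beta> R powr (p - 1) = (c * 2 powr \<theta>) powr (p - 1) * R powr (\<theta> * (p - 1))"
        using Rp c by (simp add: \<beta>_def powr_mult powr_powr)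
      moreover have "measure lborel (cball (0::'a) (2 * R)) = unit_ball_vol N * 2 powr N * R powr N"
        using Rp content_cball[of "2 * R" "0::'a"] by (simp add: N_def powr_realpow power_mult_distrib)
      ultimately have Ceq: "2 * \<beta> R powr (p - 1) * 12 * measure lborel (cball (0::'a) (2 * R)) = C2 * R powr (\<theta> * (p - 1) + N)"
        by (simp add: C2_def powr_add)
      have "I R \<le> (\<integral>x. 2 * \<beta> R powr (p - 1) * 12 * (indicat_real (cball 0 (2 * R)) x *\<^sub>R (1::real)) \<partial>(lborel :: 'a measure))"
      proof (rule I_le[OF Rp(1) loc_integrable_const])
        show "AE x in lborel. \<Psi> R x - (F x \<bullet> W x) * \<psi>' (w x) * cutoff R x
           \<le> 2 * \<beta> R powr (p - 1) * 12 * (indicat_real (cball 0 (2 * R)) x *\<^sub>R 1)"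
          using annulus[OF R]
        proof eventually_elim
          case (elim x)
          have nn: "0 \<le> (F x \<bullet> W x) * \<psi>' (w x) * cutoff R x"
            by (intro mult_nonneg_nonneg D0 \<psi>b(5) cutoff_properties(2)[OF Rp(1)])
          show ?case
          proof (cases "grad (cutoff R) x = 0")
            case True
            have "0 \<le> 2 * \<beta> R powr (p - 1) * 12 * (indicat_real (cball 0 (2 * R)) x *\<^sub>R 1)"
              by (simp add: indicator_def)
            moreover have "\<Psi> R x = 0" using True by (simp add: \<Psi>_def)
            ultimately show ?thesis using nn by linarith
          next
            case False
            then have b: "norm (U x) \<le> \<beta> R" "norm (V x) \<le> \<beta> R" "x \<in> cball 0 (2 * R)" using elim by auto
            have F2: "norm (F x) \<le> 2 * \<beta> R powr (p - 1)"
              using powr_mono2[of "p - 1", OF _ _ b(1)] powr_mono2[of "p - 1", OF _ _ b(2)] p FUV[of x] by simp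
            have "(norm (grad (cutoff R) x))\<^sup>2 \<le> 128 / R\<^sup>2 * cutoff R x"
              by (rule cutoff_properties(8)[OF Rp(1)])
            also have "\<dots> \<le> 128 / 1 * 1"
              using cutoff_properties(2,3)[OF Rp(1), of x] Rp power_mono[of 1 R 2]
              by (intro mult_mono divide_left_mono) auto
            \<comment> \<open>Here R \<ge> 1, and 128 \<le> 144.\<close>
            finally have "(norm (grad (cutoff R) x))\<^sup>2 \<le> 12\<^sup>2" by simp
            then have g2: "norm (grad (cutoff R) x) \<le> 12"
              by (rule power2_le_imp_le) simp
            have "\<Psi> R x \<le> 1 * (2 * \<beta> R powr (p - 1)) * 12"
              unfolding \<Psi>_def using \<psi>b(1,2) F2 g2 by (intro mult_mono) auto
            then show ?thesis using nn b(3) by simp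
          qed
        qed
      qed
      also have "\<dots> = 2 * \<beta> R powr (p - 1) * 12 * measure lborel (cball (0::'a) (2 * R))" by simp
      finally show ?thesis unfolding Ceq .
    qed
    have I0: "0 \<le> I R" for R
      unfolding I_def using \<Phi>0 by (intro Bochner_Integration.integral_nonneg) auto
    obtain R1 where R1: "R1 \<ge> R0" "\<And>R. R \<ge> R1 \<Longrightarrow> I R = 0"
      by (rule doubling_decay_imp_zero[OF R0 _ C1 I0 decay growthI]) (use \<theta>(2) in auto)
    have "AE x in lborel. indicat_real (cball 0 R) x *\<^sub>R \<Phi> x = 0" if "R \<ge> R1" for R
      using R1(2)[OF that] \<Phi>0 iI[of R] unfolding I_def by (subst (asm) integral_nonneg_eq_0_iff_AE) auto
    \<comment> \<open>Countably many balls exhaust the space, so the exceptional null sets can be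
      united.\<close>
    then have "AE x in lborel. indicat_real (cball 0 (R1 + real n)) x *\<^sub>R \<Phi> x = 0" for n :: nat
      by simp
    then have "AE x in lborel. \<forall>n::nat. indicat_real (cball 0 (R1 + real n)) x *\<^sub>R \<Phi> x = 0"
      by (subst AE_all_countable) simp
    then show ?thesis
    proof eventually_elim
      case (elim x)
      obtain n :: nat where "norm x - R1 \<le> real n" using real_arch_simple by blast
      then have "\<Phi> x = 0" using elim[rule_format, of n] by (simp add: indicator_def)
      show "w x \<le> k"
      proof (rule ccontr)
        assume "\<not> w x \<le> k"
        then have wk: "w x > k" by simp
        then have "0 < w x powr q" using k by simp
        then have "G x > 0" using Gw[OF wk] by (smt (verit) mult_nonneg_nonpos powr_ge_zero)
        then show False using \<open>\<Phi> x = 0\<close> \<psi>b(4)[OF wk] by (simp add: \<Phi>_def)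
      qed
    qed
  qed
  \<comment> \<open>Countably many levels k = 1 / (n + 1) replace the limit of k to 0.\<close>
  have "AE x in lborel. \<forall>n::nat. w x \<le> 1 / real (Suc n)"
    using main by (subst AE_all_countable) simp
  then show ?thesis
  proof eventually_elim
    case (elim x)
    have "w x \<le> 0"
      using elim LIMSEQ_inverse_real_of_nat by (intro LIMSEQ_le_const[of _ 0]) (auto simp: inverse_eq_divide)
    then show ?case by (simp add: w_def)
  qed
qed

section \<open>From Lebesgue measurable functions to Borel representatives\<close>

lemma lebesgue_borel_representative:
  fixes f :: "'a::euclidean_space \<Rightarrow> 'b::euclidean_space"
  assumes f: "f \<in> borel_measurable lebesgue"
  obtains f' where "f' \<in> borel_measurable borel" "AE x in lborel. f x = f' x"
proof -
  have "\<exists>g\<in>borel_measurable lborel. AE x in lborel. f x \<bullet> b = g x" for b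
    using f by (intro completion_ex_borel_measurable_real) auto
  then obtain g where g: "\<And>b. g b \<in> borel_measurable lborel" "\<And>b. AE x in lborel. f x \<bullet> b = g b x"
    by metis
  have [measurable]: "g b \<in> borel_measurable borel" for b using g(1)[of b] by simp
  have "AE x in lborel. \<forall>b\<in>Basis. f x \<bullet> b = g b x"
    using g(2) by (simp add: AE_ball_countable countable_finite)
  then have "AE x in lborel. f x = (\<Sum>b\<in>Basis. g b x *\<^sub>R b)"
  proof eventually_elim
    case (elim x)
    then have "(\<Sum>b\<in>Basis. g b x *\<^sub>R b) = (\<Sum>b\<in>Basis. (f x \<bullet> b) *\<^sub>R b)" by simp
    then show ?case by (simp add: euclidean_representation)
  qed
  moreover have "(\<lambda>x. \<Sum>b\<in>Basis. g b x *\<^sub>R b) \<in> borel_measurable borel" by measurable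
  ultimately show thesis using that by blast
qed

lemma integral_lebesgue_eq_lborel:
  fixes f f' :: "'a::euclidean_space \<Rightarrow> 'b::{banach, second_countable_topology}"
  assumes f: "f \<in> borel_measurable lebesgue" and f': "f' \<in> borel_measurable borel"
    and eq: "AE x in lborel. f x = f' x"
  shows "(LINT x|lebesgue. f x) = (\<integral>x. f' x \<partial>lborel)"
proof -
  have "(LINT x|lebesgue. f x) = (LINT x|lebesgue. f' x)"
    using f f' eq by (intro integral_cong_AE) (auto intro: AE_completion measurable_completion)
  also have "\<dots> = (\<integral>x. f' x \<partial>lborel)"
    using f' by (intro integral_completion) simp
  finally show ?thesis .
qed

lemma L_loc_loc_integrable:
  fixes f f' :: "'a::euclidean_space \<Rightarrow> 'b::euclidean_space"
  assumes f: "f \<in> L_loc r" and [measurable]: "f' \<in> borel_measurable borel"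
    and eq: "AE x in lborel. f x = f' x"
  shows "loc_integrable (\<lambda>x. norm (f' x) powr r)"
  unfolding loc_integrable_def
proof (intro conjI allI)
  fix R :: real
  have [measurable]: "f \<in> borel_measurable lebesgue" and
    i: "integrable lebesgue (\<lambda>x. indicator (cball 0 R) x *\<^sub>R norm (f x) powr r)"
    using f by (auto simp: L_loc_def set_integrable_def)
  have [measurable]: "f' \<in> borel_measurable lebesgue" by (auto intro: measurable_completion)
  have [measurable]: "cball (0::'a) R \<in> sets borel" by simp
  have m: "(\<lambda>x. indicat_real (cball 0 R) x *\<^sub>R norm (f' x) powr r) \<in> borel_measurable borel"
    by measurable
  have "integrable lebesgue (\<lambda>x. indicat_real (cball 0 R) x *\<^sub>R norm (f' x) powr r)"
  proof (rule integrable_cong_AE_imp[OF i])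
    show "AE x in lebesgue. indicat_real (cball 0 R) x *\<^sub>R norm (f x) powr r = indicat_real (cball 0 R) x *\<^sub>R norm (f' x) powr r"
      using AE_completion[OF eq] by eventually_elim simp
    show "(\<lambda>x. indicat_real (cball 0 R) x *\<^sub>R norm (f' x) powr r) \<in> borel_measurable lebesgue"
      using m by (auto intro: measurable_completion)
  qed
  then show "integrable lborel (\<lambda>x. indicat_real (cball 0 R) x *\<^sub>R norm (f' x) powr r)"
    using m by (subst (asm) integrable_completion) auto
qed simp

lemma L_loc_1_loc_integrable:
  fixes f f' :: "'a::euclidean_space \<Rightarrow> 'b::euclidean_space"
  assumes "f \<in> L_loc 1" "f' \<in> borel_measurable borel" "AE x in lborel. f x = f' x"
  shows "loc_integrable f'"
  by (rule loc_integrable_bound[OF L_loc_loc_integrable[OF assms] assms(2)]) simp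

lemma has_weak_gradient_lborel:
  fixes u u' :: "'a::euclidean_space \<Rightarrow> real"
  assumes u: "has_weak_gradient u U"
    and [measurable]: "u' \<in> borel_measurable borel" "U' \<in> borel_measurable borel"
    and eq: "AE x in lborel. u x = u' x" "AE x in lborel. U x = U' x"
  shows "weak_gradient_lborel u' U'"
  unfolding weak_gradient_lborel_def
proof (intro conjI ballI)
  have L: "u \<in> L_loc 1" "U \<in> L_loc 1" using u by (auto simp: has_weak_gradient_def)
  then have [measurable]: "u \<in> borel_measurable lebesgue" "U \<in> borel_measurable lebesgue"
    by (auto simp: L_loc_def)
  show "loc_integrable u'" "loc_integrable U'"
    using L_loc_1_loc_integrable[OF L(1) _ eq(1)] L_loc_1_loc_integrable[OF L(2) _ eq(2)] by auto
  fix \<phi> :: "'a \<Rightarrow> real" and i :: 'a assume \<phi>: "\<phi> \<in> C1_0" and i: "i \<in> Basis"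
  have [measurable]: "\<phi> \<in> borel_measurable borel" "grad \<phi> \<in> borel_measurable borel"
    "\<phi> \<in> borel_measurable lebesgue" "grad \<phi> \<in> borel_measurable lebesgue"
    using \<phi> by (auto intro: measurable_completion)
  have "(LINT x|lebesgue. u x * (grad \<phi> x \<bullet> i)) = (\<integral>x. u' x * (grad \<phi> x \<bullet> i) \<partial>lborel)"
    by (rule integral_lebesgue_eq_lborel) (use eq(1) in auto)
  moreover have "(LINT x|lebesgue. (U x \<bullet> i) * \<phi> x) = (\<integral>x. (U' x \<bullet> i) * \<phi> x \<partial>lborel)"
    by (rule integral_lebesgue_eq_lborel) (use eq(2) in auto)
  ultimately show "(\<integral>x. u' x * (grad \<phi> x \<bullet> i) \<partial>lborel) = - (\<integral>x. (U' x \<bullet> i) * \<phi> x \<partial>lborel)"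
    using u \<phi> i by (simp add: has_weak_gradient_def)
qed

lemma loc_integrable_p_flux:
  fixes U :: "'a::euclidean_space \<Rightarrow> 'a"
  assumes p: "p > 1" and [measurable]: "U \<in> borel_measurable borel"
    and Up: "loc_integrable (\<lambda>x. norm (U x) powr p)"
  shows "loc_integrable (\<lambda>x. norm (U x) powr (p - 2) *\<^sub>R U x)"
proof (rule loc_integrable_bound[OF loc_integrable_add[OF Up loc_integrable_const[of 1]]])
  show "norm (norm (U x) powr (p - 2) *\<^sub>R U x) \<le> norm (U x) powr p + 1" for x
    using powr_mult_le_add[of "norm (U x)" 1 p] p unfolding norm_p_flux by simp
qed simp

lemma loc_integrable_odd_power:
  fixes u :: "'a::euclidean_space \<Rightarrow> real"
  assumes q: "q > 0" and [measurable]: "u \<in> borel_measurable borel"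
    and uq: "loc_integrable (\<lambda>x. \<bar>u x\<bar> powr q)"
  shows "loc_integrable (\<lambda>x. \<bar>u x\<bar> powr (q - 1) * u x)"
  by (rule loc_integrable_bound[OF uq]) (use q in \<open>auto simp: odd_power_abs\<close>)

text \<open>The growth condition of \<open>class_K\<close> for a given gradient instead of
  \<open>weak_grad u\<close>; it can thus be stated for the zero gradient of a constant.\<close>

definition subcritical_growth :: "real \<Rightarrow> ('a::euclidean_space \<Rightarrow> 'a) \<Rightarrow> bool" where
  "subcritical_growth p U \<longleftrightarrow> (\<exists>\<theta> c R. \<theta> < 1 / (p - 2) \<and> c > 0 \<and>
     (AE x in lebesgue. norm x \<ge> R \<longrightarrow> norm (U x) \<le> c * norm x powr \<theta>))"

text \<open>Only the difference of two weak formulations enters, so \<open>h\<close> is absent. The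
  gradients are arbitrary weak gradients and not \<open>weak_grad\<close>: a constant can be
  compared using the gradient 0.\<close>

lemma comparison_principle:
  fixes u v :: "'a::euclidean_space \<Rightarrow> real" and U V :: "'a \<Rightarrow> 'a" and p q :: real
  assumes p: "p > 2" and q: "q > 1"
    and uU: "has_weak_gradient u U" and vV: "has_weak_gradient v V"
    and Up: "U \<in> L_loc p" and Vp: "V \<in> L_loc p" and uq: "u \<in> L_loc q" and vq: "v \<in> L_loc q"
    and gU: "subcritical_growth p U" and gV: "subcritical_growth p V"
    and ineq: "\<And>\<phi>. \<phi> \<in> C1_0 \<Longrightarrow> (\<And>x. 0 \<le> \<phi> x) \<Longrightarrow>
        (LINT x|lebesgue. (norm (U x) powr (p - 2) *\<^sub>R U x) \<bullet> grad \<phi> x) + (LINT x|lebesgue. \<bar>u x\<bar> powr (q - 1) * u x * \<phi> x)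
        \<le> (LINT x|lebesgue. (norm (V x) powr (p - 2) *\<^sub>R V x) \<bullet> grad \<phi> x) + (LINT x|lebesgue. \<bar>v x\<bar> powr (q - 1) * v x * \<phi> x)"
  shows "AE x in lebesgue. u x \<le> v x"
proof -
  have [measurable]: "u \<in> borel_measurable lebesgue" "U \<in> borel_measurable lebesgue"
      "v \<in> borel_measurable lebesgue" "V \<in> borel_measurable lebesgue"
    using uq vq Up Vp by (auto simp: L_loc_def)
  obtain u' where u'm [measurable]: "u' \<in> borel_measurable borel" and u': "AE x in lborel. u x = u' x"
    using lebesgue_borel_representative[of u] by auto
  obtain U' where U'm [measurable]: "U' \<in> borel_measurable borel" and U': "AE x in lborel. U x = U' x"
    using lebesgue_borel_representative[of U] by auto
  obtain v' where v'm [measurable]: "v' \<in> borel_measurable borel" and v': "AE x in lborel. v x = v' x"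
    using lebesgue_borel_representative[of v] by auto
  obtain V' where V'm [measurable]: "V' \<in> borel_measurable borel" and V': "AE x in lborel. V x = V' x"
    using lebesgue_borel_representative[of V] by auto
  note uq' = L_loc_loc_integrable[OF uq u'm u', unfolded real_norm_def]
    and vq' = L_loc_loc_integrable[OF vq v'm v', unfolded real_norm_def]
    and Up' = L_loc_loc_integrable[OF Up U'm U'] and Vp' = L_loc_loc_integrable[OF Vp V'm V']
  obtain \<theta>1 c1 R1 where g1: "\<theta>1 < 1 / (p - 2)" "c1 > 0" "AE x in lebesgue. norm x \<ge> R1 \<longrightarrow> norm (U x) \<le> c1 * norm x powr \<theta>1"
    using gU by (auto simp: subcritical_growth_def)
  obtain \<theta>2 c2 R2 where g2: "\<theta>2 < 1 / (p - 2)" "c2 > 0" "AE x in lebesgue. norm x \<ge> R2 \<longrightarrow> norm (V x) \<le> c2 * norm x powr \<theta>2"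
    using gV by (auto simp: subcritical_growth_def)
  \<comment> \<open>One growth bound for both gradients. The entry 0 gives \<theta> \<ge> 0; the
    entry 1 puts \<open>norm x\<close> in the range where powers increase with the exponent.\<close>
  define \<theta> c R0 where "\<theta> = max 0 (max \<theta>1 \<theta>2)" and "c = max c1 c2" and "R0 = max 1 (max R1 R2)"
  have "\<theta> < 1 / (p - 2)" using g1 g2 p by (simp add: \<theta>_def)
  then have "\<theta> * (p - 2) < 1" using p by (simp add: pos_less_divide_eq)
  then have \<theta>: "\<theta> \<ge> 0" "\<theta> * (p - 2) < 2" by (auto simp: \<theta>_def)
  have mono: "c1 * r powr \<theta>1 \<le> c * r powr \<theta>" "c2 * r powr \<theta>2 \<le> c * r powr \<theta>" if "r \<ge> R0" for r
    using that g1(2) g2(2) by (auto simp: c_def \<theta>_def R0_def intro!: mult_mono powr_mono)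
  have growth: "AE x in lborel. R0 \<le> norm x \<longrightarrow>
        norm (U' x) \<le> c * norm x powr \<theta> \<and> norm (V' x) \<le> c * norm x powr \<theta>"
    using g1(3)[unfolded AE_completion_iff] g2(3)[unfolded AE_completion_iff] U' V'
  proof eventually_elim
    case (elim x)
    show ?case
    proof
      assume x: "R0 \<le> norm x"
      then have "norm x \<ge> R1" "norm x \<ge> R2" by (auto simp: R0_def)
      then show "norm (U' x) \<le> c * norm x powr \<theta> \<and> norm (V' x) \<le> c * norm x powr \<theta>"
        using elim mono[OF x] by force
    qed
  qed
  have "AE x in lborel. u' x \<le> v' x"
  proof (rule comparison_lborel[OF p q has_weak_gradient_lborel[OF uU u'm U'm u' U']
        has_weak_gradient_lborel[OF vV v'm V'm v' V'] Up' Vp' uq' vq' \<theta> _ _ growth])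
    show "c > 0" "R0 \<ge> 1" using g1 g2 by (auto simp: c_def R0_def)
    fix \<phi> :: "'a \<Rightarrow> real" assume \<phi>: "\<phi> \<in> C1_0" and \<phi>0: "\<And>x. 0 \<le> \<phi> x"
    have [measurable]: "\<phi> \<in> borel_measurable borel" "grad \<phi> \<in> borel_measurable borel"
      "\<phi> \<in> borel_measurable lebesgue" "grad \<phi> \<in> borel_measurable lebesgue"
      using \<phi> by (auto intro: measurable_completion)
    have 1: "(LINT x|lebesgue. (norm (U x) powr (p - 2) *\<^sub>R U x) \<bullet> grad \<phi> x) = (\<integral>x. (norm (U' x) powr (p - 2) *\<^sub>R U' x) \<bullet> grad \<phi> x \<partial>lborel)"
      by (rule integral_lebesgue_eq_lborel) (use U' in auto)
    have 2: "(LINT x|lebesgue. (norm (V x) powr (p - 2) *\<^sub>R V x) \<bullet> grad \<phi> x) = (\<integral>x. (norm (V' x) powr (p - 2) *\<^sub>R V' x) \<bullet> grad \<phi> x \<partial>lborel)"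
      by (rule integral_lebesgue_eq_lborel) (use V' in auto)
    have 3: "(LINT x|lebesgue. \<bar>u x\<bar> powr (q - 1) * u x * \<phi> x) = (\<integral>x. \<bar>u' x\<bar> powr (q - 1) * u' x * \<phi> x \<partial>lborel)"
      by (rule integral_lebesgue_eq_lborel) (use u' in auto)
    have 4: "(LINT x|lebesgue. \<bar>v x\<bar> powr (q - 1) * v x * \<phi> x) = (\<integral>x. \<bar>v' x\<bar> powr (q - 1) * v' x * \<phi> x \<partial>lborel)"
      by (rule integral_lebesgue_eq_lborel) (use v' in auto)
    have p1: "p > 1" "q > 0" using p q by auto
    \<comment> \<open>Splitting the integral of the difference needs each of the four pieces to be
      integrable.\<close>
    note I = C1_0_mult_integrable(4)[OF \<phi> loc_integrable_p_flux[OF p1(1) U'm Up']]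
      C1_0_mult_integrable(4)[OF \<phi> loc_integrable_p_flux[OF p1(1) V'm Vp']]
      C1_0_mult_integrable(1)[OF \<phi> loc_integrable_odd_power[OF p1(2) u'm uq']]
      C1_0_mult_integrable(1)[OF \<phi> loc_integrable_odd_power[OF p1(2) v'm vq']]
    have "(\<integral>x. (norm (U' x) powr (p - 2) *\<^sub>R U' x - norm (V' x) powr (p - 2) *\<^sub>R V' x) \<bullet> grad \<phi> x
        + (\<bar>u' x\<bar> powr (q - 1) * u' x - \<bar>v' x\<bar> powr (q - 1) * v' x) * \<phi> x \<partial>lborel)
      = (\<integral>x. (norm (U' x) powr (p - 2) *\<^sub>R U' x) \<bullet> grad \<phi> x \<partial>lborel) - (\<integral>x. (norm (V' x) powr (p - 2) *\<^sub>R V' x) \<bullet> grad \<phi> x \<partial>lborel)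
        + ((\<integral>x. \<bar>u' x\<bar> powr (q - 1) * u' x * \<phi> x \<partial>lborel) - (\<integral>x. \<bar>v' x\<bar> powr (q - 1) * v' x * \<phi> x \<partial>lborel))"
      unfolding inner_diff_left left_diff_distrib using I
      by (simp only: Bochner_Integration.integral_add Bochner_Integration.integral_diff Bochner_Integration.integrable_diff)
    also have "\<dots> \<le> 0"
      using ineq[OF \<phi> \<phi>0] unfolding 1 2 3 4 by linarith
    finally show "(\<integral>x. (norm (U' x) powr (p - 2) *\<^sub>R U' x - norm (V' x) powr (p - 2) *\<^sub>R V' x) \<bullet> grad \<phi> x
        + (\<bar>u' x\<bar> powr (q - 1) * u' x - \<bar>v' x\<bar> powr (q - 1) * v' x) * \<phi> x \<partial>lborel) \<le> 0" .
  qed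
  with u' v' have "AE x in lborel. u x \<le> v x" by eventually_elim simp
  then show ?thesis by (rule AE_completion)
qed

section \<open>Constants as comparison functions, and essential bounds\<close>

lemma C1_0_integral_grad_inner:
  fixes \<phi> :: "'a::euclidean_space \<Rightarrow> real"
  assumes \<phi>: "\<phi> \<in> C1_0" and i: "i \<in> Basis"
  shows "(\<integral>x. grad \<phi> x \<bullet> i \<partial>lborel) = 0"
proof (rule ccontr)
  \<comment> \<open>A difference quotient argument: by translation invariance the increment of
    \<phi> integrates to 0, so t |a| is at most the integral of the first-order remainder, which is
    below t |a| for a small step t.\<close>
  define a where "a = (\<integral>x. grad \<phi> x \<bullet> i \<partial>lborel)"
  assume "\<not> ?thesis"
  then have a: "\<bar>a\<bar> > 0" by (simp add: a_def)
  obtain R where R: "R > 0" "\<And>x. norm x > R \<Longrightarrow> \<phi> x = 0" "\<And>x. norm x > R \<Longrightarrow> grad \<phi> x = 0"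
    using C1_0_support[OF \<phi>] by metis
  define V where "V = measure lborel (cball (0::'a) (R + 1))"
  have V: "V \<ge> 0" by (simp add: V_def)
  \<comment> \<open>Small enough that the remainder, integrated over a ball of volume
    \<open>V\<close>, stays below |a|; the added 1 keeps the denominator positive.\<close>
  define e where "e = \<bar>a\<bar> / (2 * (V + 1))"
  have e: "e > 0" "e * V < \<bar>a\<bar>"
    using a V add_nonneg_pos[OF mult_nonneg_nonneg[OF V abs_ge_zero[of a]], of "\<bar>a\<bar> * 2"]
    by (auto simp: e_def field_simps)
  obtain d where d: "d > 0" "\<And>z h. norm h < d \<Longrightarrow> \<bar>\<phi> (z + h) - \<phi> z - h \<bullet> grad \<phi> z\<bar> \<le> e * norm h"
    using C1_0_uniform_differentiable[OF \<phi> e(1)] by blast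
  \<comment> \<open>A step of at most 1 keeps the shifted support in the ball of radius
    \<open>R + 1\<close>.\<close>
  define t where "t = min (d / 2) 1"
  have t: "0 < t" "t < d" "t \<le> 1" using d(1) by (auto simp: t_def)
  define h where "h = t *\<^sub>R i"
  have nh: "norm h = t" using t i by (simp add: h_def)
  note I = C1_0_integrable[OF \<phi>]
  have I1: "integrable lborel (\<lambda>x. \<phi> (h + x))" by (rule integrable_lborel_translate[OF I(1)])
  have I2: "integrable lborel (\<lambda>x. t * (grad \<phi> x \<bullet> i))" using I(2) by simp
  have ind: "integrable lborel (\<lambda>x. e * t * indicat_real (cball (0::'a) (R + 1)) x)"
    by (intro integrable_mult_right integrable_real_indicator emeasure_bounded_finite) auto
  have "(\<integral>x. \<phi> (h + x) - \<phi> x - t * (grad \<phi> x \<bullet> i) \<partial>lborel) = - (t * a)"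
    using I1 I2 I(1) integral_lborel_translate[of \<phi> h] C1_0_measurable[OF \<phi>] by (simp add: a_def)
  then have "t * \<bar>a\<bar> = \<bar>\<integral>x. \<phi> (h + x) - \<phi> x - t * (grad \<phi> x \<bullet> i) \<partial>lborel\<bar>"
    using t by (simp add: abs_mult)
  also have "\<dots> \<le> (\<integral>x. \<bar>\<phi> (h + x) - \<phi> x - t * (grad \<phi> x \<bullet> i)\<bar> \<partial>lborel)"
    by (rule integral_abs_bound)
  also have "\<dots> \<le> (\<integral>x. e * t * indicat_real (cball (0::'a) (R + 1)) x \<partial>lborel)"
  proof (rule integral_mono[OF _ ind])
    fix x :: 'a
    show "\<bar>\<phi> (h + x) - \<phi> x - t * (grad \<phi> x \<bullet> i)\<bar> \<le> e * t * indicat_real (cball 0 (R + 1)) x"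
    proof (cases "norm x \<le> R + 1")
      case True
      then show ?thesis
        using d(2)[of h x] nh t by (simp add: h_def add.commute inner_commute)
    next
      case False
      have "norm x \<le> norm (h + x) + norm h" using norm_triangle_ineq4[of "h + x" h] by simp
      then have "norm (h + x) > R" using False nh t by simp
      then show ?thesis using R False by simp
    qed
  qed (use I1 I2 I(1) in auto)
  also have "\<dots> = t * (e * V)" by (simp add: V_def)
  finally have "\<bar>a\<bar> \<le> e * V" using t by simp
  with e(2) show False by simp
qed

lemma const_L_loc: "(\<lambda>_::'a::euclidean_space. k :: 'b::euclidean_space) \<in> L_loc r"
proof -
  have "integrable lebesgue (\<lambda>x. indicat_real K x *\<^sub>R norm k powr r)" if "compact K" for K :: "'a set"
    using that by (intro integrable_scaleR_left integrable_real_indicator)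
      (auto simp: compact_imp_closed sets_completionI_sets intro: emeasure_bounded_finite[unfolded infinity_ennreal_def] compact_imp_bounded)
  then show ?thesis
    by (auto simp: L_loc_def set_integrable_def)
qed

lemma has_weak_gradient_const: "has_weak_gradient (\<lambda>_::'a::euclidean_space. k) (\<lambda>_. 0)"
  unfolding has_weak_gradient_def
proof (intro conjI ballI)
  fix \<phi> :: "'a \<Rightarrow> real" and i :: 'a assume \<phi>: "\<phi> \<in> C1_0" and i: "i \<in> Basis"
  have [measurable]: "grad \<phi> \<in> borel_measurable borel" using \<phi> by auto
  have "(LINT x|lebesgue. k * (grad \<phi> x \<bullet> i)) = (\<integral>x. k * (grad \<phi> x \<bullet> i) \<partial>lborel)"
    by (rule integral_completion) simp
  then show "(LINT x|lebesgue. k * (grad \<phi> x \<bullet> i)) = - (LINT x|lebesgue. (0 \<bullet> i) * \<phi> x)"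
    using C1_0_integral_grad_inner[OF \<phi> i] by simp
qed (rule const_L_loc)+

lemma subcritical_growth_zero: "p > 2 \<Longrightarrow> subcritical_growth p (\<lambda>_. 0)"
  unfolding subcritical_growth_def by (rule exI[of _ 0], rule exI[of _ 1]) auto

lemma odd_power_surj:
  fixes H q :: real
  assumes "q > 0"
  obtains k where "\<bar>k\<bar> powr (q - 1) * k = H"
proof (cases "H = 0")
  case True
  then show thesis using that[of 0] by simp
next
  case False
  define k where "k = sgn H * \<bar>H\<bar> powr (1 / q)"
  have abs: "\<bar>k\<bar> = \<bar>H\<bar> powr (1 / q)" using False by (simp add: k_def abs_mult abs_sgn_eq)
  have "\<bar>k\<bar> powr (q - 1) * k = sgn H * (\<bar>k\<bar> * \<bar>k\<bar> powr (q - 1))"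
    unfolding k_def[symmetric] using abs by (simp add: k_def)
  also have "\<bar>k\<bar> * \<bar>k\<bar> powr (q - 1) = \<bar>k\<bar> powr q" using powr_mult_base[of "\<bar>k\<bar>" "q - 1"] by simp
  also have "\<dots> = \<bar>H\<bar>" using assms False unfolding abs by (simp add: powr_powr)
  also have "sgn H * \<bar>H\<bar> = H" by (simp add: sgn_mult_abs)
  finally show thesis by (rule that)
qed

lemma odd_power_mono:
  fixes u v q :: real
  assumes "u \<le> v" "q \<ge> 1"
  shows "\<bar>u\<bar> powr (q - 1) * u \<le> \<bar>v\<bar> powr (q - 1) * v"
proof (cases "u = v")
  case False
  then have "((v - u) / 2) powr q \<le> \<bar>v\<bar> powr (q - 1) * v - \<bar>u\<bar> powr (q - 1) * u"
    using assms by (intro odd_power_diff_ge) auto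
  then show ?thesis using powr_ge_zero[of "(v - u) / 2" q] by linarith
qed simp

text \<open>Integrability is the substance: an undefined integral would count as 0, and monotonicity
  could fail.\<close>

lemma integral_mult_test_mono:
  fixes h g :: "'a::euclidean_space \<Rightarrow> real"
  assumes h: "h \<in> L_loc 1" and g: "g \<in> L_loc 1" and le: "AE x in lebesgue. h x \<le> g x"
    and \<phi>: "\<phi> \<in> C1_0" and \<phi>0: "\<And>x. 0 \<le> \<phi> x"
  shows "(LINT x|lebesgue. h x * \<phi> x) \<le> (LINT x|lebesgue. g x * \<phi> x)"
proof (rule integral_mono_AE)
  have int: "integrable lebesgue (\<lambda>x. f x * \<phi> x)" if f: "f \<in> L_loc 1" for f :: "'a \<Rightarrow> real"
  proof -
    have [measurable]: "f \<in> borel_measurable lebesgue" using f by (simp add: L_loc_def)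
    have [measurable]: "\<phi> \<in> borel_measurable borel" "\<phi> \<in> borel_measurable lebesgue"
      using \<phi> by (auto intro: measurable_completion)
    obtain f' where f'm [measurable]: "f' \<in> borel_measurable borel" and f': "AE x in lborel. f x = f' x"
      using lebesgue_borel_representative[of f] by auto
    have "integrable lborel (\<lambda>x. f' x * \<phi> x)"
      by (rule C1_0_mult_integrable(1)[OF \<phi> L_loc_1_loc_integrable[OF f f'm f']])
    then have "integrable lebesgue (\<lambda>x. f' x * \<phi> x)"
      by (subst integrable_completion) auto
    then show ?thesis
    proof (rule integrable_cong_AE_imp)
      show "AE x in lebesgue. f' x * \<phi> x = f x * \<phi> x"
        using AE_completion[OF f'] by eventually_elim simp
    qed simp
  qed
  show "integrable lebesgue (\<lambda>x. h x * \<phi> x)" "integrable lebesgue (\<lambda>x. g x * \<phi> x)"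
    by (rule int[OF h], rule int[OF g])
  show "AE x in lebesgue. h x * \<phi> x \<le> g x * \<phi> x"
    using le by eventually_elim (intro mult_right_mono \<phi>0)
qed

text \<open>The supremum is attained along a sequence, so only countably many null sets have to be
  united.\<close>

lemma essinf_AE: "AE x in M. essinf M f \<le> f x"
proof -
  let ?A = "{z. AE x in M. z \<le> f x}"
  have "?A \<noteq> {}" by (auto intro!: exI[of _ "-\<infinity>"])
  then obtain z :: "nat \<Rightarrow> ereal" where z: "range z \<subseteq> ?A" "Sup ?A = (SUP i. z i)"
    using Sup_countable_SUP by metis
  then have "AE x in M. \<forall>i. z i \<le> f x" by (subst AE_all_countable) auto
  then show ?thesis unfolding essinf_def z(2) by eventually_elim (auto intro: SUP_least)
qed

theorem theorem1p4:
  fixes p q :: real and h :: "real ^ 'n \<Rightarrow> real"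
  assumes "p > 2" and "q > p - 1" and "h \<in> L_loc 1"
  shows "(\<forall>u v. u \<in> class_K p q \<and> weak_solution p q h u \<and> v \<in> class_K p q \<and> weak_solution p q h v
            \<longrightarrow> (AE x in lebesgue. u x = v x)) \<and>
         (\<forall>v. v \<in> class_K p q \<and> weak_solution p q h v
            \<longrightarrow> (AE x in lebesgue.
                  essinf lebesgue (\<lambda>x. ereal (h x)) \<le> ereal (\<bar>v x\<bar> powr (q - 1) * v x) \<and>
                  ereal (\<bar>v x\<bar> powr (q - 1) * v x) \<le> esssup lebesgue (\<lambda>x. ereal (h x))))"
proof -
  have q: "q > 1" using assms by simp
  \<comment> \<open>\<open>someI\<close> turns the existence of a weak gradient into the fact that
    the chosen representative \<open>weak_grad u\<close> is one.\<close>
  have K: "has_weak_gradient u (weak_grad u)" "weak_grad u \<in> L_loc p" "u \<in> L_loc q" "subcritical_growth p (weak_grad u)"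
    if "u \<in> class_K p q" for u :: "real ^ 'n \<Rightarrow> real"
    using that unfolding class_K_def W1_loc_def subcritical_growth_def weak_grad_def by (auto intro: someI[of "has_weak_gradient u"])
  have sol: "(LINT x|lebesgue. (norm (weak_grad u x) powr (p - 2) *\<^sub>R weak_grad u x) \<bullet> grad \<phi> x)
        + (LINT x|lebesgue. \<bar>u x\<bar> powr (q - 1) * u x * \<phi> x) = (LINT x|lebesgue. h x * \<phi> x)"
    if "weak_solution p q h u" "\<phi> \<in> C1_0" for u \<phi> :: "real ^ 'n \<Rightarrow> real"
    using that by (auto simp: weak_solution_def)
  \<comment> \<open>Both weak formulations have the same right-hand side, so the hypothesis of the
    comparison holds with equality; exchanging the two solutions gives the reverse bound.\<close>
  have uniq: "AE x in lebesgue. u x \<le> v x"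
    if "u \<in> class_K p q" "weak_solution p q h u" "v \<in> class_K p q" "weak_solution p q h v"
    for u v :: "real ^ 'n \<Rightarrow> real"
    by (rule comparison_principle[OF assms(1) q K(1)[OF that(1)] K(1)[OF that(3)] K(2)[OF that(1)] K(2)[OF that(3)]
          K(3)[OF that(1)] K(3)[OF that(3)] K(4)[OF that(1)] K(4)[OF that(3)]])
       (simp only: sol[OF that(2)] sol[OF that(4)] order_refl)
  \<comment> \<open>The flux of the constant \<open>k\<close> vanishes, so what remains to check is
    that the integral of \<open>h\<close> against a nonnegative test function is at most that of
    \<open>H\<close>.\<close>
  have upper: "AE x in lebesgue. \<bar>v x\<bar> powr (q - 1) * v x \<le> H"
    if v: "v \<in> class_K p q" "weak_solution p q h v" and H: "AE x in lebesgue. h x \<le> H"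
    for v :: "real ^ 'n \<Rightarrow> real" and H
  proof -
    obtain k where k: "\<bar>k\<bar> powr (q - 1) * k = H" using odd_power_surj[of q H] q by auto
    have "AE x in lebesgue. v x \<le> k"
    proof (rule comparison_principle[OF assms(1) q K(1)[OF v(1)] has_weak_gradient_const K(2)[OF v(1)] const_L_loc
          K(3)[OF v(1)] const_L_loc K(4)[OF v(1)] subcritical_growth_zero[OF assms(1)]])
      fix \<phi> :: "real ^ 'n \<Rightarrow> real" assume \<phi>: "\<phi> \<in> C1_0" "\<And>x. 0 \<le> \<phi> x"
      show "(LINT x|lebesgue. (norm (weak_grad v x) powr (p - 2) *\<^sub>R weak_grad v x) \<bullet> grad \<phi> x)
        + (LINT x|lebesgue. \<bar>v x\<bar> powr (q - 1) * v x * \<phi> x)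
        \<le> (LINT x|lebesgue. (norm (0::real ^ 'n) powr (p - 2) *\<^sub>R 0) \<bullet> grad \<phi> x) + (LINT x|lebesgue. \<bar>k\<bar> powr (q - 1) * k * \<phi> x)"
        unfolding sol[OF v(2) \<phi>(1)] k
        using integral_mult_test_mono[OF assms(3) const_L_loc H \<phi>] by simp
    qed
    then show ?thesis unfolding k[symmetric] by eventually_elim (use q in \<open>auto intro: odd_power_mono\<close>)
  qed
  have lower: "AE x in lebesgue. H \<le> \<bar>v x\<bar> powr (q - 1) * v x"
    if v: "v \<in> class_K p q" "weak_solution p q h v" and H: "AE x in lebesgue. H \<le> h x"
    for v :: "real ^ 'n \<Rightarrow> real" and H
  proof -
    obtain k where k: "\<bar>k\<bar> powr (q - 1) * k = H" using odd_power_surj[of q H] q by auto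
    have "AE x in lebesgue. k \<le> v x"
    proof (rule comparison_principle[OF assms(1) q has_weak_gradient_const K(1)[OF v(1)] const_L_loc K(2)[OF v(1)]
          const_L_loc K(3)[OF v(1)] subcritical_growth_zero[OF assms(1)] K(4)[OF v(1)]])
      fix \<phi> :: "real ^ 'n \<Rightarrow> real" assume \<phi>: "\<phi> \<in> C1_0" "\<And>x. 0 \<le> \<phi> x"
      show "(LINT x|lebesgue. (norm (0::real ^ 'n) powr (p - 2) *\<^sub>R 0) \<bullet> grad \<phi> x) + (LINT x|lebesgue. \<bar>k\<bar> powr (q - 1) * k * \<phi> x)
        \<le> (LINT x|lebesgue. (norm (weak_grad v x) powr (p - 2) *\<^sub>R weak_grad v x) \<bullet> grad \<phi> x)
        + (LINT x|lebesgue. \<bar>v x\<bar> powr (q - 1) * v x * \<phi> x)"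
        unfolding sol[OF v(2) \<phi>(1)] k
        using integral_mult_test_mono[OF const_L_loc assms(3) H \<phi>] by simp
    qed
    then show ?thesis unfolding k[symmetric] by eventually_elim (use q in \<open>auto intro: odd_power_mono\<close>)
  qed
  \<comment> \<open>Only a finite essential supremum has content: the value \<infinity> bounds
    everything, and - \<infinity> contradicts \<open>h\<close> being real-valued.\<close>
  have sup: "AE x in lebesgue. ereal (\<bar>v x\<bar> powr (q - 1) * v x) \<le> esssup lebesgue (\<lambda>x. ereal (h x))"
    if v: "v \<in> class_K p q" "weak_solution p q h v" for v :: "real ^ 'n \<Rightarrow> real"
  proof (cases "esssup lebesgue (\<lambda>x. ereal (h x))")
    case (real H)
    have "AE x in lebesgue. h x \<le> H"
      using esssup_AE[of "\<lambda>x. ereal (h x)" lebesgue] by (simp add: real)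
    from upper[OF v this] show ?thesis by (simp add: real)
  next
    case MInf
    have "AE x in lebesgue. ereal (h x) \<le> - \<infinity>"
      using esssup_AE[of "\<lambda>x. ereal (h x)" lebesgue] unfolding MInf .
    then show ?thesis by eventually_elim simp
  qed simp
  have inf: "AE x in lebesgue. essinf lebesgue (\<lambda>x. ereal (h x)) \<le> ereal (\<bar>v x\<bar> powr (q - 1) * v x)"
    if v: "v \<in> class_K p q" "weak_solution p q h v" for v :: "real ^ 'n \<Rightarrow> real"
  proof (cases "essinf lebesgue (\<lambda>x. ereal (h x))")
    case (real H)
    have "AE x in lebesgue. H \<le> h x"
      using essinf_AE[of lebesgue "\<lambda>x. ereal (h x)"] by (simp add: real)
    from lower[OF v this] show ?thesis by (simp add: real)
  next
    case PInf
    have "AE x in lebesgue. \<infinity> \<le> ereal (h x)"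
      using essinf_AE[of lebesgue "\<lambda>x. ereal (h x)"] unfolding PInf .
    then show ?thesis by eventually_elim simp
  qed simp
  show ?thesis
  proof (intro conjI allI impI)
    fix u v :: "real ^ 'n \<Rightarrow> real"
    assume A: "u \<in> class_K p q \<and> weak_solution p q h u \<and> v \<in> class_K p q \<and> weak_solution p q h v"
    then have "AE x in lebesgue. u x \<le> v x" "AE x in lebesgue. v x \<le> u x"
      using uniq by blast+
    then show "AE x in lebesgue. u x = v x" by eventually_elim simp
  next
    fix v :: "real ^ 'n \<Rightarrow> real"
    assume "v \<in> class_K p q \<and> weak_solution p q h v"
    then show "AE x in lebesgue. essinf lebesgue (\<lambda>x. ereal (h x)) \<le> ereal (\<bar>v x\<bar> powr (q - 1) * v x) \<and>
        ereal (\<bar>v x\<bar> powr (q - 1) * v x) \<le> esssup lebesgue (\<lambda>x. ereal (h x))"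
      using inf sup by (auto intro: AE_conjI)
  qed
qed

end
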